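(* Let $\alpha>0$, $\beta>0$, $\boldsymbol{\gamma}=(\gamma_\nu)_{\nu=1}^N\in(0,\infty)^N$, $\boldsymbol{a}_0=(a_{0,\nu})_{\nu=1}^N\in\mathbb{R}^N$, and $\boldsymbol{a}=((a_{i,\nu})_{i=1}^{m_\nu})_{\nu=1}^N$ with all $a_{i,\nu}\in(0,\infty)$; put $a_{\cdot,\nu}=\sum_{i=1}^{m_\nu}a_{i,\nu}$. Assume that $r_\nu+a_{0,\nu}>0$ for all $\nu=1,\dots,N$ and that $r_\nu\ge1$ for all $\nu=1,\dots,N$. Suppose that $$\Big\{\frac{(\alpha+1)\gamma_\nu}{\beta+\gamma_\nu}-a_{\cdot,\nu}\Big\}(r_\nu-1)\le x_\nu\Big\{-\frac{(\alpha+1)\gamma_\nu}{\beta+\gamma_\nu}-\sum_{\lambda\in\Lambda(\nu)}l^{(\lambda)}-a_{0,\nu}\Big\}$$ for all $x_\nu\in\mathbb{N}$, for all $\nu=1,\dots,N$. Then the Bayesian predictive mass $\hat f^{(\pi_{\alpha,\beta,\boldsymbol{\gamma},\boldsymbol{a}_0,\boldsymbol{a}})}(\cdot;\boldsymbol{X})$ with respect to the shrinkage prior $\pi_{\alpha,\beta,\boldsymbol{\gamma},\boldsymbol{a}_0,\boldsymbol{a}}$ dominates the Bayesian predictive mass $\hat f^{(\pi_{\boldsymbol{a}_0,\boldsymbol{a}})}(\cdot;\boldsymbol{X})$ with respect to the Dirichlet prior $\pi_{\boldsymbol{a}_0,\boldsymbol{a}}$ under the Kullback--Leibler risk.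
   Context: Notation: $\mathbb{N}=\{1,2,\dots\}$, $\mathbb{N}_0=\{0,1,2,\dots\}$. Let $N\in\mathbb{N}$, $m_1,\dots,m_N\in\mathbb{N}$, $r_1,\dots,r_N>0$. For $\nu=1,\dots,N$, $\boldsymbol{p}_\nu=(p_{i,\nu})_{i=1}^{m_\nu}\in D_{m_\nu}=\{(q_1,\dots,q_{m_\nu}) : q_i>0\ \forall i,\ \sum_iq_i<1\}$ is unknown and $p_{0,\nu}=1-\sum_{i=1}^{m_\nu}p_{i,\nu}$; $\boldsymbol{p}=(\boldsymbol{p}_\nu)_{\nu=1}^N\in D=D_{m_1}\times\dots\times D_{m_N}$. The observation is $\boldsymbol{X}=(\boldsymbol{X}_\nu)_{\nu=1}^N$, with independent negative multinomial $\boldsymbol{X}_\nu=(X_{i,\nu})_{i=1}^{m_\nu}$ having mass function $\frac{\Gamma(r_\nu+\sum_ix_{i,\nu})}{\Gamma(r_\nu)\prod_ix_{i,\nu}!}p_{0,\nu}^{r_\nu}\prod_{i=1}^{m_\nu}p_{i,\nu}^{x_{i,\nu}}$ on $\mathbb{N}_0^{m_\nu}$. Variables to be predicted: let $L\in\mathbb{N}$, $d^{(1)},\dots,d^{(L)}\in\{1,\dots,N\}$, $l^{(1)},\dots,l^{(L)}\in\mathbb{N}$. For $\lambda=1,\dots,L$ let $1\le\nu_1^{(\lambda)}<\dots<\nu_{d^{(\lambda)}}^{(\lambda)}\le N$ be integers, let $I_0^{(\lambda)}=\prod_{h=1}^{d^{(\lambda)}}\{0,1,\dots,m_{\nu_h^{(\lambda)}}\}$,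 and $\mathcal{W}^{(\lambda)}=\{(w_{\boldsymbol{i}})_{\boldsymbol{i}\in I_0^{(\lambda)}} : w_{\boldsymbol{i}}\in\mathbb{N}_0,\ \sum_{\boldsymbol{i}}w_{\boldsymbol{i}}=l^{(\lambda)}\}$. The multinomial tables $\boldsymbol{W}^{(1)},\dots,\boldsymbol{W}^{(L)}$ are independent of each other and of $\boldsymbol{X}$, and $\boldsymbol{W}^{(\lambda)}$ has mass function $$f_\lambda(\boldsymbol{w}^{(\lambda)}|\boldsymbol{p})=\frac{l^{(\lambda)}!}{\prod_{\boldsymbol{i}\in I_0^{(\lambda)}}w^{(\lambda)}_{\boldsymbol{i}}!}\prod_{\boldsymbol{i}=(i_h)_{h}\in I_0^{(\lambda)}}\Big\{\prod_{h=1}^{d^{(\lambda)}}p_{i_h,\nu_h^{(\lambda)}}\Big\}^{w^{(\lambda)}_{\boldsymbol{i}}},\qquad \boldsymbol{w}^{(\lambda)}\in\mathcal{W}^{(\lambda)}.$$ Let $\mathcal{W}=\mathcal{W}^{(1)}\times\dots\times\mathcal{W}^{(L)}$, $\boldsymbol{W}=(\boldsymbol{W}^{(\lambda)})_{\lambda=1}^L$ and $f(\boldsymbol{w}|\boldsymbol{p})=\prod_{\lambda=1}^Lf_\lambda(\boldsymbol{w}^{(\lambda)}|\boldsymbol{p})$ for $\boldsymbol{w}\in\mathcal{W}$. For $\nu=1,\dots,N$, $\Lambda(\nu)=\{\lambda\in\{1,\dots,L\} : \nu\in\{\nu_1^{(\lambda)},\dots,\nu_{d^{(\lambda)}}^{(\lambda)}\}\}$.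 Risk: a predictive mass $\hat f(\cdot;\boldsymbol{X})$ (an estimator of $f(\cdot|\boldsymbol{p})$ based on $\boldsymbol{X}$) has Kullback--Leibler risk $E[\log\{f(\boldsymbol{W}|\boldsymbol{p})/\hat f(\boldsymbol{W};\boldsymbol{X})\}]$, a function of $\boldsymbol{p}\in D$. One predictive mass dominates another if its risk is less than or equal to the other's for every $\boldsymbol{p}\in D$, with strict inequality for at least one $\boldsymbol{p}$. The Bayesian predictive mass for a (possibly improper) prior density $\pi$ on $D$ is the posterior expectation $\hat f^{(\pi)}(\boldsymbol{w};\boldsymbol{X})=E_\pi[f(\boldsymbol{w}|\boldsymbol{p})\,|\,\boldsymbol{X}]$. Priors (densities on $D$ with respect to Lebesgue measure, up to normalization): $$\pi_{\boldsymbol{a}_0,\boldsymbol{a}}(\boldsymbol{p})\propto\prod_{\nu=1}^N\Big(p_{0,\nu}^{a_{0,\nu}-1}\prod_{i=1}^{m_\nu}p_{i,\nu}^{a_{i,\nu}-1}\Big),$$ $$\pi_{\alpha,\beta,\boldsymbol{\gamma},\boldsymbol{a}_0,\boldsymbol{a}}(\boldsymbol{p})=\int_0^\infty u^{\alpha-1}e^{-\beta u}\Big\{\prod_{\nu=1}^N\Big(p_{0,\nu}^{\gamma_\nu u+a_{0,\nu}-1}\prod_{i=1}^{m_\nu}p_{i,\nu}^{a_{i,\nu}-1}\Big)\Big\}du.$$ *)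

theory Defs
  imports "HOL-Probability.Probability"
begin

text \<open>
  All indices are natural numbers. The parameter \<open>p\<^bsub>i,\<nu>\<^esub>\<close> is \<open>cell_prob (m \<nu>) (p \<nu>) i\<close>,
  for \<open>\<nu> \<in> {1..N}\<close> and \<open>i \<in> {0..m \<nu>}\<close>; only the coordinates with \<open>i \<ge> 1\<close> are stored in \<open>p \<nu>\<close>.
  Likewise \<open>x \<nu> i\<close>, \<open>a \<nu> i\<close> stand for \<open>x\<^bsub>i,\<nu>\<^esub>\<close>, \<open>a\<^bsub>i,\<nu>\<^esub>\<close>, and \<open>nu \<lambda> h\<close> for the integer \<open>\<nu>\<^sub>h\<close>
  belonging to the table with number \<open>\<lambda>\<close>.
\<close>

section \<open>Parameter space\<close>

definition open_simplex :: "nat \<Rightarrow> (nat \<Rightarrow> real) set" where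
  "open_simplex k =
     {q \<in> {1..k} \<rightarrow>\<^sub>E UNIV. (\<forall>i\<in>{1..k}. 0 < q i) \<and> (\<Sum>i=1..k. q i) < 1}"

definition param_space :: "nat \<Rightarrow> (nat \<Rightarrow> nat) \<Rightarrow> (nat \<Rightarrow> nat \<Rightarrow> real) set" where
  "param_space N m = (\<Pi>\<^sub>E \<nu>\<in>{1..N}. open_simplex (m \<nu>))"

definition param_lborel :: "nat \<Rightarrow> (nat \<Rightarrow> nat) \<Rightarrow> (nat \<Rightarrow> nat \<Rightarrow> real) measure" where
  "param_lborel N m = (\<Pi>\<^sub>M \<nu>\<in>{1..N}. \<Pi>\<^sub>M i\<in>{1..m \<nu>}. lborel)"

definition cell_prob :: "nat \<Rightarrow> (nat \<Rightarrow> real) \<Rightarrow> nat \<Rightarrow> real" where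
  "cell_prob k q i = (if i = 0 then 1 - (\<Sum>j=1..k. q j) else q i)"

section \<open>Negative multinomial observation\<close>

definition neg_multinomial_mass :: "nat \<Rightarrow> real \<Rightarrow> (nat \<Rightarrow> real) \<Rightarrow> (nat \<Rightarrow> nat) \<Rightarrow> real" where
  "neg_multinomial_mass k s q y =
     Gamma (s + real (\<Sum>i=1..k. y i)) / (Gamma s * (\<Prod>i=1..k. fact (y i))) *
     cell_prob k q 0 powr s * (\<Prod>i=1..k. cell_prob k q i ^ y i)"

definition obs_space :: "nat \<Rightarrow> (nat \<Rightarrow> nat) \<Rightarrow> (nat \<Rightarrow> nat \<Rightarrow> nat) set" where
  "obs_space N m = (\<Pi>\<^sub>E \<nu>\<in>{1..N}. \<Pi>\<^sub>E i\<in>{1..m \<nu>}. UNIV)"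

definition obs_mass ::
    "nat \<Rightarrow> (nat \<Rightarrow> nat) \<Rightarrow> (nat \<Rightarrow> real) \<Rightarrow> (nat \<Rightarrow> nat \<Rightarrow> real) \<Rightarrow> (nat \<Rightarrow> nat \<Rightarrow> nat) \<Rightarrow> real" where
  "obs_mass N m r p x = (\<Prod>\<nu>=1..N. neg_multinomial_mass (m \<nu>) (r \<nu>) (p \<nu>) (x \<nu>))"

section \<open>Multinomial tables to be predicted\<close>

text \<open>
  The following definitions concern a single table, with \<open>dd\<close>, \<open>ll\<close>, \<open>n h\<close> for
  \<open>d \<lambda>\<close>, \<open>l \<lambda>\<close>, \<open>nu \<lambda> h\<close>.
\<close>

definition table_cells :: "(nat \<Rightarrow> nat) \<Rightarrow> nat \<Rightarrow> (nat \<Rightarrow> nat) \<Rightarrow> (nat \<Rightarrow> nat) set" where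
  "table_cells m dd n = (\<Pi>\<^sub>E h\<in>{1..dd}. {0..m (n h)})"

definition tables ::
    "(nat \<Rightarrow> nat) \<Rightarrow> nat \<Rightarrow> nat \<Rightarrow> (nat \<Rightarrow> nat) \<Rightarrow> ((nat \<Rightarrow> nat) \<Rightarrow> nat) set" where
  "tables m dd ll n =
     {v \<in> table_cells m dd n \<rightarrow>\<^sub>E UNIV. (\<Sum>i\<in>table_cells m dd n. v i) = ll}"

definition table_mass ::
    "(nat \<Rightarrow> nat) \<Rightarrow> nat \<Rightarrow> nat \<Rightarrow> (nat \<Rightarrow> nat) \<Rightarrow> (nat \<Rightarrow> nat \<Rightarrow> real) \<Rightarrow> ((nat \<Rightarrow> nat) \<Rightarrow> nat) \<Rightarrow> real"
  where
  "table_mass m dd ll n p v =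
     fact ll / (\<Prod>i\<in>table_cells m dd n. fact (v i)) *
     (\<Prod>i\<in>table_cells m dd n. (\<Prod>h=1..dd. cell_prob (m (n h)) (p (n h)) (i h)) ^ v i)"

definition pred_space ::
    "(nat \<Rightarrow> nat) \<Rightarrow> nat \<Rightarrow> (nat \<Rightarrow> nat) \<Rightarrow> (nat \<Rightarrow> nat) \<Rightarrow> (nat \<Rightarrow> nat \<Rightarrow> nat) \<Rightarrow>
     (nat \<Rightarrow> (nat \<Rightarrow> nat) \<Rightarrow> nat) set" where
  "pred_space m L d l nu = (\<Pi>\<^sub>E lam\<in>{1..L}. tables m (d lam) (l lam) (nu lam))"

definition pred_mass ::
    "(nat \<Rightarrow> nat) \<Rightarrow> nat \<Rightarrow> (nat \<Rightarrow> nat) \<Rightarrow> (nat \<Rightarrow> nat) \<Rightarrow> (nat \<Rightarrow> nat \<Rightarrow> nat) \<Rightarrow>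
     (nat \<Rightarrow> nat \<Rightarrow> real) \<Rightarrow> (nat \<Rightarrow> (nat \<Rightarrow> nat) \<Rightarrow> nat) \<Rightarrow> real" where
  "pred_mass m L d l nu p w =
     (\<Prod>lam=1..L. table_mass m (d lam) (l lam) (nu lam) p (w lam))"

definition tables_involving ::
    "nat \<Rightarrow> (nat \<Rightarrow> nat) \<Rightarrow> (nat \<Rightarrow> nat \<Rightarrow> nat) \<Rightarrow> nat \<Rightarrow> nat set" where
  "tables_involving L d nu \<nu> = {lam \<in> {1..L}. \<nu> \<in> nu lam ` {1..d lam}}"

section \<open>Priors and Bayesian predictive masses\<close>

definition dirichlet_prior ::
    "nat \<Rightarrow> (nat \<Rightarrow> nat) \<Rightarrow> (nat \<Rightarrow> real) \<Rightarrow> (nat \<Rightarrow> nat \<Rightarrow> real) \<Rightarrow> (nat \<Rightarrow> nat \<Rightarrow> real) \<Rightarrow> real" where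
  "dirichlet_prior N m a0 a p =
     (\<Prod>\<nu>=1..N. cell_prob (m \<nu>) (p \<nu>) 0 powr (a0 \<nu> - 1) *
        (\<Prod>i=1..m \<nu>. cell_prob (m \<nu>) (p \<nu>) i powr (a \<nu> i - 1)))"

definition shrinkage_prior ::
    "nat \<Rightarrow> (nat \<Rightarrow> nat) \<Rightarrow> real \<Rightarrow> real \<Rightarrow> (nat \<Rightarrow> real) \<Rightarrow> (nat \<Rightarrow> real) \<Rightarrow> (nat \<Rightarrow> nat \<Rightarrow> real) \<Rightarrow>
     (nat \<Rightarrow> nat \<Rightarrow> real) \<Rightarrow> real" where
  "shrinkage_prior N m \<alpha> \<beta> \<gamma> a0 a p =
     (LBINT u:{0<..}. u powr (\<alpha> - 1) * exp (- \<beta> * u) *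
        (\<Prod>\<nu>=1..N. cell_prob (m \<nu>) (p \<nu>) 0 powr (\<gamma> \<nu> * u + a0 \<nu> - 1) *
           (\<Prod>i=1..m \<nu>. cell_prob (m \<nu>) (p \<nu>) i powr (a \<nu> i - 1))))"

text \<open>
  The posterior expectation of the predictive mass under the (possibly improper, unnormalized)
  prior density \<open>\<pi>\<close>, by Bayes' formula.
\<close>

definition bayes_predictive ::
    "nat \<Rightarrow> (nat \<Rightarrow> nat) \<Rightarrow> (nat \<Rightarrow> real) \<Rightarrow>
     nat \<Rightarrow> (nat \<Rightarrow> nat) \<Rightarrow> (nat \<Rightarrow> nat) \<Rightarrow> (nat \<Rightarrow> nat \<Rightarrow> nat) \<Rightarrow>
     ((nat \<Rightarrow> nat \<Rightarrow> real) \<Rightarrow> real) \<Rightarrow>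
     (nat \<Rightarrow> nat \<Rightarrow> nat) \<Rightarrow> (nat \<Rightarrow> (nat \<Rightarrow> nat) \<Rightarrow> nat) \<Rightarrow> real" where
  "bayes_predictive N m r L d l nu \<pi> x w =
     (LINT p:param_space N m|param_lborel N m.
        pred_mass m L d l nu p w * (obs_mass N m r p x * \<pi> p)) /
     (LINT p:param_space N m|param_lborel N m. obs_mass N m r p x * \<pi> p)"

section \<open>Kullback--Leibler risk and dominance\<close>

text \<open>The joint law of \<open>(X, W)\<close>; the product of the masses expresses all the independence.\<close>

definition joint_law ::
    "nat \<Rightarrow> (nat \<Rightarrow> nat) \<Rightarrow> (nat \<Rightarrow> real) \<Rightarrow>
     nat \<Rightarrow> (nat \<Rightarrow> nat) \<Rightarrow> (nat \<Rightarrow> nat) \<Rightarrow> (nat \<Rightarrow> nat \<Rightarrow> nat) \<Rightarrow>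
     (nat \<Rightarrow> nat \<Rightarrow> real) \<Rightarrow>
     ((nat \<Rightarrow> nat \<Rightarrow> nat) \<times> (nat \<Rightarrow> (nat \<Rightarrow> nat) \<Rightarrow> nat)) measure" where
  "joint_law N m r L d l nu p =
     point_measure (obs_space N m \<times> pred_space m L d l nu)
       (\<lambda>(x, w). ennreal (obs_mass N m r p x * pred_mass m L d l nu p w))"

definition kl_risk ::
    "nat \<Rightarrow> (nat \<Rightarrow> nat) \<Rightarrow> (nat \<Rightarrow> real) \<Rightarrow>
     nat \<Rightarrow> (nat \<Rightarrow> nat) \<Rightarrow> (nat \<Rightarrow> nat) \<Rightarrow> (nat \<Rightarrow> nat \<Rightarrow> nat) \<Rightarrow>
     ((nat \<Rightarrow> nat \<Rightarrow> nat) \<Rightarrow> (nat \<Rightarrow> (nat \<Rightarrow> nat) \<Rightarrow> nat) \<Rightarrow> real) \<Rightarrow>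
     (nat \<Rightarrow> nat \<Rightarrow> real) \<Rightarrow> real" where
  "kl_risk N m r L d l nu g p =
     (LINT (x, w)|joint_law N m r L d l nu p. ln (pred_mass m L d l nu p w / g x w))"

text \<open>
  The value of \<open>kl_risk\<close> is the actual risk only if the logarithm is taken of a positive number and
  the integral exists: the library has \<open>t / 0 = 0\<close> and \<open>ln 0 = 0\<close>, and the integral of a
  non-integrable function is \<open>0\<close>. Dominance therefore includes that the two compared
  risks are well defined and finite, so that these conventions never enter the comparison.
\<close>

definition kl_risk_exists ::
    "nat \<Rightarrow> (nat \<Rightarrow> nat) \<Rightarrow> (nat \<Rightarrow> real) \<Rightarrow>
     nat \<Rightarrow> (nat \<Rightarrow> nat) \<Rightarrow> (nat \<Rightarrow> nat) \<Rightarrow> (nat \<Rightarrow> nat \<Rightarrow> nat) \<Rightarrow>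
     ((nat \<Rightarrow> nat \<Rightarrow> nat) \<Rightarrow> (nat \<Rightarrow> (nat \<Rightarrow> nat) \<Rightarrow> nat) \<Rightarrow> real) \<Rightarrow>
     (nat \<Rightarrow> nat \<Rightarrow> real) \<Rightarrow> bool" where
  "kl_risk_exists N m r L d l nu g p \<longleftrightarrow>
     (\<forall>x\<in>obs_space N m. \<forall>w\<in>pred_space m L d l nu. 0 < g x w) \<and>
     integrable (joint_law N m r L d l nu p)
       (\<lambda>(x, w). ln (pred_mass m L d l nu p w / g x w))"

definition kl_dominates ::
    "nat \<Rightarrow> (nat \<Rightarrow> nat) \<Rightarrow> (nat \<Rightarrow> real) \<Rightarrow>
     nat \<Rightarrow> (nat \<Rightarrow> nat) \<Rightarrow> (nat \<Rightarrow> nat) \<Rightarrow> (nat \<Rightarrow> nat \<Rightarrow> nat) \<Rightarrow>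
     ((nat \<Rightarrow> nat \<Rightarrow> nat) \<Rightarrow> (nat \<Rightarrow> (nat \<Rightarrow> nat) \<Rightarrow> nat) \<Rightarrow> real) \<Rightarrow>
     ((nat \<Rightarrow> nat \<Rightarrow> nat) \<Rightarrow> (nat \<Rightarrow> (nat \<Rightarrow> nat) \<Rightarrow> nat) \<Rightarrow> real) \<Rightarrow> bool" where
  "kl_dominates N m r L d l nu g g' \<longleftrightarrow>
     (\<forall>p\<in>param_space N m.
        kl_risk_exists N m r L d l nu g p \<and> kl_risk_exists N m r L d l nu g' p \<and>
        kl_risk N m r L d l nu g p \<le> kl_risk N m r L d l nu g' p) \<and>
     (\<exists>p\<in>param_space N m. kl_risk N m r L d l nu g p < kl_risk N m r L d l nu g' p)"

end

theory Submission
  imports Defs "HOL-Real_Asymp.Real_Asymp"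
begin

text \<open>
  The argument compares the two predictive masses through an explicit quotient and shows that the
  expected logarithm of this quotient increases with every elementary draw that makes up the
  predicted tables.

  The Dirichlet prior is conjugate, and the shrinkage prior is a mixture over \<open>u > 0\<close> of Dirichlet
  priors in which the exponent of \<open>p\<^bsub>0,\<nu>\<^esub>\<close> is raised by \<open>\<gamma>\<^sub>\<nu> u\<close>. Integrating out \<open>p\<close>
  first, each population contributes a quotient of Gamma functions (\<open>gamma_ratio\<close>), and what remains
  is the one-dimensional integral \<open>F z y\<close> (\<open>mix_integral\<close>). Here \<open>z\<^sub>\<nu>\<close> is the posterior
  Dirichlet parameter of cell \<open>0\<close> in population \<open>\<nu>\<close> and \<open>y\<^sub>\<nu>\<close> is the sum of all parameters.
  The quotient of the shrinkage and the Dirichlet predictive mass at \<open>w\<close> is \<open>F z' y' / F z y\<close>, where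
  \<open>z'\<^sub>\<nu>\<close> adds to \<open>z\<^sub>\<nu>\<close> the number of times that \<open>w\<close> uses cell \<open>0\<close> of \<open>\<nu>\<close>, and \<open>y'\<^sub>\<nu>\<close>
  adds to \<open>y\<^sub>\<nu>\<close> the total number of uses of \<open>\<nu>\<close>. No inequality has been spent up to this point.

  A multinomial table with \<open>l\<close> trials is a sequence of \<open>l\<close> independent cells, and a cell is a
  sequence of independent categorical draws, one for each of its coordinates. Hence it is enough that
  the \<open>potential\<close>, the expectation of \<open>ln (F z y)\<close> over the observation, increases on average when one
  more draw is made from one population \<open>\<nu>\<close> (\<open>potential_drift\<close>); the passage to whole tables is
  \<open>all_tables_drift\<close>.

  For one draw put \<open>s = y (F(y) - F(y+1)) / F(y+1)\<close>, all in coordinate \<open>\<nu>\<close>. A draw of cell \<open>0\<close> changes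
  \<open>F\<close> by the factor \<open>(1 + s/z) / (1 + s/y)\<close> and any other draw by \<open>1 / (1 + s/y)\<close>. So the
  expectation of \<open>p\<^sub>0 ln (1 + s/z) - ln (1 + s/y)\<close> has to be positive. The unknown \<open>p\<^sub>0\<close> is removed
  by the shift identity of the negative multinomial law,
  \<open>E [p\<^sub>i h(X)] = E [X\<^sub>i / (r + n - 1) h(X - e\<^sub>i)]\<close> with \<open>n = \<Sum>\<^sub>i X\<^sub>i\<close>
  (\<open>obs_expectation_shift\<close>). With \<open>\<theta> = (r - 1) / (r + n - 1)\<close> and \<open>t\<close> the value of \<open>s\<close> at the count
  \<open>n - 1\<close>, the following pointwise inequality remains (\<open>one_draw_inequality\<close>):
  \<open>(1 - \<theta>) ln (1 + t/z) + ln (1 + s/y) \<le> ln (1 + s/z)\<close>.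
  Concavity of the logarithm reduces it to a comparison of consecutive first differences of \<open>F\<close> in
  \<open>y\<^sub>\<nu>\<close> (\<open>F_second_difference\<close>), which follows from an integration by parts in \<open>u\<close>
  (\<open>wt_integration_by_parts\<close>) as soon as \<open>z + \<kappa> \<le> \<theta> y\<close> with \<open>\<kappa> = (\<alpha> + 1) \<gamma> / (\<beta> + \<gamma>)\<close>. The
  inequality assumed for all positive counts implies this for every draw that can occur
  (\<open>shape_condition\<close>). When \<open>n = 0\<close> the term with \<open>t\<close> is absent and the inequality is strict, which
  makes the dominance strict at every parameter.

  Finiteness of the risks comes from two facts: the logarithms involved grow at most linearly in the
  observed counts (\<open>ln_F_bound\<close>, \<open>linearly_bounded_ln_dirichlet_ratio\<close>), and the counts have
  exponential moments (\<open>neg_multinomial_mass_exp_moment\<close>).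
\<close>

section \<open>Ratios of Gamma functions\<close>

lemma pos_notin_nonpos_Ints: "0 < (x::real) \<Longrightarrow> x \<notin> \<int>\<^sub>\<le>\<^sub>0"
  by (auto elim!: nonpos_Ints_cases)

text \<open>
  A discrete substitute for \<open>Digamma' y \<ge> 1 / y\<close>. The series of the left-hand difference has the terms
  \<open>(y - z) / ((z + k) (y + k))\<close>, and for \<open>z \<le> y\<close> each is at least \<open>(y - z) / ((y + k + 1) (y + k))\<close>,
  which telescopes.
\<close>

lemma Digamma_diff_ge:
  fixes z y :: real
  assumes z: "0 < z" and zy: "z \<le> y"
  shows "(y - z) / y \<le> Digamma y - Digamma z"
proof -
  have y: "0 < y" using assms by simp
  have lim: "(\<lambda>n. (ln (real n) - (\<Sum>k<n. inverse (y + real k)))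
      - (ln (real n) - (\<Sum>k<n. inverse (z + real k)))) \<longlonglongrightarrow> Digamma y - Digamma z"
    using Digamma_LIMSEQ[of y] Digamma_LIMSEQ[of z] z y
    by (intro tendsto_diff) (auto simp: of_real_def)
  have tel: "(\<Sum>k<n. (y - z) * (1 / (y + real k) - 1 / (y + real (Suc k))))
      = (y - z) * (1 / y - 1 / (y + real n))" for n
    unfolding sum_distrib_left[symmetric] 
    by (subst sum_lessThan_telescope') simp
  \<comment> \<open>The comparison is made for partial sums; the limit is taken afterwards.\<close>
  have le: "(y - z) * (1 / y - 1 / (y + real n)) \<le>
      (ln (real n) - (\<Sum>k<n. inverse (y + real k))) - (ln (real n) - (\<Sum>k<n. inverse (z + real k)))" for n
  proof -
    have "(y - z) * (1 / (y + real k) - 1 / (y + real (Suc k)))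
        \<le> inverse (z + real k) - inverse (y + real k)" for k
    proof -
      have "inverse (z + real k) - inverse (y + real k) = (y - z) * (1 / ((z + real k) * (y + real k)))"
        using z y by (simp add: field_simps add_pos_nonneg)
      moreover have "1 / (y + real k) - 1 / (y + real (Suc k)) = 1 / ((y + real k + 1) * (y + real k))"
        using y by (simp add: divide_simps add_pos_nonneg)
      moreover have "1 / ((y + real k + 1) * (y + real k)) \<le> 1 / ((z + real k) * (y + real k))"
        using z y zy by (intro divide_left_mono mult_right_mono mult_pos_pos) auto
      ultimately show ?thesis using mult_left_mono[of _ _ "y - z"] zy by (simp only:)
    qed
    hence "(\<Sum>k<n. (y - z) * (1 / (y + real k) - 1 / (y + real (Suc k))))
        \<le> (\<Sum>k<n. inverse (z + real k) - inverse (y + real k))" by (intro sum_mono)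
    thus ?thesis unfolding tel by (simp add: sum_subtractf)
  qed
  have "(\<lambda>n. (y - z) * (1 / y - 1 / (y + real n))) \<longlonglongrightarrow> (y - z) * (1 / y - 0)"
    by real_asymp
  from tendsto_le[OF _ lim this] le show ?thesis by simp
qed

text \<open>
  The factor by which raising the parameter of cell \<open>0\<close> by \<open>q\<close> changes the normalizing constant of a
  Dirichlet density with cell-\<open>0\<close> parameter \<open>z\<close> and parameter sum \<open>y\<close>, see \<open>dirichlet_const_shift\<close>.
\<close>

definition gamma_ratio :: "real \<Rightarrow> real \<Rightarrow> real \<Rightarrow> real" where
  "gamma_ratio q z y = Gamma (q + z) * Gamma y / (Gamma (q + y) * Gamma z)"

lemma gamma_ratio_0: "0 < z \<Longrightarrow> 0 < y \<Longrightarrow> gamma_ratio 0 z y = 1"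
  using Gamma_real_pos[of z] Gamma_real_pos[of y] by (simp add: gamma_ratio_def del: Gamma_real_pos)

lemma gamma_ratio_pos: "0 \<le> q \<Longrightarrow> 0 < z \<Longrightarrow> 0 < y \<Longrightarrow> 0 < gamma_ratio q z y"
  by (simp add: gamma_ratio_def Gamma_real_pos)

lemma gamma_ratio_Suc_right:
  assumes "0 \<le> q" "0 < y"
  shows "gamma_ratio q z (y + 1) = gamma_ratio q z y * (y / (q + y))"
proof -
  have "Gamma (y + 1) = y * Gamma y" "Gamma (q + y + 1) = (q + y) * Gamma (q + y)"
    using assms by (auto intro!: Gamma_plus1 pos_notin_nonpos_Ints)
  thus ?thesis by (simp add: gamma_ratio_def add.assoc[symmetric] mult_ac)
qed

lemma gamma_ratio_Suc_left:
  assumes "0 \<le> q" "0 < z"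
  shows "gamma_ratio q (z + 1) y = gamma_ratio q z y * ((q + z) / z)"
proof -
  have "Gamma (z + 1) = z * Gamma z" "Gamma (q + z + 1) = (q + z) * Gamma (q + z)"
    using assms by (auto intro!: Gamma_plus1 pos_notin_nonpos_Ints)
  thus ?thesis by (simp add: gamma_ratio_def add.assoc[symmetric] mult_ac)
qed

lemma gamma_ratio_has_derivative:
  assumes "0 \<le> q" "0 < z" "0 < y"
  shows "((\<lambda>q. gamma_ratio q z y) has_real_derivative
           gamma_ratio q z y * (Digamma (q + z) - Digamma (q + y))) (at q)"
proof -
  have [simp]: "q + z \<notin> \<int>\<^sub>\<le>\<^sub>0" "q + y \<notin> \<int>\<^sub>\<le>\<^sub>0" using assms by (auto intro!: pos_notin_nonpos_Ints)
  have ne: "Gamma z \<noteq> 0" "Gamma y \<noteq> 0" "Gamma (q + z) \<noteq> 0" "Gamma (q + y) \<noteq> 0"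
    using assms by (simp_all add: Gamma_real_pos less_imp_neq[symmetric])
  show ?thesis unfolding gamma_ratio_def
    by (rule derivative_eq_intros refl | simp add: ne)+ (use ne in \<open>simp add: field_simps\<close>)
qed

lemma gamma_ratio_antimono:
  assumes "0 \<le> q" "q \<le> q'" "0 < z" "z \<le> y"
  shows "gamma_ratio q' z y \<le> gamma_ratio q z y"
proof (rule DERIV_nonpos_imp_nonincreasing[OF assms(2)])
  fix x assume x: "q \<le> x" "x \<le> q'"
  have "(y - z) / (x + y) \<le> Digamma (x + y) - Digamma (x + z)"
    using Digamma_diff_ge[of "x + z" "x + y"] assms x by simp
  moreover have "0 \<le> (y - z) / (x + y)" using assms x by simp
  ultimately have "Digamma (x + z) - Digamma (x + y) \<le> 0" by linarith
  hence "gamma_ratio x z y * (Digamma (x + z) - Digamma (x + y)) \<le> 0"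
    using gamma_ratio_pos[of x z y] assms x by (intro mult_nonneg_nonpos) auto
  thus "\<exists>d. ((\<lambda>q. gamma_ratio q z y) has_real_derivative d) (at x) \<and> d \<le> 0"
    using gamma_ratio_has_derivative[of x z y] assms x by auto
qed

lemma gamma_ratio_le_1: "0 \<le> q \<Longrightarrow> 0 < z \<Longrightarrow> z \<le> y \<Longrightarrow> gamma_ratio q z y \<le> 1"
  using gamma_ratio_antimono[of 0 q z y] gamma_ratio_0[of z y] by simp

text \<open>
  Raising \<open>y\<close> by one multiplies the quotient by \<open>y / (q + y)\<close>, and these factors increase with \<open>y\<close>;
  so the decay in \<open>n\<close> is at most geometric. This keeps \<open>ln F\<close> above a linear function of the counts.
\<close>

lemma gamma_ratio_lower_bound:
  assumes "0 \<le> q" "0 < y" and that: "0 < z"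
  shows "gamma_ratio q z (y + real n) \<ge> gamma_ratio q z y * (y / (q + y)) ^ n"
proof (induction n)
  case (Suc n)
  have y: "0 < y + real n" using assms by simp
  have "y / (q + y) \<le> (y + real n) / (q + (y + real n))"
    using assms by (simp add: divide_simps) (simp add: algebra_simps)
  hence "gamma_ratio q z y * (y / (q + y)) ^ n * (y / (q + y))
      \<le> gamma_ratio q z (y + real n) * ((y + real n) / (q + (y + real n)))"
    using Suc assms gamma_ratio_pos[OF assms(1) that y] by (intro mult_mono) auto
  also have "\<dots> = gamma_ratio q z (y + real n + 1)"
    by (rule gamma_ratio_Suc_right[symmetric]) (use assms y in auto)
  finally show ?case by (simp add: mult_ac add_ac)
qed simp

section \<open>The mixing integral and its differences\<close>

text \<open>
  Up to normalization this is the posterior density of the mixing variable \<open>u\<close> under the shrinkage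
  prior.
\<close>

definition mix_weight :: "'i set \<Rightarrow> real \<Rightarrow> real \<Rightarrow> ('i \<Rightarrow> real) \<Rightarrow> ('i \<Rightarrow> real) \<Rightarrow> ('i \<Rightarrow> real) \<Rightarrow> real \<Rightarrow> real" where
  "mix_weight I \<alpha> \<beta> \<gamma> z y u =
     u powr (\<alpha> - 1) * exp (- \<beta> * u) * (\<Prod>\<nu>\<in>I. gamma_ratio (\<gamma> \<nu> * u) (z \<nu>) (y \<nu>))"

definition mix_integral :: "'i set \<Rightarrow> real \<Rightarrow> real \<Rightarrow> ('i \<Rightarrow> real) \<Rightarrow> ('i \<Rightarrow> real) \<Rightarrow> ('i \<Rightarrow> real) \<Rightarrow> real" where
  "mix_integral I \<alpha> \<beta> \<gamma> z y = (LBINT u:{0<..}. mix_weight I \<alpha> \<beta> \<gamma> z y u)"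

lemma gamma_ratio_measurable [measurable]:
  assumes [measurable]: "f \<in> borel_measurable M"
  shows "(\<lambda>x. gamma_ratio (f x) z y) \<in> borel_measurable M"
proof -
  have [measurable]: "(Gamma :: real \<Rightarrow> real) \<in> borel_measurable borel"
  proof -
    have "(rGamma :: real \<Rightarrow> real) \<in> borel_measurable borel"
      by (intro borel_measurable_continuous_onI continuous_on_rGamma)
    hence "(\<lambda>x. inverse (rGamma x) :: real) \<in> borel_measurable borel" by measurable
    thus ?thesis by (simp add: Gamma_def[abs_def])
  qed
  show ?thesis unfolding gamma_ratio_def by measurable
qed

lemma mix_weight_measurable [measurable]: "mix_weight I \<alpha> \<beta> \<gamma> z y \<in> borel_measurable borel"
  unfolding mix_weight_def[abs_def] by measurable

text \<open>
  Every integrand over \<open>u\<close> below is dominated by a Gamma density, because a quotient of Gamma functions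
  with \<open>z \<le> y\<close> is at most \<open>1\<close>.
\<close>

lemma gamma_density_integrable:
  fixes \<alpha> \<beta> :: real
  assumes "0 < \<alpha>" "0 < \<beta>"
  shows "set_integrable lborel {0<..} (\<lambda>u. u powr (\<alpha> - 1) * exp (- \<beta> * u))"
proof -
  have "((\<lambda>t. t powr (\<alpha> - 1) / exp t) has_integral Gamma \<alpha>) {0..}"
    using Gamma_integral_real assms by blast
  hence "((\<lambda>t. t powr (\<alpha> - 1) / exp t) has_integral Gamma \<alpha>) {0<..}"
    by (rule has_integral_spike_set_eq[THEN iffD1, rotated 2];
        intro negligible_subset[OF negligible_sing[of 0]]) auto
  hence "(\<integral>\<^sup>+t. ennreal (t powr (\<alpha> - 1) / exp t) * indicator {0<..} t \<partial>lborel) = ennreal (Gamma \<alpha>)"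
    by (intro nn_integral_has_integral_lebesgue') auto
  hence "integrable lborel (\<lambda>t. indicator {0<..} t * (t powr (\<alpha> - 1) / exp t))"
    by (intro integrableI_nonneg) (auto simp: indicator_mult_ennreal mult.commute ennreal_mult' split: split_indicator)
  from lborel_integrable_real_affine[OF this, of \<beta> 0] assms
  have "integrable lborel (\<lambda>t. indicator {0<..} (\<beta> * t) * ((\<beta> * t) powr (\<alpha> - 1) / exp (\<beta> * t)))" by simp
  hence "integrable lborel (\<lambda>t. \<beta> powr (1 - \<alpha>) * (indicator {0<..} (\<beta> * t) * ((\<beta> * t) powr (\<alpha> - 1) / exp (\<beta> * t))))"
    by (rule integrable_mult_right)
  also have "(\<lambda>t. \<beta> powr (1 - \<alpha>) * (indicator {0<..} (\<beta> * t) * ((\<beta> * t) powr (\<alpha> - 1) / exp (\<beta> * t))))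
      = (\<lambda>u. indicator {0<..} u * (u powr (\<alpha> - 1) * exp (- \<beta> * u)))"
  proof
    fix t :: real
    have "\<beta> powr (1 - \<alpha>) * \<beta> powr (\<alpha> - 1) = 1" using assms by (simp add: powr_add[symmetric])
    thus "\<beta> powr (1 - \<alpha>) * (indicator {0<..} (\<beta> * t) * ((\<beta> * t) powr (\<alpha> - 1) / exp (\<beta> * t)))
      = indicator {0<..} t * (t powr (\<alpha> - 1) * exp (- \<beta> * t))"
      using assms by (auto simp: indicator_def powr_mult exp_minus field_simps zero_less_mult_iff)
  qed
  finally show ?thesis by (simp add: set_integrable_def)
qed

lemma set_integral_pos:
  fixes f :: "real \<Rightarrow> real"
  assumes S: "{0<..<1} \<subseteq> S" and int: "set_integrable lborel S f" and pos: "\<And>u. u \<in> S \<Longrightarrow> 0 < f u"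
  shows "0 < (LBINT u:S. f u)"
proof -
  have i: "integrable lborel (\<lambda>u. indicator S u *\<^sub>R f u)" using int by (simp add: set_integrable_def)
  have nonneg: "0 \<le> indicator S u *\<^sub>R f u" for u using pos[of u] by (auto simp: indicator_def)
  have "(LBINT u:S. f u) \<noteq> 0"
  proof
    assume "(LBINT u:S. f u) = 0"
    hence "AE u in lborel. indicator S u *\<^sub>R f u = 0"
      using integral_nonneg_eq_0_iff_AE[OF i] nonneg by (simp add: set_lebesgue_integral_def)
    hence "AE u in lborel. u \<notin> {0<..<1::real}"
      by (rule AE_mp) (use S pos in \<open>force intro!: AE_I2\<close>)
    hence "emeasure lborel {0<..<1::real} = 0"
      by (subst (asm) AE_iff_measurable[where N = "{0<..<1}"]) auto
    thus False by simp
  qed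
  moreover have "0 \<le> (LBINT u:S. f u)"
    unfolding set_lebesgue_integral_def by (intro Bochner_Integration.integral_nonneg nonneg)
  ultimately show ?thesis by simp
qed

lemma prod_has_log_derivative:
  assumes "finite J"
    and "\<And>i. i \<in> J \<Longrightarrow> (f i has_real_derivative f i x * D i) (at x)"
  shows "((\<lambda>x. \<Prod>i\<in>J. f i x) has_real_derivative (\<Prod>i\<in>J. f i x) * (\<Sum>i\<in>J. D i)) (at x)"
  using assms
proof (induction J rule: finite_induct)
  case (insert j J)
  from insert.hyps insert.prems show ?case
    by (auto intro!: derivative_eq_intros insert.IH simp: algebra_simps)
qed simp

lemma LBINT_cong_pos: "(\<And>u::real. 0 < u \<Longrightarrow> f u = (g u :: real)) \<Longrightarrow> (LBINT u:{0<..}. f u) = (LBINT u:{0<..}. g u)"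
  by (intro set_lebesgue_integral_cong) auto

text \<open>
  The data of the mixture over \<open>u\<close>; the index set \<open>I\<close> numbers the populations.
\<close>

locale mixing =
  fixes I :: "'i set" and \<alpha> \<beta> :: real and \<gamma> :: "'i \<Rightarrow> real"
  assumes fin: "finite I" and \<alpha>: "0 < \<alpha>" and \<beta>: "0 < \<beta>" and \<gamma>: "\<And>\<nu>. \<nu> \<in> I \<Longrightarrow> 0 < \<gamma> \<nu>"
begin

abbreviation "wt \<equiv> mix_weight I \<alpha> \<beta> \<gamma>"
abbreviation "F \<equiv> mix_integral I \<alpha> \<beta> \<gamma>"

definition admissible :: "('i \<Rightarrow> real) \<Rightarrow> ('i \<Rightarrow> real) \<Rightarrow> bool" where
  "admissible z y \<longleftrightarrow> (\<forall>\<nu>\<in>I. 0 < z \<nu> \<and> z \<nu> \<le> y \<nu>)"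

lemma admissibleD:
  assumes "admissible z y" "\<nu> \<in> I"
  shows "0 < z \<nu>" "z \<nu> \<le> y \<nu>" "0 < y \<nu>" "0 < \<gamma> \<nu>"
  using assms \<gamma> by (force simp: admissible_def)+

lemma wt_pos: "admissible z y \<Longrightarrow> 0 < u \<Longrightarrow> 0 < wt z y u"
  unfolding mix_weight_def
  by (intro mult_pos_pos prod_pos gamma_ratio_pos) (auto simp: admissibleD less_imp_le)

lemma wt_le: "admissible z y \<Longrightarrow> 0 < u \<Longrightarrow> wt z y u \<le> u powr (\<alpha> - 1) * exp (- \<beta> * u)"
  unfolding mix_weight_def
  by (intro mult_left_le prod_le_1 conjI gamma_ratio_le_1 less_imp_le[OF gamma_ratio_pos])
     (auto simp: admissibleD less_imp_le)

lemma wt_power_integrable: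
  assumes "admissible z y"
  shows "set_integrable lborel {0<..} (\<lambda>u. u ^ j * wt z y u)"
proof (rule set_integrable_bound[where f = "\<lambda>u. u powr (\<alpha> + real j - 1) * exp (- \<beta> * u)"])
  show "set_integrable lborel {0<..} (\<lambda>u. u powr (\<alpha> + real j - 1) * exp (- \<beta> * u))"
    using \<alpha> \<beta> by (intro gamma_density_integrable) auto
  show "set_borel_measurable lborel {0<..} (\<lambda>u. u ^ j * wt z y u)"
    unfolding set_borel_measurable_def by measurable
  show "AE u in lborel. u \<in> {0<..} \<longrightarrow> norm (u ^ j * wt z y u) \<le> norm (u powr (\<alpha> + real j - 1) * exp (- \<beta> * u))"
  proof (intro AE_I2 impI)
    fix u :: real assume u: "u \<in> {0<..}"
    have "u ^ j * wt z y u \<le> u ^ j * (u powr (\<alpha> - 1) * exp (- \<beta> * u))"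
      using u wt_le[OF assms, of u] by (intro mult_left_mono) auto
    also have "\<dots> = u powr (\<alpha> + real j - 1) * exp (- \<beta> * u)"
      using u by (simp add: powr_realpow[symmetric] powr_add[symmetric] algebra_simps)
    finally show "norm (u ^ j * wt z y u) \<le> norm (u powr (\<alpha> + real j - 1) * exp (- \<beta> * u))"
      using u wt_pos[OF assms, of u] by (simp add: abs_mult)
  qed
qed

lemma wt_bounded_integrable:
  assumes adm: "admissible z y" and [measurable]: "f \<in> borel_measurable borel"
    and b: "\<And>u. 0 < u \<Longrightarrow> \<bar>f u\<bar> \<le> C * u ^ j"
  shows "set_integrable lborel {0<..} (\<lambda>u. f u * wt z y u)"
proof (rule set_integrable_bound[where f = "\<lambda>u. C * (u ^ j * wt z y u)"])
  show "set_integrable lborel {0<..} (\<lambda>u. C * (u ^ j * wt z y u))"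
    using wt_power_integrable[OF adm] by simp
  show "set_borel_measurable lborel {0<..} (\<lambda>u. f u * wt z y u)"
    unfolding set_borel_measurable_def by measurable
  show "AE u in lborel. u \<in> {0<..} \<longrightarrow> norm (f u * wt z y u) \<le> norm (C * (u ^ j * wt z y u))"
  proof (intro AE_I2 impI)
    fix u :: real assume u: "u \<in> {0<..}"
    have "\<bar>f u\<bar> * wt z y u \<le> C * u ^ j * wt z y u"
      using u wt_pos[OF adm, of u] b[of u] by (intro mult_right_mono) auto
    also have "\<dots> \<le> \<bar>C * (u ^ j * wt z y u)\<bar>" by simp
    finally show "norm (f u * wt z y u) \<le> norm (C * (u ^ j * wt z y u))"
      using u wt_pos[OF adm, of u] by (simp add: abs_mult)
  qed
qed

lemma wt_quotient_integrable:
  assumes adm: "admissible z y" and \<nu>: "\<nu> \<in> I"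
  shows "set_integrable lborel {0<..} (\<lambda>u. u\<^sup>2 / (\<gamma> \<nu> * u + y \<nu>) * wt z y u)"
proof (rule wt_bounded_integrable[OF adm, where C = "1 / y \<nu>" and j = 2])
  fix u :: real assume "0 < u"
  thus "\<bar>u\<^sup>2 / (\<gamma> \<nu> * u + y \<nu>)\<bar> \<le> 1 / y \<nu> * u\<^sup>2"
    using admissibleD[OF adm \<nu>]
    by (simp add: add_pos_pos) (intro divide_left_mono, auto intro!: mult_pos_pos add_pos_pos)
qed measurable

lemma F_pos: "admissible z y \<Longrightarrow> 0 < F z y"
  unfolding mix_integral_def
  using wt_power_integrable[of z y 0] by (intro set_integral_pos wt_pos) auto

text \<open>
  The derivative behind the integration by parts. The power \<open>u\<^sup>2\<close> gives \<open>u\<^bsup>\<alpha> + 1\<^esup>\<close> in total, which is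
  where the numerator \<open>\<alpha> + 1\<close> of \<open>(\<alpha> + 1) \<gamma> / (\<beta> + \<gamma>)\<close> comes from.
\<close>

lemma wt_antiderivative:
  assumes adm: "admissible z y" and u: "0 < u"
  shows "((\<lambda>u. u\<^sup>2 * wt z y u) has_real_derivative
           ((\<alpha> + 1) * u - \<beta> * u\<^sup>2
             - u\<^sup>2 * (\<Sum>\<nu>\<in>I. \<gamma> \<nu> * (Digamma (\<gamma> \<nu> * u + y \<nu>) - Digamma (\<gamma> \<nu> * u + z \<nu>)))) * wt z y u) (at u)"
proof -
  let ?P = "\<lambda>u. \<Prod>\<nu>\<in>I. gamma_ratio (\<gamma> \<nu> * u) (z \<nu>) (y \<nu>)"
  let ?D = "\<lambda>\<nu>. Digamma (\<gamma> \<nu> * u + y \<nu>) - Digamma (\<gamma> \<nu> * u + z \<nu>)"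
  have P: "(?P has_real_derivative ?P u * (\<Sum>\<nu>\<in>I. - (\<gamma> \<nu> * ?D \<nu>))) (at u)"
  proof (rule prod_has_log_derivative[OF fin])
    fix \<nu> assume \<nu>: "\<nu> \<in> I"
    have "((\<lambda>u. gamma_ratio (\<gamma> \<nu> * u) (z \<nu>) (y \<nu>)) has_real_derivative
        gamma_ratio (\<gamma> \<nu> * u) (z \<nu>) (y \<nu>) * (Digamma (\<gamma> \<nu> * u + z \<nu>) - Digamma (\<gamma> \<nu> * u + y \<nu>)) * \<gamma> \<nu>) (at u)"
      using \<nu> adm u \<gamma>[OF \<nu>]
      by (intro DERIV_chain2[where f = "\<lambda>q. gamma_ratio q (z \<nu>) (y \<nu>)"] gamma_ratio_has_derivative)
         (auto simp: admissible_def intro!: derivative_eq_intros)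
    thus "((\<lambda>u. gamma_ratio (\<gamma> \<nu> * u) (z \<nu>) (y \<nu>)) has_real_derivative
        gamma_ratio (\<gamma> \<nu> * u) (z \<nu>) (y \<nu>) * - (\<gamma> \<nu> * ?D \<nu>)) (at u)"
      by (simp add: algebra_simps)
  qed
  have "((\<lambda>u. u\<^sup>2 * (u powr (\<alpha> - 1) * exp (- \<beta> * u))) has_real_derivative
      (((\<alpha> + 1) * u - \<beta> * u\<^sup>2) * (u powr (\<alpha> - 1) * exp (- \<beta> * u)))) (at u)"
  proof -
    have "((\<lambda>u. u\<^sup>2 * (u powr (\<alpha> - 1) * exp (- \<beta> * u))) has_real_derivative
      2 * u * (u powr (\<alpha> - 1) * exp (- \<beta> * u)) +
      u\<^sup>2 * ((\<alpha> - 1) * u powr (\<alpha> - 1 - 1) * exp (- \<beta> * u) + u powr (\<alpha> - 1) * (exp (- \<beta> * u) * - \<beta>))) (at u)"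
      using u by (auto intro!: derivative_eq_intros simp: algebra_simps)
    moreover have "u * u powr (\<alpha> - 2) = u powr (\<alpha> - 1)"
      using u powr_mult_base[of u "\<alpha> - 2"] by simp
    hence "u\<^sup>2 * u powr (\<alpha> - 1 - 1) = u * u powr (\<alpha> - 1)"
      by (simp add: power2_eq_square mult.assoc)
    hence "2 * u * (u powr (\<alpha> - 1) * exp (- \<beta> * u)) +
      u\<^sup>2 * ((\<alpha> - 1) * u powr (\<alpha> - 1 - 1) * exp (- \<beta> * u) + u powr (\<alpha> - 1) * (exp (- \<beta> * u) * - \<beta>))
      = ((\<alpha> + 1) * u - \<beta> * u\<^sup>2) * (u powr (\<alpha> - 1) * exp (- \<beta> * u))"
      by algebra
    ultimately show ?thesis by simp
  qed
  from DERIV_mult[OF this P] have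
    "((\<lambda>u. u\<^sup>2 * (u powr (\<alpha> - 1) * exp (- \<beta> * u)) * ?P u) has_real_derivative
      ((\<alpha> + 1) * u - \<beta> * u\<^sup>2) * (u powr (\<alpha> - 1) * exp (- \<beta> * u)) * ?P u
       + ?P u * (\<Sum>\<nu>\<in>I. - (\<gamma> \<nu> * ?D \<nu>)) * (u\<^sup>2 * (u powr (\<alpha> - 1) * exp (- \<beta> * u)))) (at u)" .
  moreover have "((\<alpha> + 1) * u - \<beta> * u\<^sup>2) * (u powr (\<alpha> - 1) * exp (- \<beta> * u)) * ?P u
       + ?P u * (\<Sum>\<nu>\<in>I. - (\<gamma> \<nu> * ?D \<nu>)) * (u\<^sup>2 * (u powr (\<alpha> - 1) * exp (- \<beta> * u)))
     = ((\<alpha> + 1) * u - \<beta> * u\<^sup>2 - u\<^sup>2 * (\<Sum>\<nu>\<in>I. \<gamma> \<nu> * ?D \<nu>)) * wt z y u"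
    unfolding mix_weight_def sum_negf by algebra
  moreover have "(\<lambda>u. u\<^sup>2 * (u powr (\<alpha> - 1) * exp (- \<beta> * u)) * ?P u) = (\<lambda>u. u\<^sup>2 * wt z y u)"
    by (simp add: mix_weight_def mult.assoc)
  ultimately show ?thesis by simp
qed

text \<open>
  Integrating the derivative of \<open>u\<^sup>2 * wt z y u\<close> over the half-line gives \<open>0\<close>. Each term with a
  difference of Digamma functions is nonnegative by \<open>Digamma_diff_ge\<close>; the lower bound is kept for the
  population \<open>\<nu>\<close> and the other populations are dropped. Only a one-sided bound of the
  derivative is integrated, over compact intervals that exhaust the half-line.
\<close>

lemma wt_integration_by_parts:
  assumes adm: "admissible z y" and \<nu>: "\<nu> \<in> I"
  shows "\<beta> * (LBINT u:{0<..}. u\<^sup>2 * wt z y u)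
           + \<gamma> \<nu> * (y \<nu> - z \<nu>) * (LBINT u:{0<..}. u\<^sup>2 / (\<gamma> \<nu> * u + y \<nu>) * wt z y u)
         \<le> (\<alpha> + 1) * (LBINT u:{0<..}. u * wt z y u)"
proof -
  define c where "c = \<gamma> \<nu> * (y \<nu> - z \<nu>)"
  define E where "E u = ((\<alpha> + 1) * u - \<beta> * u\<^sup>2 - c * (u\<^sup>2 / (\<gamma> \<nu> * u + y \<nu>))) * wt z y u" for u
  define D where "D u = ((\<alpha> + 1) * u - \<beta> * u\<^sup>2
             - u\<^sup>2 * (\<Sum>\<nu>\<in>I. \<gamma> \<nu> * (Digamma (\<gamma> \<nu> * u + y \<nu>) - Digamma (\<gamma> \<nu> * u + z \<nu>)))) * wt z y u" for u
  have zy: "0 < z \<nu>" "z \<nu> \<le> y \<nu>" "0 < y \<nu>" "0 < \<gamma> \<nu>" using adm \<nu> \<gamma> by (force simp: admissible_def)+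
  have i1: "set_integrable lborel {0<..} (\<lambda>u. u * wt z y u)"
    using wt_power_integrable[OF adm, of 1] by simp
  have i2: "set_integrable lborel {0<..} (\<lambda>u. u\<^sup>2 * wt z y u)"
    using wt_power_integrable[OF adm, of 2] by simp
  have i3: "set_integrable lborel {0<..} (\<lambda>u. u\<^sup>2 / (\<gamma> \<nu> * u + y \<nu>) * wt z y u)"
    by (rule wt_quotient_integrable[OF adm \<nu>])
  have E_alt: "E = (\<lambda>u. (\<alpha> + 1) * (u * wt z y u) - \<beta> * (u\<^sup>2 * wt z y u) - c * (u\<^sup>2 / (\<gamma> \<nu> * u + y \<nu>) * wt z y u))"
    by (auto simp: E_def algebra_simps)
  have iE: "set_integrable lborel {0<..} E"
    unfolding E_alt using i1 i2 i3 by (intro set_integral_diff set_integrable_mult_right) auto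
  have intE: "(LBINT u:{0<..}. E u) = (\<alpha> + 1) * (LBINT u:{0<..}. u * wt z y u)
      - \<beta> * (LBINT u:{0<..}. u\<^sup>2 * wt z y u) - c * (LBINT u:{0<..}. u\<^sup>2 / (\<gamma> \<nu> * u + y \<nu>) * wt z y u)"
    unfolding E_alt
    by (subst set_integral_diff; (subst set_integral_diff)?)
       (intro set_integral_diff set_integrable_mult_right impI i1 i2 i3 | simp only: set_integral_mult_right)+
  \<comment> \<open>\<open>D\<close> is the exact derivative; \<open>E\<close> bounds it from above and has an evident integrable majorant.\<close>
  have DE: "D u \<le> E u" if u: "0 < u" for u
  proof -
    have "\<gamma> \<mu> * (Digamma (\<gamma> \<mu> * u + y \<mu>) - Digamma (\<gamma> \<mu> * u + z \<mu>)) \<ge> \<gamma> \<mu> * ((y \<mu> - z \<mu>) / (\<gamma> \<mu> * u + y \<mu>))"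
      if "\<mu> \<in> I" for \<mu>
      using Digamma_diff_ge[of "\<gamma> \<mu> * u + z \<mu>" "\<gamma> \<mu> * u + y \<mu>"] admissibleD[OF adm that] u
      by (intro mult_left_mono) (auto simp: add_pos_pos)
    hence ge: "(\<Sum>\<mu>\<in>I. \<gamma> \<mu> * (Digamma (\<gamma> \<mu> * u + y \<mu>) - Digamma (\<gamma> \<mu> * u + z \<mu>)))
        \<ge> (\<Sum>\<mu>\<in>I. \<gamma> \<mu> * ((y \<mu> - z \<mu>) / (\<gamma> \<mu> * u + y \<mu>)))" by (rule sum_mono)
    have "\<gamma> \<mu> * ((y \<mu> - z \<mu>) / (\<gamma> \<mu> * u + y \<mu>)) \<ge> 0" if "\<mu> \<in> I" for \<mu>
      using adm that \<gamma>[OF that] u by (force simp: admissible_def)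
    hence "(\<Sum>\<mu>\<in>I. \<gamma> \<mu> * ((y \<mu> - z \<mu>) / (\<gamma> \<mu> * u + y \<mu>))) \<ge> \<gamma> \<nu> * ((y \<nu> - z \<nu>) / (\<gamma> \<nu> * u + y \<nu>))"
      using \<nu> fin by (intro member_le_sum) auto
    with ge have "u\<^sup>2 * (\<gamma> \<nu> * ((y \<nu> - z \<nu>) / (\<gamma> \<nu> * u + y \<nu>))) \<le>
        u\<^sup>2 * (\<Sum>\<mu>\<in>I. \<gamma> \<mu> * (Digamma (\<gamma> \<mu> * u + y \<mu>) - Digamma (\<gamma> \<mu> * u + z \<mu>)))"
      by (intro mult_left_mono) auto
    thus ?thesis unfolding D_def E_def c_def
      using wt_pos[OF adm u] by (intro mult_right_mono) (auto simp: mult_ac)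
  qed
  \<comment> \<open>The boundary term at \<open>b\<close> has the right sign, the one at \<open>a\<close> vanishes in the limit.\<close>
  have part: "- (a powr (\<alpha> + 1)) \<le> (LBINT u:{a..b}. E u)" if a: "0 < a" and ab: "a \<le> b" for a b :: real
  proof -
    have iab: "set_integrable lborel {a..b} E"
      by (rule set_integrable_subset[OF iE]) (use a in auto)
    have "(D has_integral b\<^sup>2 * wt z y b - a\<^sup>2 * wt z y a) {a..b}"
      using a ab unfolding D_def
      by (intro fundamental_theorem_of_calculus has_real_derivative_iff_has_vector_derivative[THEN iffD1]
            has_field_derivative_at_within[OF wt_antiderivative[OF adm]]) auto
    moreover have "(E has_integral (LBINT u:{a..b}. E u)) {a..b}"
      using set_borel_integral_eq_integral[OF iab] by (simp add: has_integral_iff)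
    ultimately have "b\<^sup>2 * wt z y b - a\<^sup>2 * wt z y a \<le> (LBINT u:{a..b}. E u)"
      using DE a by (elim has_integral_le) auto
    moreover have "0 \<le> b\<^sup>2 * wt z y b" using wt_pos[OF adm, of b] a ab by simp
    moreover have "a\<^sup>2 * wt z y a \<le> a\<^sup>2 * (a powr (\<alpha> - 1) * 1)"
    proof (intro mult_left_mono order.trans[OF wt_le[OF adm a]])
      show "exp (- \<beta> * a) \<le> 1" using a \<beta> by simp
    qed auto
    moreover have "a\<^sup>2 * (a powr (\<alpha> - 1) * 1) = a powr (\<alpha> + 1)"
      using a powr_add[of a 2 "\<alpha> - 1"] by (simp add: add.commute)
    ultimately show ?thesis by linarith
  qed
  have lim: "(\<lambda>n. (LBINT u:{1 / real (Suc n)..real (Suc n)}. E u)) \<longlonglongrightarrow> (LBINT u:{0<..}. E u)"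
    unfolding set_lebesgue_integral_def
  proof (rule integral_dominated_convergence[where w = "\<lambda>u. norm (indicator {0<..} u *\<^sub>R E u)"])
    have "set_borel_measurable lborel {1 / real (Suc n)..real (Suc n)} E" for n
      unfolding set_borel_measurable_def E_def by measurable
    thus "(\<lambda>u. indicator {1 / real (Suc n)..real (Suc n)} u *\<^sub>R E u) \<in> borel_measurable lborel" for n
      unfolding set_borel_measurable_def .
    show "(\<lambda>u. indicator {0<..} u *\<^sub>R E u) \<in> borel_measurable lborel"
      using iE unfolding set_integrable_def by (rule borel_measurable_integrable)
    show "integrable lborel (\<lambda>u. norm (indicator {0<..} u *\<^sub>R E u))"
      using iE unfolding set_integrable_def by (rule integrable_norm)
    show "AE u in lborel. norm (indicator {1 / real (Suc n)..real (Suc n)} u *\<^sub>R E u) \<le> norm (indicator {0<..} u *\<^sub>R E u)" for n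
      by (intro AE_I2) (auto simp: indicator_def less_le_trans[of 0 "1 / real (Suc n)"])
    show "AE u in lborel. (\<lambda>n. indicator {1 / real (Suc n)..real (Suc n)} u *\<^sub>R E u) \<longlonglongrightarrow> indicator {0<..} u *\<^sub>R E u"
    proof (intro AE_I2)
      fix u :: real
      show "(\<lambda>n. indicator {1 / real (Suc n)..real (Suc n)} u *\<^sub>R E u) \<longlonglongrightarrow> indicator {0<..} u *\<^sub>R E u"
      proof (cases "0 < u")
        case True
        have "\<forall>\<^sub>F n in sequentially. 1 / real (Suc n) \<le> u" "\<forall>\<^sub>F n in sequentially. u \<le> real (Suc n)"
          using True by real_asymp+
        hence "\<forall>\<^sub>F n in sequentially. indicator {1 / real (Suc n)..real (Suc n)} u *\<^sub>R E u = indicator {0<..} u *\<^sub>R E u"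
          by eventually_elim (use True in auto)
        thus ?thesis by (rule tendsto_eventually)
      next
        case False
        hence "\<not> 1 / real (Suc n) \<le> u" for n
          using less_le_trans[of 0 "1 / real (Suc n)" u] by auto
        thus ?thesis using False by (simp add: indicator_def)
      qed
    qed
  qed
  have "(\<lambda>n. - ((1 / real (Suc n)) powr (\<alpha> + 1))) \<longlonglongrightarrow> - 0"
    using \<alpha> by real_asymp
  moreover have "- ((1 / real (Suc n)) powr (\<alpha> + 1)) \<le> (LBINT u:{1 / real (Suc n)..real (Suc n)}. E u)" for n
    by (rule part) (auto simp: field_simps)
  ultimately have "- 0 \<le> (LBINT u:{0<..}. E u)"
    using lim by (intro tendsto_le[OF _ lim]) auto
  thus ?thesis using intE unfolding c_def by linarith
qed

lemma wt_update_y: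
  assumes adm: "admissible z y" and \<nu>: "\<nu> \<in> I" and u: "0 < u"
  shows "wt z (y(\<nu> := y \<nu> + 1)) u = wt z y u * (y \<nu> / (\<gamma> \<nu> * u + y \<nu>))"
proof -
  note D = admissibleD[OF adm \<nu>]
  have "(\<Prod>\<mu>\<in>I - {\<nu>}. gamma_ratio (\<gamma> \<mu> * u) (z \<mu>) ((y(\<nu> := y \<nu> + 1)) \<mu>))
      = (\<Prod>\<mu>\<in>I - {\<nu>}. gamma_ratio (\<gamma> \<mu> * u) (z \<mu>) (y \<mu>))"
    by (intro prod.cong) auto
  thus ?thesis using fin \<nu> D u unfolding mix_weight_def
    by (simp add: prod.remove[OF fin \<nu>] gamma_ratio_Suc_right)
qed

lemma wt_update_z:
  assumes adm: "admissible z y" and \<nu>: "\<nu> \<in> I" and u: "0 < u"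
  shows "wt (z(\<nu> := z \<nu> + 1)) y u = wt z y u * ((\<gamma> \<nu> * u + z \<nu>) / z \<nu>)"
proof -
  note D = admissibleD[OF adm \<nu>]
  have "(\<Prod>\<mu>\<in>I - {\<nu>}. gamma_ratio (\<gamma> \<mu> * u) ((z(\<nu> := z \<nu> + 1)) \<mu>) (y \<mu>))
      = (\<Prod>\<mu>\<in>I - {\<nu>}. gamma_ratio (\<gamma> \<mu> * u) (z \<mu>) (y \<mu>))"
    by (intro prod.cong) auto
  thus ?thesis using fin \<nu> D u unfolding mix_weight_def
    by (simp add: prod.remove[OF fin \<nu>] gamma_ratio_Suc_left)
qed

lemma admissible_update_y: "admissible z y \<Longrightarrow> admissible z (y(\<nu> := y \<nu> + 1))"
  by (auto simp: admissible_def)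

text \<open>
  One more draw of a nonzero cell multiplies the weight by \<open>y / (\<gamma> u + y)\<close>, hence the first difference
  of \<open>F\<close> is the integral of the complementary factor.
\<close>

lemma F_diff_y:
  assumes adm: "admissible z y" and \<nu>: "\<nu> \<in> I"
  shows "F z y - F z (y(\<nu> := y \<nu> + 1)) = (LBINT u:{0<..}. \<gamma> \<nu> * u / (\<gamma> \<nu> * u + y \<nu>) * wt z y u)"
proof -
  note D = admissibleD[OF adm \<nu>]
  have "F z y - F z (y(\<nu> := y \<nu> + 1)) = (LBINT u:{0<..}. wt z y u - wt z (y(\<nu> := y \<nu> + 1)) u)"
    unfolding mix_integral_def using wt_power_integrable[of _ _ 0] adm admissible_update_y[OF adm]
    by (subst set_integral_diff) auto
  also have "\<dots> = (LBINT u:{0<..}. \<gamma> \<nu> * u / (\<gamma> \<nu> * u + y \<nu>) * wt z y u)"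
  proof (rule LBINT_cong_pos)
    fix u :: real assume u: "0 < u"
    hence "\<gamma> \<nu> * u + y \<nu> > 0" using D by (simp add: add_pos_pos)
    thus "wt z y u - wt z (y(\<nu> := y \<nu> + 1)) u = \<gamma> \<nu> * u / (\<gamma> \<nu> * u + y \<nu>) * wt z y u"
      unfolding wt_update_y[OF adm \<nu> u] by (simp add: field_simps)
  qed
  finally show ?thesis .
qed

lemma F_decreasing_y:
  assumes adm: "admissible z y" and \<nu>: "\<nu> \<in> I"
  shows "F z (y(\<nu> := y \<nu> + 1)) < F z y"
proof -
  note D = admissibleD[OF adm \<nu>]
  have "0 < (LBINT u:{0<..}. \<gamma> \<nu> * u / (\<gamma> \<nu> * u + y \<nu>) * wt z y u)"
  proof (rule set_integral_pos)
    show "set_integrable lborel {0<..} (\<lambda>u. \<gamma> \<nu> * u / (\<gamma> \<nu> * u + y \<nu>) * wt z y u)"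
    proof (rule wt_bounded_integrable[OF adm, where C = 1 and j = 0])
      fix u :: real assume "0 < u"
      thus "\<bar>\<gamma> \<nu> * u / (\<gamma> \<nu> * u + y \<nu>)\<bar> \<le> 1 * u ^ 0"
        using D mult_pos_pos[of "\<gamma> \<nu>" u] by (simp add: divide_le_eq_1_pos add_pos_pos)
    qed measurable
    show "0 < \<gamma> \<nu> * u / (\<gamma> \<nu> * u + y \<nu>) * wt z y u" if "u \<in> {0<..}" for u
      using D that wt_pos[OF adm, of u] by (simp add: add_pos_pos)
  qed auto
  thus ?thesis using F_diff_y[OF adm \<nu>] by simp
qed

text \<open>
  A draw of cell \<open>0\<close> multiplies the weight by \<open>(\<gamma> u + z) / z * y / (\<gamma> u + y)\<close>, which is an affine
  combination of the constant \<open>1\<close> and the factor \<open>y / (\<gamma> u + y)\<close> of a nonzero cell. So all three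
  outcomes are described by two values of \<open>F\<close>.
\<close>

lemma F_zero_draw:
  assumes adm: "admissible z y" and \<nu>: "\<nu> \<in> I"
  shows "F (z(\<nu> := z \<nu> + 1)) (y(\<nu> := y \<nu> + 1))
       = F z (y(\<nu> := y \<nu> + 1)) + y \<nu> / z \<nu> * (F z y - F z (y(\<nu> := y \<nu> + 1)))"
proof -
  note D = admissibleD[OF adm \<nu>]
  let ?y = "y(\<nu> := y \<nu> + 1)" and ?z = "z(\<nu> := z \<nu> + 1)"
  have eq: "wt ?z ?y u = wt z ?y u + y \<nu> / z \<nu> * (wt z y u - wt z ?y u)" if u: "0 < u" for u
  proof -
    have *: "\<gamma> \<nu> * u + y \<nu> > 0" using u D by (simp add: add_pos_pos)
    have "wt ?z ?y u = wt z ?y u * ((\<gamma> \<nu> * u + z \<nu>) / z \<nu>)"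
      by (rule wt_update_z[OF admissible_update_y[OF adm] \<nu> u])
    moreover have arith: "W * (Y / (q + Y)) * ((q + Z) / Z) = W * (Y / (q + Y)) + Y / Z * (W - W * (Y / (q + Y)))"
      if "0 < q + Y" "0 < Z" for q Y Z W :: real
    proof -
      have "W - W * (Y / (q + Y)) = W * (q / (q + Y))" using that by (simp add: field_simps)
      thus ?thesis using that by (simp add: divide_simps) (simp add: algebra_simps)
    qed
    ultimately show ?thesis unfolding wt_update_y[OF adm \<nu> u]
      using arith[OF *] D by simp
  qed
  have "F ?z ?y = (LBINT u:{0<..}. wt z ?y u + y \<nu> / z \<nu> * (wt z y u - wt z ?y u))"
    unfolding mix_integral_def by (intro LBINT_cong_pos eq)
  also have "\<dots> = F z ?y + y \<nu> / z \<nu> * (F z y - F z ?y)"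
    unfolding mix_integral_def 
    using wt_power_integrable[OF adm, of 0] wt_power_integrable[OF admissible_update_y[OF adm], of 0]
    by (subst set_integral_add) (auto simp: set_integral_diff)
  finally show ?thesis .
qed

text \<open>
  The analytic core. Let \<open>q = \<gamma> u\<close> and integrate against the weight. Then
  \<open>(y - 1) (F(y - 1) - F(y))\<close> is the integral of \<open>q\<close>, and \<open>y (F(y) - F(y + 1))\<close> is the integral of
  \<open>q - q\<^sup>2 / (q + y)\<close>. So the claim bounds the integral of \<open>(y - z) q\<^sup>2 / (q + y)\<close> by \<open>\<kappa>\<close>
  times the integral of \<open>q\<close>. This is the integration by parts, once \<open>(y - z) q\<^sup>2 / (q + y) \<le> q\<^sup>2\<close> has
  been used in its term with \<open>\<beta>\<close>.
\<close>

lemma F_second_difference: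
  assumes adm: "admissible z y" and \<nu>: "\<nu> \<in> I" and y1: "z \<nu> \<le> y \<nu> - 1"
    and \<kappa>: "(\<alpha> + 1) * \<gamma> \<nu> / (\<beta> + \<gamma> \<nu>) = \<kappa>"
    and \<theta>: "z \<nu> + \<kappa> \<le> \<theta> * y \<nu>"
  shows "(1 - \<theta>) * (y \<nu> - 1) * (F z (y(\<nu> := y \<nu> - 1)) - F z y) \<le> (y \<nu> - z \<nu>) * (F z y - F z (y(\<nu> := y \<nu> + 1)))"
proof -
  define y' where "y' = y(\<nu> := y \<nu> - 1)"
  note D = admissibleD[OF adm \<nu>]
  have adm': "admissible z y'" using adm D y1 by (auto simp: admissible_def y'_def)
  have y: "y = y'(\<nu> := y' \<nu> + 1)" by (auto simp: y'_def)
  have y1p: "0 < y \<nu> - 1" using y1 D by simp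
  let ?g = "\<gamma> \<nu>"
  define Q where "Q = (LBINT u:{0<..}. u * wt z y u)"
  define Q2 where "Q2 = (LBINT u:{0<..}. u\<^sup>2 * wt z y u)"
  define R where "R = (LBINT u:{0<..}. u\<^sup>2 / (?g * u + y \<nu>) * wt z y u)"
  have i1: "set_integrable lborel {0<..} (\<lambda>u. u * wt z y u)"
    using wt_power_integrable[OF adm, of 1] by simp
  have i2: "set_integrable lborel {0<..} (\<lambda>u. u\<^sup>2 * wt z y u)"
    using wt_power_integrable[OF adm, of 2] by simp
  have i3: "set_integrable lborel {0<..} (\<lambda>u. u\<^sup>2 / (?g * u + y \<nu>) * wt z y u)"
    by (rule wt_quotient_integrable[OF adm \<nu>])
  have lower: "(y \<nu> - 1) * (F z y' - F z y) = ?g * Q"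
  proof -
    have "F z y' - F z y = (LBINT u:{0<..}. ?g / (y \<nu> - 1) * (u * wt z y u))"
      unfolding F_diff_y[OF adm' \<nu>, folded y]
    proof (rule LBINT_cong_pos)
      fix u :: real assume u: "0 < u"
      have "wt z y u = wt z y' u * (y' \<nu> / (?g * u + y' \<nu>))"
        using wt_update_y[OF adm' \<nu> u] unfolding y[symmetric] .
      moreover have "0 < ?g * u + y' \<nu>" "y \<nu> - 1 = y' \<nu>" "0 < y' \<nu>"
        using D u y1p by (simp_all add: y'_def add_pos_pos)
      ultimately show "?g * u / (?g * u + y' \<nu>) * wt z y' u = ?g / (y \<nu> - 1) * (u * wt z y u)"
        by simp
    qed
    also have "\<dots> = ?g / (y \<nu> - 1) * Q" unfolding Q_def by simp
    finally show ?thesis using y1p by simp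
  qed
  have upper: "y \<nu> * (F z y - F z (y(\<nu> := y \<nu> + 1))) = ?g * Q - ?g\<^sup>2 * R"
  proof -
    have "y \<nu> * (F z y - F z (y(\<nu> := y \<nu> + 1)))
        = (LBINT u:{0<..}. y \<nu> * (?g * u / (?g * u + y \<nu>) * wt z y u))"
      unfolding F_diff_y[OF adm \<nu>] by (rule set_integral_mult_right[symmetric])
    also have "\<dots> = (LBINT u:{0<..}. ?g * (u * wt z y u) - ?g\<^sup>2 * (u\<^sup>2 / (?g * u + y \<nu>) * wt z y u))"
    proof (rule LBINT_cong_pos)
      fix u :: real assume u: "0 < u"
      hence "?g * u + y \<nu> > 0" using D by (simp add: add_pos_pos)
      thus "y \<nu> * (?g * u / (?g * u + y \<nu>) * wt z y u) = ?g * (u * wt z y u) - ?g\<^sup>2 * (u\<^sup>2 / (?g * u + y \<nu>) * wt z y u)"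
        by (simp add: divide_simps) (simp add: algebra_simps power2_eq_square)
    qed
    also have "\<dots> = ?g * Q - ?g\<^sup>2 * R" unfolding Q_def R_def
      by (subst set_integral_diff)
         (intro set_integrable_mult_right impI i1 i3 | simp only: set_integral_mult_right)+
    finally show ?thesis .
  qed
  \<comment> \<open>Uses \<open>y - z \<le> q + y\<close>; this turns the \<open>\<beta>\<close>-term into a second copy of the \<open>\<gamma>\<close>-term.\<close>
  have R_Q2: "(y \<nu> - z \<nu>) * R \<le> Q2"
  proof -
    have "(y \<nu> - z \<nu>) * R = (LBINT u:{0<..}. (y \<nu> - z \<nu>) * (u\<^sup>2 / (?g * u + y \<nu>) * wt z y u))"
      unfolding R_def by (rule set_integral_mult_right[symmetric])
    also have "\<dots> \<le> (LBINT u:{0<..}. u\<^sup>2 * wt z y u)"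
    proof (rule set_integral_mono)
      show "set_integrable lborel {0<..} (\<lambda>u. (y \<nu> - z \<nu>) * (u\<^sup>2 / (?g * u + y \<nu>) * wt z y u))"
        by (intro set_integrable_mult_right impI i3)
      show "set_integrable lborel {0<..} (\<lambda>u. u\<^sup>2 * wt z y u)" by (rule i2)
      fix u :: real assume "u \<in> {0<..}"
      hence u: "0 < u" by simp
      have "0 < ?g * u" using D u by simp
      hence "(y \<nu> - z \<nu>) / (?g * u + y \<nu>) \<le> 1"
        using D by (simp add: divide_le_eq_1_pos)
      hence "(y \<nu> - z \<nu>) / (?g * u + y \<nu>) * (u\<^sup>2 * wt z y u) \<le> 1 * (u\<^sup>2 * wt z y u)"
        using wt_pos[OF adm u] by (intro mult_right_mono) auto
      thus "(y \<nu> - z \<nu>) * (u\<^sup>2 / (?g * u + y \<nu>) * wt z y u) \<le> u\<^sup>2 * wt z y u"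
        by simp
    qed
    finally show ?thesis unfolding Q2_def .
  qed
  have Q: "0 \<le> Q" unfolding Q_def
    using i1 wt_pos[OF adm] by (intro less_imp_le set_integral_pos) auto
  have ibp: "\<beta> * Q2 + ?g * (y \<nu> - z \<nu>) * R \<le> (\<alpha> + 1) * Q"
    unfolding Q_def Q2_def R_def by (rule wt_integration_by_parts[OF adm \<nu>])
  have "(\<beta> + ?g) * ((y \<nu> - z \<nu>) * R) \<le> (\<alpha> + 1) * Q"
  proof -
    have "\<beta> * ((y \<nu> - z \<nu>) * R) \<le> \<beta> * Q2" using R_Q2 \<beta> by simp
    with ibp show ?thesis by (simp add: algebra_simps)
  qed
  hence "?g * ((y \<nu> - z \<nu>) * R) \<le> \<kappa> * Q"
  proof -
    have "(y \<nu> - z \<nu>) * R \<le> (\<alpha> + 1) * Q / (\<beta> + ?g)"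
      using \<open>(\<beta> + ?g) * ((y \<nu> - z \<nu>) * R) \<le> (\<alpha> + 1) * Q\<close> D \<beta> by (simp add: pos_le_divide_eq mult.commute)
    from mult_left_mono[OF this, of ?g] show ?thesis using D by (simp add: \<kappa>[symmetric] mult_ac)
  qed
  hence "(y \<nu> - z \<nu>) * (?g\<^sup>2 * R) \<le> \<kappa> * (?g * Q)"
    using mult_left_mono[of "?g * ((y \<nu> - z \<nu>) * R)" "\<kappa> * Q" ?g] D by (simp add: power2_eq_square mult_ac)
  hence "(y \<nu> - z \<nu> - \<kappa>) * (?g * Q) \<le> (y \<nu> - z \<nu>) * (y \<nu> * (F z y - F z (y(\<nu> := y \<nu> + 1))))"
    unfolding upper by (simp add: algebra_simps)
  moreover have "y \<nu> * ((1 - \<theta>) * (?g * Q)) \<le> (y \<nu> - z \<nu> - \<kappa>) * (?g * Q)"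
  proof -
    have "(y \<nu> * (1 - \<theta>)) * (?g * Q) \<le> (y \<nu> - z \<nu> - \<kappa>) * (?g * Q)"
      using \<theta> Q D by (intro mult_right_mono) (auto simp: algebra_simps)
    thus ?thesis by (simp add: mult_ac)
  qed
  ultimately have "y \<nu> * ((1 - \<theta>) * (?g * Q)) \<le> y \<nu> * ((y \<nu> - z \<nu>) * (F z y - F z (y(\<nu> := y \<nu> + 1))))"
    by (simp add: mult_ac)
  hence "(1 - \<theta>) * (?g * Q) \<le> (y \<nu> - z \<nu>) * (F z y - F z (y(\<nu> := y \<nu> + 1)))"
    using D by simp
  thus ?thesis unfolding lower[symmetric] y'_def by (simp add: mult_ac)
qed

text \<open>
  The advantage, in terms of \<open>ln F\<close>, of drawing cell \<open>0\<close> over drawing another cell of \<open>\<nu>\<close>.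
\<close>

definition zero_gain :: "('i \<Rightarrow> real) \<Rightarrow> ('i \<Rightarrow> real) \<Rightarrow> 'i \<Rightarrow> real" where
  "zero_gain z y \<nu> = ln (F (z(\<nu> := z \<nu> + 1)) (y(\<nu> := y \<nu> + 1)) / F z (y(\<nu> := y \<nu> + 1)))"

text \<open>
  With \<open>s\<close> and \<open>t\<close> as in the proof the claim is
  \<open>ln (1 + s/y) \<le> ln (1 + s/z) - (1 - \<theta>) ln (1 + t/z)\<close>. By concavity
  \<open>(1 - \<theta>) ln (1 + t/z) \<le> ln (1 + (1 - \<theta>) t/z)\<close>, so it suffices that
  \<open>(1 + s/y) (z + (1 - \<theta>) t) \<le> z + s\<close>, and after multiplication by \<open>F(y + 1)\<close> this is
  \<open>F_second_difference\<close>.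
\<close>

lemma one_draw_inequality:
  assumes adm: "admissible z y" and \<nu>: "\<nu> \<in> I" and y1: "z \<nu> \<le> y \<nu> - 1"
    and \<theta>: "z \<nu> + (\<alpha> + 1) * \<gamma> \<nu> / (\<beta> + \<gamma> \<nu>) \<le> \<theta> * y \<nu>" "0 \<le> \<theta>" "\<theta> \<le> 1"
  shows "ln (F z y / F z (y(\<nu> := y \<nu> + 1))) \<le> zero_gain z y \<nu> - (1 - \<theta>) * zero_gain z (y(\<nu> := y \<nu> - 1)) \<nu>"
proof -
  note D = admissibleD[OF adm \<nu>]
  define y' where "y' = y(\<nu> := y \<nu> - 1)"
  have adm': "admissible z y'" using adm D y1 by (auto simp: admissible_def y'_def)
  have y: "y'(\<nu> := y' \<nu> + 1) = y" by (auto simp: y'_def)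
  define F0 where "F0 = F z y"
  define Fb where "Fb = F z (y(\<nu> := y \<nu> + 1))"
  define Fm where "Fm = F z y'"
  have pos: "0 < F0" "0 < Fb" "0 < Fm"
    unfolding F0_def Fb_def Fm_def
    by (rule F_pos[OF adm] F_pos[OF admissible_update_y[OF adm]] F_pos[OF adm'])+
  have dec: "Fb < F0" "F0 < Fm"
    unfolding F0_def Fb_def Fm_def using F_decreasing_y[OF adm \<nu>] F_decreasing_y[OF adm' \<nu>] y by auto
  \<comment> \<open>Chosen such that \<open>F0 / Fb = 1 + s / y\<close>, while a draw of cell \<open>0\<close> gives \<open>1 + s / z\<close>;
    \<open>t\<close> is the same quantity with one count less.\<close>
  define s where "s = y \<nu> * (F0 - Fb) / Fb"
  define t where "t = (y \<nu> - 1) * (Fm - F0) / F0"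
  have y1p: "0 < y \<nu> - 1" using y1 D by simp
  have st: "0 < s" "0 < t" using pos dec D y1p by (simp_all add: s_def t_def)
  have L1: "zero_gain z y \<nu> = ln (1 + s / z \<nu>)"
    unfolding zero_gain_def F_zero_draw[OF adm \<nu>] F0_def[symmetric] Fb_def[symmetric] using pos D
    by (simp add: s_def add_divide_distrib mult_ac)
  have L2: "zero_gain z y' \<nu> = ln (1 + t / z \<nu>)"
    unfolding zero_gain_def F_zero_draw[OF adm' \<nu>] unfolding y F0_def[symmetric] Fm_def[symmetric] using pos D
    by (simp add: t_def add_divide_distrib y'_def mult.commute[of "z \<nu>"])
  have sd: "(1 - \<theta>) * (y \<nu> - 1) * (Fm - F0) \<le> (y \<nu> - z \<nu>) * (F0 - Fb)"
    unfolding F0_def Fb_def Fm_def y'_def using F_second_difference[OF adm \<nu> y1 refl \<theta>(1)] .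
  have key: "F0 / Fb * (z \<nu> + (1 - \<theta>) * t) \<le> z \<nu> + s"
  proof -
    have "F0 * (z \<nu> + (1 - \<theta>) * t) = z \<nu> * F0 + (1 - \<theta>) * (y \<nu> - 1) * (Fm - F0)"
      using pos by (simp add: t_def field_simps)
    also have "\<dots> \<le> z \<nu> * F0 + (y \<nu> - z \<nu>) * (F0 - Fb)" using sd by simp
    also have "\<dots> = Fb * (z \<nu> + s)" using pos by (simp add: s_def field_simps)
    finally show ?thesis using pos by (simp add: field_simps)
  qed
  \<comment> \<open>Concavity between the points \<open>1\<close> and \<open>1 + t / z\<close>, with weights \<open>\<theta>\<close> and \<open>1 - \<theta>\<close>.\<close>
  have amgm: "(1 - \<theta>) * ln (1 + t / z \<nu>) \<le> ln (1 + (1 - \<theta>) * t / z \<nu>)"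
  proof -
    have "concave_on {0<..} ln" by (rule ln_concave)
    hence "ln ((1 - (1 - \<theta>)) *\<^sub>R 1 + (1 - \<theta>) *\<^sub>R (1 + t / z \<nu>)) \<ge> (1 - (1 - \<theta>)) * ln 1 + (1 - \<theta>) * ln (1 + t / z \<nu>)"
      using st D \<theta> by (intro concave_onD) (auto simp: add_pos_pos)
    thus ?thesis by (simp add: algebra_simps)
  qed
  have "ln (F0 / Fb) + ln (1 + (1 - \<theta>) * t / z \<nu>) = ln (F0 / Fb * (1 + (1 - \<theta>) * t / z \<nu>))"
    using pos st \<theta> D by (intro ln_mult_pos[symmetric]) (auto intro!: add_pos_nonneg)
  also have "\<dots> \<le> ln (1 + s / z \<nu>)"
  proof (subst ln_le_cancel_iff)
    have "0 \<le> (1 - \<theta>) * t / z \<nu>" using st \<theta> D by simp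
    thus "0 < F0 / Fb * (1 + (1 - \<theta>) * t / z \<nu>)"
      using pos by (intro mult_pos_pos divide_pos_pos) auto
    show "0 < 1 + s / z \<nu>" using st D by (simp add: add_pos_pos)
    have "F0 / Fb * (z \<nu> + (1 - \<theta>) * t) / z \<nu> \<le> (z \<nu> + s) / z \<nu>"
      using key D by (intro divide_right_mono) auto
    moreover have "(z \<nu> + (1 - \<theta>) * t) / z \<nu> = 1 + (1 - \<theta>) * t / z \<nu>" "(z \<nu> + s) / z \<nu> = 1 + s / z \<nu>"
      using D by (simp_all add: add_divide_distrib)
    ultimately show "F0 / Fb * (1 + (1 - \<theta>) * t / z \<nu>) \<le> 1 + s / z \<nu>"
      by (metis times_divide_eq_right)
  qed
  finally have "ln (F0 / Fb) \<le> ln (1 + s / z \<nu>) - (1 - \<theta>) * ln (1 + t / z \<nu>)" using amgm by linarith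
  thus ?thesis unfolding L1[symmetric] L2[symmetric] unfolding F0_def Fb_def y'_def .
qed

text \<open>
  The case in which \<open>\<nu>\<close> has no observed counts, so that no term with \<open>n - 1\<close> occurs. It amounts to
  \<open>ln (1 + s/y) < ln (1 + s/z)\<close>.
\<close>

lemma first_draw_inequality:
  assumes adm: "admissible z y" and \<nu>: "\<nu> \<in> I" and zy: "z \<nu> < y \<nu>"
  shows "ln (F z y / F z (y(\<nu> := y \<nu> + 1))) < zero_gain z y \<nu>"
proof -
  note D = admissibleD[OF adm \<nu>]
  define F0 where "F0 = F z y"
  define Fb where "Fb = F z (y(\<nu> := y \<nu> + 1))"
  have pos: "0 < F0" "0 < Fb"
    unfolding F0_def Fb_def by (rule F_pos[OF adm] F_pos[OF admissible_update_y[OF adm]])+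
  have dec: "Fb < F0"
    unfolding F0_def Fb_def using F_decreasing_y[OF adm \<nu>] by auto
  have "F0 < Fb + y \<nu> / z \<nu> * (F0 - Fb)"
    using mult_strict_right_mono[of 1 "y \<nu> / z \<nu>" "F0 - Fb"] dec zy D by (simp add: algebra_simps)
  hence "F0 / Fb < (Fb + y \<nu> / z \<nu> * (F0 - Fb)) / Fb"
    using pos by (intro divide_strict_right_mono)
  moreover have "0 < F0 / Fb" using pos by simp
  ultimately have "ln (F0 / Fb) < ln ((Fb + y \<nu> / z \<nu> * (F0 - Fb)) / Fb)"
    by (metis less_trans ln_less_cancel_iff)
  thus ?thesis unfolding zero_gain_def F_zero_draw[OF adm \<nu>] F0_def[symmetric] Fb_def[symmetric] .
qed

end

section \<open>Growth of the logarithm of the mixing integral\<close>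

context mixing
begin

text \<open>
  The weight is restricted to \<open>u \<le> 1\<close>, where each quotient of Gamma functions is at least its value at
  \<open>u = 1\<close>.
\<close>

lemma F_ge_at_1:
  assumes adm: "admissible z y"
  shows "(LBINT u:{0<..1}. u powr (\<alpha> - 1) * exp (- \<beta> * u)) * (\<Prod>\<nu>\<in>I. gamma_ratio (\<gamma> \<nu>) (z \<nu>) (y \<nu>)) \<le> F z y"
proof -
  have i: "set_integrable lborel {0<..1} (\<lambda>u. u powr (\<alpha> - 1) * exp (- \<beta> * u))"
    by (rule set_integrable_subset[OF gamma_density_integrable[OF \<alpha> \<beta>]]) auto
  have iw: "set_integrable lborel {0<..} (wt z y)" using wt_power_integrable[OF adm, of 0] by simp
  have iw1: "set_integrable lborel {0<..1} (wt z y)"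
    by (rule set_integrable_subset[OF iw]) auto
  have "(LBINT u:{0<..1}. u powr (\<alpha> - 1) * exp (- \<beta> * u)) * (\<Prod>\<nu>\<in>I. gamma_ratio (\<gamma> \<nu>) (z \<nu>) (y \<nu>))
     = (LBINT u:{0<..1}. u powr (\<alpha> - 1) * exp (- \<beta> * u) * (\<Prod>\<nu>\<in>I. gamma_ratio (\<gamma> \<nu>) (z \<nu>) (y \<nu>)))"
    by (rule set_integral_mult_left[symmetric])
  also have "\<dots> \<le> (LBINT u:{0<..1}. wt z y u)"
  proof (rule set_integral_mono)
    show "set_integrable lborel {0<..1} (\<lambda>u. u powr (\<alpha> - 1) * exp (- \<beta> * u) * (\<Prod>\<nu>\<in>I. gamma_ratio (\<gamma> \<nu>) (z \<nu>) (y \<nu>)))"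
      by (intro set_integrable_mult_left impI i)
    show "set_integrable lborel {0<..1} (wt z y)" by (rule iw1)
    fix u :: real assume u: "u \<in> {0<..1}"
    show "u powr (\<alpha> - 1) * exp (- \<beta> * u) * (\<Prod>\<nu>\<in>I. gamma_ratio (\<gamma> \<nu>) (z \<nu>) (y \<nu>)) \<le> wt z y u"
      unfolding mix_weight_def
    proof (intro mult_left_mono prod_mono conjI)
      fix \<nu> assume \<nu>: "\<nu> \<in> I"
      note D = admissibleD[OF adm \<nu>]
      show "0 \<le> gamma_ratio (\<gamma> \<nu>) (z \<nu>) (y \<nu>)" using gamma_ratio_pos[of "\<gamma> \<nu>" "z \<nu>" "y \<nu>"] D by simp
      show "gamma_ratio (\<gamma> \<nu>) (z \<nu>) (y \<nu>) \<le> gamma_ratio (\<gamma> \<nu> * u) (z \<nu>) (y \<nu>)"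
        using D u by (intro gamma_ratio_antimono) (auto simp: mult_left_le)
    qed auto
  qed
  also have "\<dots> \<le> F z y"
    unfolding mix_integral_def set_lebesgue_integral_def
  proof (rule integral_mono)
    show "indicator {0<..1} u *\<^sub>R wt z y u \<le> indicator {0<..} u *\<^sub>R wt z y u" for u
      using wt_pos[OF adm, of u] by (auto simp: indicator_def)
  qed (use iw iw1 in \<open>simp_all add: set_integrable_def\<close>)
  finally show ?thesis .
qed

lemma F_le: "admissible z y \<Longrightarrow> F z y \<le> (LBINT u:{0<..}. u powr (\<alpha> - 1) * exp (- \<beta> * u))"
  unfolding mix_integral_def
  using wt_power_integrable[of z y 0] wt_le gamma_density_integrable[OF \<alpha> \<beta>]
  by (intro set_integral_mono) auto

lemma ln_F_bound:
  assumes adm: "admissible z y"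
  shows "\<exists>C. \<forall>n :: 'i \<Rightarrow> nat. \<bar>ln (F z (\<lambda>\<nu>. y \<nu> + real (n \<nu>)))\<bar> \<le> C * (1 + (\<Sum>\<nu>\<in>I. real (n \<nu>)))"
proof -
  define A where "A = (LBINT u:{0<..1}. u powr (\<alpha> - 1) * exp (- \<beta> * u))"
  define B where "B = (LBINT u:{0<..}. u powr (\<alpha> - 1) * exp (- \<beta> * u))"
  define G where "G = (\<Prod>\<nu>\<in>I. gamma_ratio (\<gamma> \<nu>) (z \<nu>) (y \<nu>))"
  define \<delta> where "\<delta> \<nu> = y \<nu> / (\<gamma> \<nu> + y \<nu>)" for \<nu>
  have Dy: "0 < \<gamma> \<nu>" "0 < y \<nu>" "0 < z \<nu>" "z \<nu> \<le> y \<nu>" if "\<nu> \<in> I" for \<nu> using admissibleD[OF adm that] by auto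
  have \<delta>: "0 < \<delta> \<nu>" "\<delta> \<nu> < 1" if "\<nu> \<in> I" for \<nu>
    using Dy[OF that] by (simp_all add: \<delta>_def add_pos_pos)
  have G: "0 < G" unfolding G_def using Dy by (intro prod_pos ballI gamma_ratio_pos) (auto intro: less_imp_le)
  have A: "0 < A" unfolding A_def
  proof (rule set_integral_pos)
    show "set_integrable lborel {0<..1} (\<lambda>u. u powr (\<alpha> - 1) * exp (- \<beta> * u))"
      by (rule set_integrable_subset[OF gamma_density_integrable[OF \<alpha> \<beta>]]) auto
  qed auto
  define C where "C = \<bar>ln B\<bar> + \<bar>ln A\<bar> + \<bar>ln G\<bar> + (\<Sum>\<nu>\<in>I. \<bar>ln (\<delta> \<nu>)\<bar>)"
  have "\<bar>ln (F z (\<lambda>\<nu>. y \<nu> + real (n \<nu>)))\<bar> \<le> C * (1 + (\<Sum>\<nu>\<in>I. real (n \<nu>)))" for n :: "'i \<Rightarrow> nat"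
  proof -
    let ?y = "\<lambda>\<nu>. y \<nu> + real (n \<nu>)"
    have adm': "admissible z ?y" using adm by (fastforce simp: admissible_def)
    have Fp: "0 < F z ?y" by (rule F_pos[OF adm'])
    have "ln (F z ?y) \<le> ln B" using F_le[OF adm'] Fp unfolding B_def by simp
    have P: "0 < (\<Prod>\<nu>\<in>I. \<delta> \<nu> ^ n \<nu>)" using \<delta> by (intro prod_pos) auto
    have "A * (G * (\<Prod>\<nu>\<in>I. \<delta> \<nu> ^ n \<nu>)) \<le> F z ?y"
    proof -
      have "G * (\<Prod>\<nu>\<in>I. \<delta> \<nu> ^ n \<nu>) \<le> (\<Prod>\<nu>\<in>I. gamma_ratio (\<gamma> \<nu>) (z \<nu>) (y \<nu> + real (n \<nu>)))"
        unfolding G_def prod.distrib[symmetric]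
      proof (intro prod_mono conjI)
        fix \<nu> assume \<nu>: "\<nu> \<in> I"
        show "gamma_ratio (\<gamma> \<nu>) (z \<nu>) (y \<nu>) * \<delta> \<nu> ^ n \<nu> \<le> gamma_ratio (\<gamma> \<nu>) (z \<nu>) (y \<nu> + real (n \<nu>))"
          unfolding \<delta>_def using Dy[OF \<nu>] by (intro gamma_ratio_lower_bound) auto
        show "0 \<le> gamma_ratio (\<gamma> \<nu>) (z \<nu>) (y \<nu>) * \<delta> \<nu> ^ n \<nu>"
          using gamma_ratio_pos[of "\<gamma> \<nu>" "z \<nu>" "y \<nu>"] Dy[OF \<nu>] \<delta>[OF \<nu>] by simp
      qed
      hence "A * (G * (\<Prod>\<nu>\<in>I. \<delta> \<nu> ^ n \<nu>)) \<le> A * (\<Prod>\<nu>\<in>I. gamma_ratio (\<gamma> \<nu>) (z \<nu>) (?y \<nu>))"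
        using A by (intro mult_left_mono) auto
      also have "\<dots> \<le> F z ?y" using F_ge_at_1[OF adm'] unfolding A_def .
      finally show ?thesis .
    qed
    hence "ln (A * (G * (\<Prod>\<nu>\<in>I. \<delta> \<nu> ^ n \<nu>))) \<le> ln (F z ?y)"
      using A G P Fp by (subst ln_le_cancel_iff) auto
    moreover have "ln (A * (G * (\<Prod>\<nu>\<in>I. \<delta> \<nu> ^ n \<nu>))) = ln A + (ln G + (\<Sum>\<nu>\<in>I. real (n \<nu>) * ln (\<delta> \<nu>)))"
    proof -
      have "ln (\<Prod>\<nu>\<in>I. \<delta> \<nu> ^ n \<nu>) = (\<Sum>\<nu>\<in>I. real (n \<nu>) * ln (\<delta> \<nu>))"
        using fin \<delta> by (subst ln_prod) (auto intro!: sum.cong simp: ln_realpow less_imp_neq[symmetric])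
      thus ?thesis using A G P by (simp add: ln_mult_pos)
    qed
    ultimately have lower: "ln A + (ln G + (\<Sum>\<nu>\<in>I. real (n \<nu>) * ln (\<delta> \<nu>))) \<le> ln (F z ?y)" by simp
    let ?S = "\<Sum>\<nu>\<in>I. real (n \<nu>)" and ?T = "\<Sum>\<nu>\<in>I. \<bar>ln (\<delta> \<nu>)\<bar>"
    have "(\<Sum>\<nu>\<in>I. real (n \<nu>) * \<bar>ln (\<delta> \<nu>)\<bar>) \<le> (\<Sum>\<nu>\<in>I. ?S * \<bar>ln (\<delta> \<nu>)\<bar>)"
      using fin by (intro sum_mono mult_right_mono member_le_sum) auto
    also have "\<dots> = ?S * ?T" by (simp add: sum_distrib_left)
    finally have le: "(\<Sum>\<nu>\<in>I. real (n \<nu>) * \<bar>ln (\<delta> \<nu>)\<bar>) \<le> ?S * ?T" .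
    have "- (\<Sum>\<nu>\<in>I. real (n \<nu>) * \<bar>ln (\<delta> \<nu>)\<bar>) \<le> (\<Sum>\<nu>\<in>I. real (n \<nu>) * ln (\<delta> \<nu>))"
      unfolding sum_negf[symmetric]
    proof (rule sum_mono)
      fix \<nu>
      have "real (n \<nu>) * (- \<bar>ln (\<delta> \<nu>)\<bar>) \<le> real (n \<nu>) * ln (\<delta> \<nu>)" by (intro mult_left_mono) auto
      thus "- (real (n \<nu>) * \<bar>ln (\<delta> \<nu>)\<bar>) \<le> real (n \<nu>) * ln (\<delta> \<nu>)" by simp
    qed
    moreover have S: "0 \<le> ?S" and T: "0 \<le> ?T" by (auto intro: sum_nonneg)
    ultimately have 1: "\<bar>ln (F z ?y)\<bar> \<le> \<bar>ln B\<bar> + \<bar>ln A\<bar> + \<bar>ln G\<bar> + ?S * ?T"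
      using lower le \<open>ln (F z ?y) \<le> ln B\<close> mult_nonneg_nonneg[OF S T] by linarith
    have "C * (1 + ?S) = C + (\<bar>ln B\<bar> + \<bar>ln A\<bar> + \<bar>ln G\<bar>) * ?S + ?S * ?T"
      by (simp add: C_def algebra_simps)
    moreover have "0 \<le> (\<bar>ln B\<bar> + \<bar>ln A\<bar> + \<bar>ln G\<bar>) * ?S" using S by simp
    moreover have "\<bar>ln B\<bar> + \<bar>ln A\<bar> + \<bar>ln G\<bar> \<le> C" using T by (simp add: C_def)
    ultimately show ?thesis using 1 by linarith
  qed
  thus ?thesis by blast
qed

end

section \<open>Expectations under the negative multinomial law\<close>

text \<open>
  One term of the binomial expansion of \<open>(a + b)\<^bsup>m + n\<^esup>\<close>.
\<close>

lemma binomial_single_term_le: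
  fixes a b :: real
  assumes "0 \<le> a" "0 \<le> b"
  shows "a ^ m / fact m * (b ^ n / fact n) \<le> (a + b) ^ (m + n) / fact (m + n)"
proof -
  have "real (m + n choose m) * a ^ m * b ^ (m + n - m)
      \<le> (\<Sum>k\<le>m + n. real (m + n choose k) * a ^ k * b ^ (m + n - k))"
    using assms by (intro member_le_sum) auto
  also have "\<dots> = (a + b) ^ (m + n)" by (rule binomial_ring[symmetric])
  finally have "fact (m + n) / (fact m * fact n) * a ^ m * b ^ n \<le> (a + b) ^ (m + n)"
    by (simp add: binomial_fact)
  thus ?thesis by (simp add: field_simps)
qed

lemma multinomial_single_term_le:
  fixes q :: "'a \<Rightarrow> real"
  assumes "finite J" "\<And>i. i \<in> J \<Longrightarrow> 0 \<le> q i"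
  shows "(\<Prod>i\<in>J. q i ^ x i / fact (x i)) \<le> (\<Sum>i\<in>J. q i) ^ (\<Sum>i\<in>J. x i) / fact (\<Sum>i\<in>J. x i)"
  using assms
proof (induction J rule: finite_induct)
  case (insert j J)
  have "(\<Prod>i\<in>insert j J. q i ^ x i / fact (x i)) 
     \<le> q j ^ x j / fact (x j) * ((\<Sum>i\<in>J. q i) ^ (\<Sum>i\<in>J. x i) / fact (\<Sum>i\<in>J. x i))"
    unfolding prod.insert[OF insert.hyps] using insert by (intro mult_left_mono) auto
  also have "\<dots> \<le> (q j + (\<Sum>i\<in>J. q i)) ^ (x j + (\<Sum>i\<in>J. x i)) / fact (x j + (\<Sum>i\<in>J. x i))"
    using insert.prems by (intro binomial_single_term_le sum_nonneg) auto
  finally show ?case using insert.hyps by simp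
qed simp

text \<open>
  The quotient of consecutive terms is \<open>(s + n) / (n + 1)\<close>, which tends to \<open>1\<close>.
\<close>

lemma Gamma_over_fact_bound:
  fixes s b :: real
  assumes s: "0 < s" and b: "1 < b"
  shows "\<exists>C>0. \<forall>n. Gamma (s + real n) / fact n \<le> C * b ^ n"
proof -
  define g where "g n = Gamma (s + real n) / fact n" for n
  have g_pos: "0 < g n" for n using s by (simp add: g_def Gamma_real_pos add_pos_nonneg)
  have g_Suc: "g (Suc n) = g n * ((s + real n) / (real n + 1))" for n
  proof -
    have "Gamma (s + real n + 1) = (s + real n) * Gamma (s + real n)"
      using s by (intro Gamma_plus1) (auto elim!: nonpos_Ints_cases)
    thus ?thesis unfolding g_def by (simp add: field_simps)
  qed
  have "\<forall>\<^sub>F n in sequentially. (s + real n) / (real n + 1) \<le> b"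
    using b by real_asymp
  then obtain n0 where n0: "\<And>n. n \<ge> n0 \<Longrightarrow> (s + real n) / (real n + 1) \<le> b"
    by (auto simp: eventually_sequentially)
  define C where "C = (\<Sum>n\<le>n0. g n)"
  have C: "g n \<le> C" if "n \<le> n0" for n
    unfolding C_def using that g_pos by (intro member_le_sum) (auto intro: less_imp_le)
  have Cpos: "0 < C" using C[of 0] g_pos[of 0] by simp
  have "g n \<le> C * b ^ n" for n
  proof (induction n)
    case 0
    show ?case using C[of 0] by simp
  next
    case (Suc n)
    show ?case
    proof (cases "Suc n \<le> n0")
      case True
      have "C * 1 \<le> C * b ^ Suc n" using Cpos b by (intro mult_left_mono one_le_power) auto
      thus ?thesis using C[OF True] by simp
    next
      case False
      have "g (Suc n) \<le> g n * b" unfolding g_Suc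
        using n0[of n] False g_pos[of n] by (intro mult_left_mono) auto
      also have "\<dots> \<le> C * b ^ n * b" using Suc b by (intro mult_right_mono) auto
      finally show ?thesis by (simp add: mult_ac)
    qed
  qed
  thus ?thesis using Cpos unfolding g_def by blast
qed

lemma open_simplexD:
  assumes "q \<in> open_simplex k"
  shows "0 < cell_prob k q 0" "\<And>i. i \<in> {1..k} \<Longrightarrow> 0 < cell_prob k q i" "\<And>i. i \<le> k \<Longrightarrow> 0 < cell_prob k q i"
    "cell_prob k q 0 = 1 - (\<Sum>i=1..k. cell_prob k q i)" "(\<Sum>i=0..k. cell_prob k q i) = 1"
proof -
  have s: "(\<Sum>i=1..k. cell_prob k q i) = (\<Sum>i=1..k. q i)"
    by (intro sum.cong) (auto simp: cell_prob_def)
  show 0: "0 < cell_prob k q 0" using assms by (simp add: open_simplex_def cell_prob_def)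
  show 1: "\<And>i. i \<in> {1..k} \<Longrightarrow> 0 < cell_prob k q i"
    using assms by (auto simp: open_simplex_def cell_prob_def)
  show "\<And>i. i \<le> k \<Longrightarrow> 0 < cell_prob k q i"
    using 0 1 by (metis atLeastAtMost_iff less_one not_le)
  show "cell_prob k q 0 = 1 - (\<Sum>i=1..k. cell_prob k q i)" unfolding s by (simp add: cell_prob_def)
  thus "(\<Sum>i=0..k. cell_prob k q i) = 1" by (simp add: sum.atLeast_Suc_atMost)
qed

lemma neg_multinomial_mass_pos:
  assumes "q \<in> open_simplex k" "0 < s"
  shows "0 < neg_multinomial_mass k s q y"
  using open_simplexD[OF assms(1)] assms(2) unfolding neg_multinomial_mass_def
  by (intro mult_pos_pos divide_pos_pos prod_pos ballI Gamma_real_pos zero_less_power)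
     (auto intro: add_pos_nonneg[OF _ of_nat_0_le_iff] simp del: of_nat_sum)

text \<open>
  A single multinomial probability is at most \<open>S\<^sup>n\<close> with \<open>S = 1 - p\<^sub>0\<close>, and the Gamma functions cost at most
  \<open>b\<^sup>n\<close> for an arbitrary \<open>b > 1\<close>.
\<close>

lemma neg_multinomial_mass_geometric_bound:
  assumes q: "q \<in> open_simplex k" and s: "0 < s"
  shows "\<exists>C \<rho>. 0 < C \<and> 0 \<le> \<rho> \<and> \<rho> < 1 \<and> (\<forall>y. neg_multinomial_mass k s q y \<le> C * \<rho> ^ (\<Sum>i=1..k. y i))"
proof -
  note Q = open_simplexD[OF q]
  define S where "S = (\<Sum>i=1..k. cell_prob k q i)"
  have S: "0 \<le> S" "S < 1" using Q unfolding S_def by (auto intro!: sum_nonneg simp: less_imp_le)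
  \<comment> \<open>Any \<open>b > 1\<close> with \<open>b S < 1\<close> would do.\<close>
  define b where "b = 2 / (1 + S)"
  have b: "1 < b" "b * S < 1" using S by (simp_all add: b_def field_simps)
  obtain C where C: "0 < C" "\<And>n. Gamma (s + real n) / fact n \<le> C * b ^ n"
    using Gamma_over_fact_bound[OF s b(1)] by blast
  define A where "A = cell_prob k q 0 powr s / Gamma s"
  have A: "0 < A" using Q s by (simp add: A_def Gamma_real_pos)
  have "neg_multinomial_mass k s q y \<le> (A * C) * (b * S) ^ (\<Sum>i=1..k. y i)" for y
  proof -
    let ?n = "\<Sum>i=1..k. y i"
    have "neg_multinomial_mass k s q y
        = A * (Gamma (s + real ?n) * (\<Prod>i=1..k. cell_prob k q i ^ y i / fact (y i)))"
      by (simp add: neg_multinomial_mass_def A_def prod_dividef)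
    also have "\<dots> \<le> A * (Gamma (s + real ?n) * (S ^ ?n / fact ?n))"
      unfolding S_def using A Q s
      by (intro mult_left_mono multinomial_single_term_le)
         (auto intro!: less_imp_le Gamma_real_pos add_pos_nonneg[OF _ of_nat_0_le_iff] simp del: of_nat_sum intro: less_imp_le)
    also have "\<dots> = A * (Gamma (s + real ?n) / fact ?n * S ^ ?n)" by simp
    also have "\<dots> \<le> A * (C * b ^ ?n * S ^ ?n)"
      using A S C(2)[of ?n] by (intro mult_left_mono mult_right_mono) auto
    finally show ?thesis by (simp add: power_mult_distrib mult_ac)
  qed
  thus ?thesis using A C b S by (intro exI[of _ "A * C"] exI[of _ "b * S"]) auto
qed

lemma neg_multinomial_mass_exp_moment:
  assumes q: "q \<in> open_simplex k" and s: "0 < s"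
  shows "\<exists>M>1. Infinite_Set_Sum.abs_summable_on (\<lambda>y. neg_multinomial_mass k s q y * M ^ (\<Sum>i=1..k. y i)) (\<Pi>\<^sub>E i\<in>{1..k}. UNIV)"
proof -
  obtain C \<rho> where C: "0 < C" and \<rho>: "0 \<le> \<rho>" "\<rho> < 1"
    and le: "\<And>y. neg_multinomial_mass k s q y \<le> C * \<rho> ^ (\<Sum>i=1..k. y i)"
    using neg_multinomial_mass_geometric_bound[OF assms] by blast
  define M where "M = 2 / (1 + \<rho>)"
  have M: "1 < M" "0 \<le> \<rho> * M" "\<rho> * M < 1" using \<rho> by (simp_all add: M_def field_simps)
  have "Infinite_Set_Sum.abs_summable_on (\<lambda>y. \<Prod>i\<in>{1..k}. (\<rho> * M) ^ y i) (\<Pi>\<^sub>E i\<in>{1..k}. UNIV)"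
  proof (rule abs_summable_on_prod_PiE)
    show "Infinite_Set_Sum.abs_summable_on (\<lambda>n. (\<rho> * M) ^ n) (UNIV)"
      unfolding abs_summable_on_nat_iff' using M by (simp add: summable_geometric abs_mult)
  qed auto
  hence "Infinite_Set_Sum.abs_summable_on (\<lambda>y. C * (\<Prod>i\<in>{1..k}. (\<rho> * M) ^ y i)) (\<Pi>\<^sub>E i\<in>{1..k}. UNIV)"
    by (rule abs_summable_on_cmult_right)
  hence "Infinite_Set_Sum.abs_summable_on (\<lambda>y. neg_multinomial_mass k s q y * M ^ (\<Sum>i=1..k. y i)) (\<Pi>\<^sub>E i\<in>{1..k}. UNIV)"
  proof (rule abs_summable_on_comparison_test)
    fix y :: "nat \<Rightarrow> nat"
    have "neg_multinomial_mass k s q y * M ^ (\<Sum>i=1..k. y i) \<le> C * \<rho> ^ (\<Sum>i=1..k. y i) * M ^ (\<Sum>i=1..k. y i)"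
      using le[of y] M by (intro mult_right_mono) auto
    also have "\<dots> = C * (\<Prod>i\<in>{1..k}. (\<rho> * M) ^ y i)"
      by (simp add: power_mult_distrib power_sum prod.distrib)
    finally show "norm (neg_multinomial_mass k s q y * M ^ (\<Sum>i=1..k. y i)) \<le> norm (C * (\<Prod>i\<in>{1..k}. (\<rho> * M) ^ y i))"
      using neg_multinomial_mass_pos[OF q s, of y] M C by (simp add: abs_mult abs_prod)
  qed
  thus ?thesis using M by blast
qed

definition obs_count :: "(nat \<Rightarrow> nat) \<Rightarrow> (nat \<Rightarrow> nat \<Rightarrow> nat) \<Rightarrow> nat \<Rightarrow> nat" where
  "obs_count m x \<nu> = (\<Sum>i=1..m \<nu>. x \<nu> i)"

text \<open>
  The class of functions of the observation for which expectations are taken; every logarithm below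
  belongs to it.
\<close>

definition linearly_bounded :: "nat \<Rightarrow> (nat \<Rightarrow> nat) \<Rightarrow> ((nat \<Rightarrow> nat \<Rightarrow> nat) \<Rightarrow> real) \<Rightarrow> bool" where
  "linearly_bounded N m h \<longleftrightarrow>
     (\<exists>C. \<forall>x\<in>obs_space N m. \<bar>h x\<bar> \<le> C * (1 + (\<Sum>\<nu>=1..N. real (obs_count m x \<nu>))))"

lemma countable_obs_space: "countable (obs_space N m)"
  unfolding obs_space_def by (intro countable_PiE) auto

text \<open>
  A fixed true parameter \<open>p\<close>. The bound \<open>r \<ge> 1\<close> ensures \<open>X\<^sub>i / (r + n - 1) \<le> 1\<close> in the shift identity.
\<close>

locale observation =
  fixes N :: nat and m :: "nat \<Rightarrow> nat" and r :: "nat \<Rightarrow> real" and p :: "nat \<Rightarrow> nat \<Rightarrow> real"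
  assumes p: "p \<in> param_space N m" and r: "\<And>\<nu>. \<nu> \<in> {1..N} \<Longrightarrow> 1 \<le> r \<nu>"
begin

lemma p_simplex: "\<nu> \<in> {1..N} \<Longrightarrow> p \<nu> \<in> open_simplex (m \<nu>)"
  using p by (auto simp: param_space_def)

lemma r_pos: "\<nu> \<in> {1..N} \<Longrightarrow> 0 < r \<nu>" using r[of \<nu>] by simp

lemma obs_mass_pos: "0 < obs_mass N m r p x"
  unfolding obs_mass_def by (intro prod_pos ballI neg_multinomial_mass_pos p_simplex r_pos)

text \<open>
  By Bernoulli's inequality \<open>1 + (M - 1) n \<le> M\<^sup>n\<close>, a linear function of the counts is bounded by a
  multiple of the product of the \<open>M\<^sub>\<nu>\<^bsup>n\<^esup>\<close>, and the expectation of that product factorizes.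
\<close>

lemma linearly_bounded_summable:
  assumes h: "linearly_bounded N m h"
  shows "Infinite_Set_Sum.abs_summable_on (\<lambda>x. obs_mass N m r p x * h x) (obs_space N m)"
proof -
  obtain C where C: "\<And>x. x \<in> obs_space N m \<Longrightarrow> \<bar>h x\<bar> \<le> C * (1 + (\<Sum>\<nu>=1..N. real (obs_count m x \<nu>)))"
    using h unfolding linearly_bounded_def by blast
  have "\<forall>\<nu>\<in>{1..N}. \<exists>M>1. Infinite_Set_Sum.abs_summable_on (\<lambda>y. neg_multinomial_mass (m \<nu>) (r \<nu>) (p \<nu>) y * M ^ (\<Sum>i=1..m \<nu>. y i)) (\<Pi>\<^sub>E i\<in>{1..m \<nu>}. UNIV)"
    using neg_multinomial_mass_exp_moment p_simplex r_pos by blast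
  then obtain M where M: "\<And>\<nu>. \<nu> \<in> {1..N} \<Longrightarrow> 1 < M \<nu>"
    and sm: "\<And>\<nu>. \<nu> \<in> {1..N} \<Longrightarrow> Infinite_Set_Sum.abs_summable_on (\<lambda>y. neg_multinomial_mass (m \<nu>) (r \<nu>) (p \<nu>) y * M \<nu> ^ (\<Sum>i=1..m \<nu>. y i)) (\<Pi>\<^sub>E i\<in>{1..m \<nu>}. UNIV)" by metis
  define B where "B = \<bar>C\<bar> * (1 + (\<Sum>\<nu>=1..N. 1 / (M \<nu> - 1)))"
  have "Infinite_Set_Sum.abs_summable_on (\<lambda>x. \<Prod>\<nu>\<in>{1..N}. neg_multinomial_mass (m \<nu>) (r \<nu>) (p \<nu>) (x \<nu>) * M \<nu> ^ (\<Sum>i=1..m \<nu>. x \<nu> i)) (\<Pi>\<^sub>E \<nu>\<in>{1..N}. \<Pi>\<^sub>E i\<in>{1..m \<nu>}. UNIV)"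
  proof (rule abs_summable_on_prod_PiE)
    show "countable (\<Pi>\<^sub>E i\<in>{1..m \<nu>}. (UNIV :: nat set))" for \<nu> by (intro countable_PiE) auto
  qed (rule finite_atLeastAtMost, rule sm)
  hence "Infinite_Set_Sum.abs_summable_on (\<lambda>x. B * (\<Prod>\<nu>\<in>{1..N}. neg_multinomial_mass (m \<nu>) (r \<nu>) (p \<nu>) (x \<nu>) * M \<nu> ^ (\<Sum>i=1..m \<nu>. x \<nu> i))) (obs_space N m)"
    unfolding obs_space_def by (rule abs_summable_on_cmult_right)
  thus ?thesis
  proof (rule abs_summable_on_comparison_test)
    fix x assume x: "x \<in> obs_space N m"
    define P where "P = (\<Prod>\<nu>\<in>{1..N}. M \<nu> ^ obs_count m x \<nu>)"
    have P1: "1 \<le> P" unfolding P_def using M by (intro prod_ge_1 one_le_power) (auto intro: less_imp_le)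
    have "real (obs_count m x \<nu>) \<le> 1 / (M \<nu> - 1) * P" if \<nu>: "\<nu> \<in> {1..N}" for \<nu>
    proof -
      have "real (obs_count m x \<nu>) * (M \<nu> - 1) \<le> M \<nu> ^ obs_count m x \<nu>"
        using Bernoulli_inequality[of "M \<nu> - 1" "obs_count m x \<nu>"] M[OF \<nu>] by simp
      also have "\<dots> = (\<Prod>\<mu>\<in>{\<nu>}. M \<mu> ^ obs_count m x \<mu>)" by simp
      also have "\<dots> \<le> P" unfolding P_def
        using \<nu> M by (intro prod_mono2) (auto intro!: one_le_power intro: less_imp_le order.trans[OF zero_le_one])
      finally show ?thesis using M[OF \<nu>] by (simp add: field_simps)
    qed
    hence "(\<Sum>\<nu>=1..N. real (obs_count m x \<nu>)) \<le> (\<Sum>\<nu>=1..N. 1 / (M \<nu> - 1) * P)"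
      by (rule sum_mono)
    hence le: "1 + (\<Sum>\<nu>=1..N. real (obs_count m x \<nu>)) \<le> (1 + (\<Sum>\<nu>=1..N. 1 / (M \<nu> - 1))) * P"
      using P1 by (simp add: algebra_simps sum_distrib_left)
    have "\<bar>h x\<bar> \<le> \<bar>C\<bar> * (1 + (\<Sum>\<nu>=1..N. real (obs_count m x \<nu>)))"
      by (rule order.trans[OF C[OF x]]) (intro mult_right_mono, auto intro!: add_nonneg_nonneg sum_nonneg)
    also have "\<dots> \<le> \<bar>C\<bar> * ((1 + (\<Sum>\<nu>=1..N. 1 / (M \<nu> - 1))) * P)"
      using le by (intro mult_left_mono) auto
    finally have "\<bar>h x\<bar> \<le> B * P" by (simp add: B_def mult_ac)
    hence "obs_mass N m r p x * \<bar>h x\<bar> \<le> obs_mass N m r p x * (B * P)"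
      using obs_mass_pos[of x] by (intro mult_left_mono) auto
    also have "\<dots> = B * (\<Prod>\<nu>\<in>{1..N}. neg_multinomial_mass (m \<nu>) (r \<nu>) (p \<nu>) (x \<nu>) * M \<nu> ^ (\<Sum>i=1..m \<nu>. x \<nu> i))"
      by (simp add: obs_mass_def P_def obs_count_def prod.distrib mult_ac)
    finally show "norm (obs_mass N m r p x * h x)
      \<le> norm (B * (\<Prod>\<nu>\<in>{1..N}. neg_multinomial_mass (m \<nu>) (r \<nu>) (p \<nu>) (x \<nu>) * M \<nu> ^ (\<Sum>i=1..m \<nu>. x \<nu> i)))"
      using obs_mass_pos[of x] unfolding real_norm_def abs_mult[of "obs_mass N m r p x"] by linarith
  qed
qed

definition obs_expectation :: "((nat \<Rightarrow> nat \<Rightarrow> nat) \<Rightarrow> real) \<Rightarrow> real" where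
  "obs_expectation h = (\<Sum>\<^sub>ax\<in>obs_space N m. obs_mass N m r p x * h x)"

text \<open>
  Adding one count in cell \<open>i\<close> multiplies the negative multinomial mass by \<open>p\<^sub>i (r + n) / (x\<^sub>i + 1)\<close>.
\<close>

lemma obs_mass_shift:
  assumes \<nu>: "\<nu> \<in> {1..N}" and i: "i \<in> {1..m \<nu>}"
  shows "obs_mass N m r p (x(\<nu> := (x \<nu>)(i := Suc (x \<nu> i)))) * (real (Suc (x \<nu> i)) / (r \<nu> + real (obs_count m x \<nu>)))
       = obs_mass N m r p x * cell_prob (m \<nu>) (p \<nu>) i"
proof -
  let ?x = "x(\<nu> := (x \<nu>)(i := Suc (x \<nu> i)))" and ?y = "(x \<nu>)(i := Suc (x \<nu> i))"
  let ?n = "\<Sum>i=1..m \<nu>. x \<nu> i"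
  have rest: "(\<Prod>\<mu>\<in>{1..N}-{\<nu>}. neg_multinomial_mass (m \<mu>) (r \<mu>) (p \<mu>) (?x \<mu>))
      = (\<Prod>\<mu>\<in>{1..N}-{\<nu>}. neg_multinomial_mass (m \<mu>) (r \<mu>) (p \<mu>) (x \<mu>))"
    by (intro prod.cong) auto
  have one: "neg_multinomial_mass (m \<nu>) (r \<nu>) (p \<nu>) ?y * (real (Suc (x \<nu> i)) / (r \<nu> + real ?n))
      = neg_multinomial_mass (m \<nu>) (r \<nu>) (p \<nu>) (x \<nu>) * cell_prob (m \<nu>) (p \<nu>) i"
  proof -
    have fi: "finite {1..m \<nu>}" by simp
    have a: "(\<Sum>j\<in>{1..m \<nu>}-{i}. ?y j) = (\<Sum>j\<in>{1..m \<nu>}-{i}. x \<nu> j)" by (intro sum.cong) auto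
    have b: "(\<Prod>j\<in>{1..m \<nu>}-{i}. fact (?y j)) = (\<Prod>j\<in>{1..m \<nu>}-{i}. fact (x \<nu> j) :: real)" by (intro prod.cong) auto
    have c: "(\<Prod>j\<in>{1..m \<nu>}-{i}. cell_prob (m \<nu>) (p \<nu>) j ^ ?y j) = (\<Prod>j\<in>{1..m \<nu>}-{i}. cell_prob (m \<nu>) (p \<nu>) j ^ x \<nu> j)"
      by (intro prod.cong) auto
    have A: "(\<Sum>j=1..m \<nu>. ?y j) = ?n + 1" using sum.remove[OF fi i, of ?y] sum.remove[OF fi i, of "x \<nu>"] a by simp
    have B: "(\<Prod>j=1..m \<nu>. fact (?y j) :: real) = real (Suc (x \<nu> i)) * (\<Prod>j=1..m \<nu>. fact (x \<nu> j))"
      unfolding prod.remove[OF fi i] b by simp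
    have C: "(\<Prod>j=1..m \<nu>. cell_prob (m \<nu>) (p \<nu>) j ^ ?y j) = cell_prob (m \<nu>) (p \<nu>) i * (\<Prod>j=1..m \<nu>. cell_prob (m \<nu>) (p \<nu>) j ^ x \<nu> j)"
      unfolding prod.remove[OF fi i] c by simp
    have rn: "0 < r \<nu> + real ?n" using r_pos[OF \<nu>] by (simp add: add_pos_nonneg sum_nonneg)
    have G: "Gamma (r \<nu> + real (?n + 1)) = (r \<nu> + real ?n) * Gamma (r \<nu> + real ?n)"
    proof -
      have "r \<nu> + real ?n \<notin> \<int>\<^sub>\<le>\<^sub>0" using rn by (auto elim!: nonpos_Ints_cases)
      from Gamma_plus1[OF this] show ?thesis by (simp only: of_nat_add of_nat_1 add.assoc)
    qed
    have arith: "(R * g) / (G * (S * f)) * P * (c * Q) * (S / R) = g / (G * f) * P * Q * c"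
      if "R \<noteq> 0" "S \<noteq> 0" for R g G S f P c Q :: real
      using that by (simp add: field_simps)
    show ?thesis unfolding neg_multinomial_mass_def A B C G
      by (rule arith) (use rn in auto)
  qed
  have "A * P * k = B * P * c" if "A * k = B * c" for A B P k c :: real
    using that by (metis mult.assoc mult.commute)
  from this[OF one] show ?thesis
    by (simp only: obs_mass_def obs_count_def prod.remove[OF finite_atLeastAtMost \<nu>] rest fun_upd_same)
qed

lemma obs_count_shift:
  assumes "i \<in> {1..m \<nu>}"
  shows "obs_count m (x(\<nu> := (x \<nu>)(i := Suc (x \<nu> i)))) = (obs_count m x)(\<nu> := Suc (obs_count m x \<nu>))"
proof
  fix \<mu>
  have "(\<Sum>j\<in>{1..m \<nu>}-{i}. ((x \<nu>)(i := Suc (x \<nu> i))) j) = (\<Sum>j\<in>{1..m \<nu>}-{i}. x \<nu> j)" by (intro sum.cong) auto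
  thus "obs_count m (x(\<nu> := (x \<nu>)(i := Suc (x \<nu> i)))) \<mu> = ((obs_count m x)(\<nu> := Suc (obs_count m x \<nu>))) \<mu>"
    using sum.remove[OF _ assms, of "(x \<nu>)(i := Suc (x \<nu> i))"] sum.remove[OF _ assms, of "x \<nu>"]
    by (auto simp: obs_count_def)
qed

lemma shift_bij:
  assumes \<nu>: "\<nu> \<in> {1..N}" and i: "i \<in> {1..m \<nu>}"
  shows "bij_betw (\<lambda>x. x(\<nu> := (x \<nu>)(i := Suc (x \<nu> i)))) (obs_space N m) {x \<in> obs_space N m. 0 < x \<nu> i}"
proof (rule bij_betwI[where g = "\<lambda>x. x(\<nu> := (x \<nu>)(i := x \<nu> i - 1))"])
  show "(\<lambda>x. x(\<nu> := (x \<nu>)(i := Suc (x \<nu> i)))) \<in> obs_space N m \<rightarrow> {x \<in> obs_space N m. 0 < x \<nu> i}"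
    using assms by (fastforce simp: obs_space_def PiE_iff extensional_def)
  show "(\<lambda>x. x(\<nu> := (x \<nu>)(i := x \<nu> i - 1))) \<in> {x \<in> obs_space N m. 0 < x \<nu> i} \<rightarrow> obs_space N m"
    using assms by (fastforce simp: obs_space_def PiE_iff extensional_def)
qed auto

text \<open>
  The substitution \<open>x \<mapsto> x + e\<^sub>i\<close> in the sum over observations. It trades the unknown probability \<open>p\<^sub>i\<close>
  for an expression in the observation alone; terms with \<open>x\<^sub>i = 0\<close> vanish on the right-hand side.
\<close>

lemma obs_expectation_shift:
  assumes \<nu>: "\<nu> \<in> {1..N}" and i: "i \<in> {1..m \<nu>}" and H: "linearly_bounded N m (\<lambda>x. H (obs_count m x))"
  shows "cell_prob (m \<nu>) (p \<nu>) i * obs_expectation (\<lambda>x. H (obs_count m x))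
       = obs_expectation (\<lambda>x. real (x \<nu> i) / (r \<nu> + real (obs_count m x \<nu>) - 1)
            * H ((obs_count m x)(\<nu> := obs_count m x \<nu> - 1)))"
proof -
  let ?g = "\<lambda>x. real (x \<nu> i) / (r \<nu> + real (obs_count m x \<nu>) - 1) * H ((obs_count m x)(\<nu> := obs_count m x \<nu> - 1))"
  let ?T = "\<lambda>x. x(\<nu> := (x \<nu>)(i := Suc (x \<nu> i)))"
  have "obs_expectation ?g = (\<Sum>\<^sub>ax\<in>{x \<in> obs_space N m. 0 < x \<nu> i}. obs_mass N m r p x * ?g x)"
    unfolding obs_expectation_def by (intro infsetsum_cong_neutral) auto
  also have "\<dots> = (\<Sum>\<^sub>ax\<in>obs_space N m. obs_mass N m r p (?T x) * ?g (?T x))"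
    by (rule infsetsum_reindex_bij_betw[OF shift_bij[OF \<nu> i], symmetric])
  also have "\<dots> = (\<Sum>\<^sub>ax\<in>obs_space N m. cell_prob (m \<nu>) (p \<nu>) i * (obs_mass N m r p x * H (obs_count m x)))"
  proof (intro infsetsum_cong refl)
    fix x
    have "?g (?T x) = real (Suc (x \<nu> i)) / (r \<nu> + real (obs_count m x \<nu>)) * H (obs_count m x)"
      unfolding obs_count_shift[OF i] by simp
    thus "obs_mass N m r p (?T x) * ?g (?T x) = cell_prob (m \<nu>) (p \<nu>) i * (obs_mass N m r p x * H (obs_count m x))"
      using obs_mass_shift[OF \<nu> i, of x] by (metis mult.assoc mult.commute)
  qed
  also have "\<dots> = cell_prob (m \<nu>) (p \<nu>) i * obs_expectation (\<lambda>x. H (obs_count m x))"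
    unfolding obs_expectation_def by (rule infsetsum_cmult_right) (use linearly_bounded_summable[OF H] in auto)
  finally show ?thesis by simp
qed

text \<open>
  If \<open>x\<^sub>i = 0\<close> the coefficient is \<open>0\<close>. Otherwise the coefficient lies in \<open>[0, 1]\<close> and the reduced counts
  come from an observation again.
\<close>

lemma linearly_bounded_count_pred:
  assumes H: "linearly_bounded N m (\<lambda>x. H (obs_count m x))" and \<nu>: "\<nu> \<in> {1..N}" and i: "i \<in> {1..m \<nu>}"
  shows "linearly_bounded N m (\<lambda>x. real (x \<nu> i) / (r \<nu> + real (obs_count m x \<nu>) - 1)
            * H ((obs_count m x)(\<nu> := obs_count m x \<nu> - 1)))"
proof -
  obtain C where C: "\<And>x. x \<in> obs_space N m \<Longrightarrow> \<bar>H (obs_count m x)\<bar> \<le> C * (1 + (\<Sum>\<nu>=1..N. real (obs_count m x \<nu>)))"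
    using H unfolding linearly_bounded_def by blast
  have "\<bar>real (x \<nu> i) / (r \<nu> + real (obs_count m x \<nu>) - 1) * H ((obs_count m x)(\<nu> := obs_count m x \<nu> - 1))\<bar>
      \<le> \<bar>C\<bar> * (1 + (\<Sum>\<nu>=1..N. real (obs_count m x \<nu>)))" if x: "x \<in> obs_space N m" for x
  proof (cases "x \<nu> i = 0")
    case True
    thus ?thesis by (auto intro!: mult_nonneg_nonneg add_nonneg_nonneg sum_nonneg)
  next
    case False
    define x' where "x' = x(\<nu> := (x \<nu>)(i := x \<nu> i - 1))"
    have x': "x' \<in> obs_space N m"
      using x \<nu> i by (fastforce simp: x'_def obs_space_def PiE_iff extensional_def)
    have xx': "x = x'(\<nu> := (x' \<nu>)(i := Suc (x' \<nu> i)))" using False by (auto simp: x'_def)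
    have cnt: "obs_count m x = (obs_count m x')(\<nu> := Suc (obs_count m x' \<nu>))"
      by (subst xx', rule obs_count_shift[OF i])
    have "x \<nu> i \<le> obs_count m x \<nu>" unfolding obs_count_def using i by (intro member_le_sum) auto
    hence "real (x \<nu> i) / (r \<nu> + real (obs_count m x \<nu>) - 1) \<le> 1" "0 \<le> real (x \<nu> i) / (r \<nu> + real (obs_count m x \<nu>) - 1)"
      using r[OF \<nu>] False by (simp_all add: divide_le_eq_1)
    hence "\<bar>real (x \<nu> i) / (r \<nu> + real (obs_count m x \<nu>) - 1) * H (obs_count m x')\<bar> \<le> 1 * \<bar>H (obs_count m x')\<bar>"
      unfolding abs_mult by (intro mult_right_mono) (simp_all only: abs_of_nonneg abs_ge_zero)
    also have "\<dots> \<le> C * (1 + (\<Sum>\<nu>=1..N. real (obs_count m x' \<nu>)))" using C[OF x'] by simp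
    also have "\<dots> \<le> \<bar>C\<bar> * (1 + (\<Sum>\<nu>=1..N. real (obs_count m x' \<nu>)))"
      by (intro mult_right_mono) (auto intro!: add_nonneg_nonneg sum_nonneg)
    also have "\<dots> \<le> \<bar>C\<bar> * (1 + (\<Sum>\<nu>=1..N. real (obs_count m x \<nu>)))"
      by (intro mult_left_mono add_left_mono sum_mono) (auto simp: cnt)
    finally show ?thesis by (simp add: cnt)
  qed
  thus ?thesis unfolding linearly_bounded_def by blast
qed

lemma linearly_bounded_add:
  assumes "linearly_bounded N m g" "linearly_bounded N m h"
  shows "linearly_bounded N m (\<lambda>x. g x + h x)"
proof -
  obtain C D where "\<And>x. x \<in> obs_space N m \<Longrightarrow> \<bar>g x\<bar> \<le> C * (1 + (\<Sum>\<nu>=1..N. real (obs_count m x \<nu>)))"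
    "\<And>x. x \<in> obs_space N m \<Longrightarrow> \<bar>h x\<bar> \<le> D * (1 + (\<Sum>\<nu>=1..N. real (obs_count m x \<nu>)))"
    using assms unfolding linearly_bounded_def by blast
  hence "\<bar>g x + h x\<bar> \<le> (C + D) * (1 + (\<Sum>\<nu>=1..N. real (obs_count m x \<nu>)))" if "x \<in> obs_space N m" for x
    using abs_triangle_ineq[of "g x" "h x"] that by (fastforce simp: distrib_right)
  thus ?thesis unfolding linearly_bounded_def by blast
qed

lemma linearly_bounded_cmult:
  assumes "linearly_bounded N m h"
  shows "linearly_bounded N m (\<lambda>x. c * h x)"
proof -
  obtain C where "\<And>x. x \<in> obs_space N m \<Longrightarrow> \<bar>h x\<bar> \<le> C * (1 + (\<Sum>\<nu>=1..N. real (obs_count m x \<nu>)))"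
    using assms unfolding linearly_bounded_def by blast
  hence "\<bar>c * h x\<bar> \<le> (\<bar>c\<bar> * C) * (1 + (\<Sum>\<nu>=1..N. real (obs_count m x \<nu>)))" if "x \<in> obs_space N m" for x
    using that mult_left_mono[of "\<bar>h x\<bar>" _ "\<bar>c\<bar>"] by (simp add: abs_mult mult.assoc)
  thus ?thesis unfolding linearly_bounded_def by blast
qed

lemma linearly_bounded_diff:
  assumes "linearly_bounded N m g" "linearly_bounded N m h"
  shows "linearly_bounded N m (\<lambda>x. g x - h x)"
  using linearly_bounded_add[OF assms(1) linearly_bounded_cmult[OF assms(2), of "-1"]] by simp

lemma linearly_bounded_const: "linearly_bounded N m (\<lambda>_. c)"
proof -
  have "\<bar>c\<bar> * 1 \<le> \<bar>c\<bar> * (1 + (\<Sum>\<nu>=1..N. real (obs_count m x \<nu>)))" for x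
    by (intro mult_left_mono) (auto intro!: sum_nonneg)
  thus ?thesis unfolding linearly_bounded_def by auto
qed

lemma linearly_bounded_sum:
  assumes "finite A" "\<And>i. i \<in> A \<Longrightarrow> linearly_bounded N m (h i)"
  shows "linearly_bounded N m (\<lambda>x. \<Sum>i\<in>A. h i x)"
  using assms by (induction A rule: finite_induct) (auto intro: linearly_bounded_add linearly_bounded_const)

lemma obs_expectation_diff:
  assumes "linearly_bounded N m g" "linearly_bounded N m h"
  shows "obs_expectation (\<lambda>x. g x - h x) = obs_expectation g - obs_expectation h"
  unfolding obs_expectation_def right_diff_distrib
  by (intro infsetsum_diff linearly_bounded_summable assms)

lemma obs_expectation_sum:
  assumes "finite A" "\<And>i. i \<in> A \<Longrightarrow> linearly_bounded N m (h i)"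
  shows "obs_expectation (\<lambda>x. \<Sum>i\<in>A. h i x) = (\<Sum>i\<in>A. obs_expectation (h i))"
  unfolding obs_expectation_def sum_distrib_left
  by (intro sum_infsetsum[symmetric] linearly_bounded_summable assms)

text \<open>
  The shift identity summed over the cells \<open>i \<ge> 1\<close>, whose probabilities add up to \<open>1 - p\<^sub>0\<close>.
\<close>

lemma obs_expectation_zero_cell:
  assumes H: "linearly_bounded N m (\<lambda>x. H (obs_count m x))" and \<nu>: "\<nu> \<in> {1..N}"
  shows "linearly_bounded N m (\<lambda>x. real (obs_count m x \<nu>) / (r \<nu> + real (obs_count m x \<nu>) - 1)
            * H ((obs_count m x)(\<nu> := obs_count m x \<nu> - 1)))"
    and "cell_prob (m \<nu>) (p \<nu>) 0 * obs_expectation (\<lambda>x. H (obs_count m x))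
       = obs_expectation (\<lambda>x. H (obs_count m x)) -
         obs_expectation (\<lambda>x. real (obs_count m x \<nu>) / (r \<nu> + real (obs_count m x \<nu>) - 1)
            * H ((obs_count m x)(\<nu> := obs_count m x \<nu> - 1)))"
proof -
  let ?g = "\<lambda>x. real (obs_count m x \<nu>) / (r \<nu> + real (obs_count m x \<nu>) - 1)
            * H ((obs_count m x)(\<nu> := obs_count m x \<nu> - 1))"
  define g where "g i x = real (x \<nu> i) / (r \<nu> + real (obs_count m x \<nu>) - 1)
            * H ((obs_count m x)(\<nu> := obs_count m x \<nu> - 1))" for i and x :: "nat \<Rightarrow> nat \<Rightarrow> nat"
  have lb: "linearly_bounded N m (g i)" if "i \<in> {1..m \<nu>}" for i
    unfolding g_def[abs_def] by (rule linearly_bounded_count_pred[OF H \<nu> that])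
  have g: "?g = (\<lambda>x. \<Sum>i\<in>{1..m \<nu>}. g i x)"
    by (simp add: g_def obs_count_def sum_distrib_right[symmetric] sum_divide_distrib[symmetric])
  show "linearly_bounded N m ?g" unfolding g by (intro linearly_bounded_sum lb) auto
  have "obs_expectation ?g = (\<Sum>i\<in>{1..m \<nu>}. obs_expectation (g i))"
    unfolding g by (intro obs_expectation_sum lb) auto
  also have "\<dots> = (\<Sum>i\<in>{1..m \<nu>}. cell_prob (m \<nu>) (p \<nu>) i * obs_expectation (\<lambda>x. H (obs_count m x)))"
    unfolding g_def[abs_def] by (intro sum.cong refl obs_expectation_shift[symmetric] \<nu> H)
  also have "\<dots> = (1 - cell_prob (m \<nu>) (p \<nu>) 0) * obs_expectation (\<lambda>x. H (obs_count m x))"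
    unfolding open_simplexD(4)[OF p_simplex[OF \<nu>]] by (simp add: sum_distrib_right)
  finally show "cell_prob (m \<nu>) (p \<nu>) 0 * obs_expectation (\<lambda>x. H (obs_count m x))
       = obs_expectation (\<lambda>x. H (obs_count m x)) - obs_expectation ?g" by (simp add: algebra_simps)
qed

lemma obs_expectation_pos:
  assumes h: "linearly_bounded N m h"
    and nonneg: "\<And>x. x \<in> obs_space N m \<Longrightarrow> 0 \<le> h x"
    and pos: "x0 \<in> obs_space N m" "0 < h x0"
  shows "0 < obs_expectation h"
proof -
  have "(\<Sum>\<^sub>ax\<in>{x0}. obs_mass N m r p x * h x) \<le> obs_expectation h"
    unfolding obs_expectation_def
    using linearly_bounded_summable[OF h] pos nonneg obs_mass_pos
    by (intro infsetsum_mono_neutral_left) (auto intro!: mult_nonneg_nonneg less_imp_le[OF obs_mass_pos])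
  moreover have "(\<Sum>\<^sub>ax\<in>{x0}. obs_mass N m r p x * h x) = obs_mass N m r p x0 * h x0" by simp
  ultimately show ?thesis using mult_pos_pos[OF obs_mass_pos pos(2)] by (metis less_le_trans)
qed

end

section \<open>The expected log gain grows with every draw\<close>

text \<open>
  Here \<open>asum \<nu>\<close> is the sum of the prior parameters of the nonzero cells of \<open>\<nu>\<close>, and \<open>K \<nu>\<close> the number
  of draws from \<open>\<nu>\<close> in all predicted tables together.
\<close>

locale shrinkage_setting = observation N m r p + mixing "{1..N}" \<alpha> \<beta> \<gamma>
  for N m r p \<alpha> \<beta> and \<gamma> :: "nat \<Rightarrow> real" +
  fixes a0 asum :: "nat \<Rightarrow> real" and K :: "nat \<Rightarrow> nat"
  assumes ra0: "\<And>\<nu>. \<nu> \<in> {1..N} \<Longrightarrow> 0 < r \<nu> + a0 \<nu>"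
    and asum: "\<And>\<nu>. \<nu> \<in> {1..N} \<Longrightarrow> 0 < asum \<nu>"
    and cond: "\<And>\<nu> n. \<nu> \<in> {1..N} \<Longrightarrow> 1 \<le> n \<Longrightarrow>
        ((\<alpha> + 1) * \<gamma> \<nu> / (\<beta> + \<gamma> \<nu>) - asum \<nu>) * (r \<nu> - 1)
           \<le> real n * (- ((\<alpha> + 1) * \<gamma> \<nu> / (\<beta> + \<gamma> \<nu>)) - real (K \<nu>) - a0 \<nu>)"
begin

definition zero_par :: "(nat \<Rightarrow> nat) \<Rightarrow> nat \<Rightarrow> real" where
  "zero_par c \<nu> = r \<nu> + a0 \<nu> + real (c \<nu>)"

definition total_par :: "(nat \<Rightarrow> nat) \<Rightarrow> (nat \<Rightarrow> nat) \<Rightarrow> nat \<Rightarrow> real" where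
  "total_par k n \<nu> = r \<nu> + a0 \<nu> + asum \<nu> + real (k \<nu>) + real (n \<nu>)"

definition log_gain :: "(nat \<Rightarrow> nat) \<Rightarrow> (nat \<Rightarrow> nat) \<Rightarrow> (nat \<Rightarrow> nat) \<Rightarrow> real" where
  "log_gain c k n = ln (F (zero_par c) (total_par k n))"

text \<open>
  In \<open>potential c k\<close> the number of draws made so far from \<open>\<nu>\<close> is \<open>k \<nu>\<close>, and \<open>c \<nu>\<close> of them gave cell
  \<open>0\<close>. The state \<open>c\<close> is random and \<open>k\<close> is not.
\<close>

definition potential :: "(nat \<Rightarrow> nat) \<Rightarrow> (nat \<Rightarrow> nat) \<Rightarrow> real" where
  "potential c k = obs_expectation (\<lambda>x. log_gain c k (obs_count m x))"

lemma admissible_par: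
  assumes "\<And>\<mu>. \<mu> \<in> {1..N} \<Longrightarrow> c \<mu> \<le> k \<mu>"
  shows "admissible (zero_par c) (total_par k n)"
  unfolding admissible_def
proof (intro ballI conjI)
  fix \<mu> assume \<mu>: "\<mu> \<in> {1..N}"
  show "0 < zero_par c \<mu>" using ra0[OF \<mu>] by (simp add: zero_par_def add_pos_nonneg)
  show "zero_par c \<mu> \<le> total_par k n \<mu>"
    using asum[OF \<mu>] assms[OF \<mu>] by (simp add: zero_par_def total_par_def)
qed

lemma log_gain_linearly_bounded:
  assumes "\<And>\<mu>. \<mu> \<in> {1..N} \<Longrightarrow> c \<mu> \<le> k \<mu>"
  shows "linearly_bounded N m (\<lambda>x. log_gain c k (obs_count m x))"
proof -
  obtain C where C: "\<And>n. \<bar>ln (F (zero_par c) (\<lambda>\<nu>. total_par k (\<lambda>_. 0) \<nu> + real (n \<nu>)))\<bar> \<le> C * (1 + (\<Sum>\<nu>\<in>{1..N}. real (n \<nu>)))"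
    using ln_F_bound[OF admissible_par[of c k "\<lambda>_. 0"]] assms by blast
  have "total_par k n = (\<lambda>\<nu>. total_par k (\<lambda>_. 0) \<nu> + real (n \<nu>))" for n
    by (auto simp: total_par_def)
  with C show ?thesis unfolding linearly_bounded_def log_gain_def by metis
qed

lemma zero_par_Suc: "zero_par (c(\<nu> := Suc (c \<nu>))) = (zero_par c)(\<nu> := zero_par c \<nu> + 1)"
  by (auto simp: zero_par_def)

lemma total_par_Suc: "total_par (k(\<nu> := Suc (k \<nu>))) n = (total_par k n)(\<nu> := total_par k n \<nu> + 1)"
  by (auto simp: total_par_def)

lemma total_par_pred: "0 < n \<nu> \<Longrightarrow> total_par k (n(\<nu> := n \<nu> - 1)) = (total_par k n)(\<nu> := total_par k n \<nu> - 1)"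
  by (auto simp: total_par_def of_nat_diff)

text \<open>
  The last draw from \<open>\<nu>\<close> is preceded by at most \<open>K \<nu> - 1\<close> draws, and at most all of them gave
  cell \<open>0\<close>. For \<open>c = k\<close> the claim multiplied by \<open>r + n - 1\<close> reads
  \<open>\<kappa> (r + n - 1) \<le> (r - 1) asum - n (a0 + k + 1)\<close>, which is the assumption on \<open>n\<close> with \<open>k + 1\<close> in
  place of the larger or equal number \<open>K \<nu>\<close>.
\<close>

lemma shape_condition:
  assumes \<nu>: "\<nu> \<in> {1..N}" and ck: "c \<nu> \<le> k \<nu>" and k: "k \<nu> < K \<nu>" and n: "0 < n \<nu>"
  shows "zero_par c \<nu> + (\<alpha> + 1) * \<gamma> \<nu> / (\<beta> + \<gamma> \<nu>) \<le> (r \<nu> - 1) / (r \<nu> + real (n \<nu>) - 1) * total_par k n \<nu>"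
proof -
  define \<kappa> where "\<kappa> = (\<alpha> + 1) * \<gamma> \<nu> / (\<beta> + \<gamma> \<nu>)"
  define t where "t = real (n \<nu>)"
  have t: "1 \<le> t" using n by (simp add: t_def)
  have r1: "1 \<le> r \<nu>" by (rule r[OF \<nu>])
  have c: "(\<kappa> - asum \<nu>) * (r \<nu> - 1) \<le> t * (- \<kappa> - real (K \<nu>) - a0 \<nu>)"
    using cond[OF \<nu>, of "n \<nu>"] n by (simp add: \<kappa>_def t_def)
  have "t * (a0 \<nu> + real (k \<nu>) + 1) \<le> t * (a0 \<nu> + real (K \<nu>))"
    using k t by (intro mult_left_mono) auto
  hence "\<kappa> * (r \<nu> + t - 1) \<le> (r \<nu> - 1) * asum \<nu> - t * (a0 \<nu> + real (k \<nu>) + 1)"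
    using c by (simp add: algebra_simps)
  also have "\<dots> = (r \<nu> - 1) * (r \<nu> + a0 \<nu> + asum \<nu> + real (k \<nu>) + t) - (r \<nu> + t - 1) * (r \<nu> + a0 \<nu> + real (k \<nu>))"
    by (simp add: algebra_simps)
  finally have "(r \<nu> + a0 \<nu> + real (k \<nu>) + \<kappa>) * (r \<nu> + t - 1) \<le> (r \<nu> - 1) * total_par k n \<nu>"
    by (simp add: total_par_def t_def algebra_simps)
  moreover have "(zero_par c \<nu> + \<kappa>) * (r \<nu> + t - 1) \<le> (r \<nu> + a0 \<nu> + real (k \<nu>) + \<kappa>) * (r \<nu> + t - 1)"
    using ck t r1 by (intro mult_right_mono) (auto simp: zero_par_def)
  ultimately have "(zero_par c \<nu> + \<kappa>) * (r \<nu> + t - 1) \<le> (r \<nu> - 1) * total_par k n \<nu>" by linarith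
  thus ?thesis using t r1 unfolding \<kappa>_def[symmetric] t_def[symmetric] by (simp add: field_simps)
qed

text \<open>
  The increase of the potential is \<open>p\<^sub>0 E H - E G\<close>, where \<open>H\<close> is the advantage of cell \<open>0\<close> and \<open>G\<close> the
  loss caused by a nonzero cell. The identity \<open>obs_expectation_zero_cell\<close> turns it into the expectation
  of one function of the observation, which is nonnegative everywhere and positive at the zero
  observation.
\<close>

lemma potential_drift:
  assumes \<nu>: "\<nu> \<in> {1..N}" and ck: "\<And>\<mu>. \<mu> \<in> {1..N} \<Longrightarrow> c \<mu> \<le> k \<mu>" and k: "k \<nu> < K \<nu>"
  shows "potential c k < cell_prob (m \<nu>) (p \<nu>) 0 * potential (c(\<nu> := Suc (c \<nu>))) (k(\<nu> := Suc (k \<nu>)))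
           + (1 - cell_prob (m \<nu>) (p \<nu>) 0) * potential c (k(\<nu> := Suc (k \<nu>)))"
proof -
  let ?c = "c(\<nu> := Suc (c \<nu>))" and ?k = "k(\<nu> := Suc (k \<nu>))" and ?n = "obs_count m"
  define \<pi> where "\<pi> = cell_prob (m \<nu>) (p \<nu>) 0"
  have lb0: "linearly_bounded N m (\<lambda>x. log_gain c k (?n x))"
    by (rule log_gain_linearly_bounded) (use ck in auto)
  have lb1: "linearly_bounded N m (\<lambda>x. log_gain ?c ?k (?n x))"
    by (rule log_gain_linearly_bounded) (use ck in auto)
  have lb2: "linearly_bounded N m (\<lambda>x. log_gain c ?k (?n x))"
    by (rule log_gain_linearly_bounded) (use ck in \<open>auto simp: le_SucI\<close>)
  define H where "H n = log_gain ?c ?k n - log_gain c ?k n" for n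
  define G where "G n = log_gain c k n - log_gain c ?k n" for n
  have lbH: "linearly_bounded N m (\<lambda>x. H (?n x))" unfolding H_def by (rule linearly_bounded_diff[OF lb1 lb2])
  have lbG: "linearly_bounded N m (\<lambda>x. G (?n x))" unfolding G_def by (rule linearly_bounded_diff[OF lb0 lb2])
  have adm: "admissible (zero_par c) (total_par k n)" for n by (rule admissible_par) (use ck in auto)
  have admS: "admissible (zero_par c) (total_par ?k n)" for n by (rule admissible_par) (use ck in \<open>auto simp: le_SucI\<close>)
  have admSS: "admissible (zero_par ?c) (total_par ?k n)" for n by (rule admissible_par) (use ck in auto)
  have H_L: "H n = zero_gain (zero_par c) (total_par k n) \<nu>" for n
    using F_pos[OF admS, of n] F_pos[OF admSS, of n]
    unfolding H_def log_gain_def zero_gain_def zero_par_Suc total_par_Suc by (simp add: ln_div)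
  have G_F: "G n = ln (F (zero_par c) (total_par k n) / F (zero_par c) ((total_par k n)(\<nu> := total_par k n \<nu> + 1)))" for n
    using F_pos[OF admS, of n] F_pos[OF adm, of n]
    unfolding G_def log_gain_def total_par_Suc by (simp add: ln_div)
  note E0 = obs_expectation_zero_cell[OF lbH \<nu>]
  define Z where "Z x = real (?n x \<nu>) / (r \<nu> + real (?n x \<nu>) - 1) * H ((?n x)(\<nu> := ?n x \<nu> - 1))" for x
  have lbZ: "linearly_bounded N m Z" unfolding Z_def[abs_def] by (rule E0(1))
  have Hx: "\<pi> * obs_expectation (\<lambda>x. H (?n x)) = obs_expectation (\<lambda>x. H (?n x)) - obs_expectation Z"
    unfolding Z_def[abs_def] \<pi>_def by (rule E0(2))
  have pointwise: "G n < H n" if "n \<nu> = 0" for n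
  proof -
    have "zero_par c \<nu> < total_par k n \<nu>"
      using asum[OF \<nu>] ck[OF \<nu>] by (simp add: zero_par_def total_par_def)
    thus ?thesis unfolding G_F H_L by (intro first_draw_inequality adm \<nu>)
  qed
  have nonneg: "0 \<le> H (?n x) - Z x - G (?n x)" for x
  proof (cases "?n x \<nu> = 0")
    case True
    thus ?thesis using pointwise[of "?n x"] True by (simp add: Z_def)
  next
    case False
    define \<theta> where "\<theta> = (r \<nu> - 1) / (r \<nu> + real (?n x \<nu>) - 1)"
    have n1: "1 \<le> real (?n x \<nu>)" and r1: "1 \<le> r \<nu>" using False r[OF \<nu>] by auto
    have "G (?n x) \<le> zero_gain (zero_par c) (total_par k (?n x)) \<nu>
        - (1 - \<theta>) * zero_gain (zero_par c) ((total_par k (?n x))(\<nu> := total_par k (?n x) \<nu> - 1)) \<nu>"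
      unfolding G_F
    proof (rule one_draw_inequality[OF adm \<nu>])
      show "zero_par c \<nu> \<le> total_par k (?n x) \<nu> - 1"
        using asum[OF \<nu>] ck[OF \<nu>] n1 by (simp add: zero_par_def total_par_def)
      show "zero_par c \<nu> + (\<alpha> + 1) * \<gamma> \<nu> / (\<beta> + \<gamma> \<nu>) \<le> \<theta> * total_par k (?n x) \<nu>"
        unfolding \<theta>_def by (rule shape_condition[OF \<nu>]) (use ck[OF \<nu>] k False in auto)
      show "0 \<le> \<theta>" "\<theta> \<le> 1" using n1 r1 by (auto simp: \<theta>_def)
    qed
    moreover have "1 - \<theta> = real (?n x \<nu>) / (r \<nu> + real (?n x \<nu>) - 1)"
      using n1 r1 by (simp add: \<theta>_def field_simps)
    ultimately show ?thesis
      unfolding Z_def H_L using False total_par_pred[of "?n x" \<nu> k] by (simp only:)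
  qed
  have "0 < obs_expectation (\<lambda>x. H (?n x) - Z x - G (?n x))"
  proof (rule obs_expectation_pos)
    show "linearly_bounded N m (\<lambda>x. H (?n x) - Z x - G (?n x))"
      by (intro linearly_bounded_diff lbH lbZ lbG)
    \<comment> \<open>The zero observation has positive mass, and the inequality is strict there.\<close>
    define x0 :: "nat \<Rightarrow> nat \<Rightarrow> nat" where "x0 = (\<lambda>\<nu>\<in>{1..N}. \<lambda>i\<in>{1..m \<nu>}. 0)"
    show "x0 \<in> obs_space N m" by (auto simp: x0_def obs_space_def)
    have "?n x0 \<nu> = 0" using \<nu> by (simp add: x0_def obs_count_def)
    thus "0 < H (?n x0) - Z x0 - G (?n x0)" using pointwise[of "?n x0"] by (simp add: Z_def)
  qed (rule nonneg)
  also have "obs_expectation (\<lambda>x. H (?n x) - Z x - G (?n x)) = \<pi> * obs_expectation (\<lambda>x. H (?n x)) - obs_expectation (\<lambda>x. G (?n x))"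
    using lbH lbZ lbG by (simp add: obs_expectation_diff linearly_bounded_diff Hx)
  finally have main: "0 < \<pi> * obs_expectation (\<lambda>x. H (?n x)) - obs_expectation (\<lambda>x. G (?n x))" .
  have EH: "obs_expectation (\<lambda>x. H (?n x)) = potential ?c ?k - potential c ?k"
    unfolding H_def potential_def by (rule obs_expectation_diff[OF lb1 lb2])
  have EG: "obs_expectation (\<lambda>x. G (?n x)) = potential c k - potential c ?k"
    unfolding G_def potential_def by (rule obs_expectation_diff[OF lb0 lb2])
  have "C < \<pi> * A + (1 - \<pi>) * B" if "0 < \<pi> * (A - B) - (C - B)" for A B C :: real
    using that by (simp add: algebra_simps)
  from this[OF main[unfolded EH EG]] show ?thesis unfolding \<pi>_def .
qed

end

section \<open>Multinomial tables as sequences of categorical draws\<close>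

lemma sum_PiE_insert:
  assumes "a \<notin> S"
  shows "(\<Sum>f\<in>PiE (insert a S) T. g f) = (\<Sum>f\<in>PiE S T. \<Sum>y\<in>T a. g (f(a := y)))"
proof -
  have "(\<Sum>f\<in>PiE (insert a S) T. g f) = (\<Sum>(y, f)\<in>T a \<times> PiE S T. g (f(a := y)))"
    unfolding PiE_insert_eq
    by (subst sum.reindex[OF inj_combinator[OF assms]]) (simp add: case_prod_unfold)
  also have "\<dots> = (\<Sum>y\<in>T a. \<Sum>f\<in>PiE S T. g (f(a := y)))" by (rule sum.cartesian_product[symmetric])
  also have "\<dots> = (\<Sum>f\<in>PiE S T. \<Sum>y\<in>T a. g (f(a := y)))" by (rule sum.swap)
  finally show ?thesis .
qed

lemma sum_mono_weighted:
  fixes g :: "'a \<Rightarrow> real"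
  shows "(\<And>x. x \<in> A \<Longrightarrow> 0 \<le> g x) \<Longrightarrow> (\<And>x. x \<in> A \<Longrightarrow> f x \<le> h x) \<Longrightarrow> (\<Sum>x\<in>A. g x * f x) \<le> (\<Sum>x\<in>A. g x * h x)"
  by (intro sum_mono mult_left_mono)

definition compositions :: "'a set \<Rightarrow> nat \<Rightarrow> ('a \<Rightarrow> nat) set" where
  "compositions C l = {v \<in> C \<rightarrow>\<^sub>E UNIV. (\<Sum>i\<in>C. v i) = l}"

definition multinomial_sum :: "'a set \<Rightarrow> ('a \<Rightarrow> real) \<Rightarrow> nat \<Rightarrow> (('a \<Rightarrow> nat) \<Rightarrow> real) \<Rightarrow> real" where
  "multinomial_sum C P l \<phi> =
     (\<Sum>v\<in>compositions C l. fact l / (\<Prod>i\<in>C. fact (v i)) * (\<Prod>i\<in>C. P i ^ v i) * \<phi> v)"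

lemma finite_compositions:
  assumes C: "finite C"
  shows "finite (compositions C l)"
proof (rule finite_subset)
  show "compositions C l \<subseteq> (\<Pi>\<^sub>E i\<in>C. {0..l})"
  proof
    fix v assume v: "v \<in> compositions C l"
    have "v i \<le> l" if "i \<in> C" for i
      using v member_le_sum[OF that _ C, of v] by (simp add: compositions_def)
    thus "v \<in> (\<Pi>\<^sub>E i\<in>C. {0..l})" using v by (simp add: compositions_def PiE_iff)
  qed
  show "finite (\<Pi>\<^sub>E i\<in>C. {0..l})" using C by (intro finite_PiE) auto
qed

lemma compositions_0: "finite C \<Longrightarrow> compositions C 0 = {\<lambda>i\<in>C. 0}"
  by (auto simp: compositions_def PiE_iff extensional_def restrict_def fun_eq_iff)

lemma multinomial_sum_0: "finite C \<Longrightarrow> multinomial_sum C P 0 \<phi> = \<phi> (\<lambda>i\<in>C. 0)"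
  by (simp add: multinomial_sum_def compositions_0)

lemma compositions_increment_bij:
  assumes C: "finite C" and i: "i \<in> C"
  shows "bij_betw (\<lambda>v. v(i := Suc (v i))) (compositions C l) {w \<in> compositions C (Suc l). 0 < w i}"
proof (rule bij_betwI[where g = "\<lambda>w. w(i := w i - 1)"])
  have upd: "(\<Sum>j\<in>C. (v(i := x)) j) = x + (\<Sum>j\<in>C - {i}. v j)" for v :: "'a \<Rightarrow> nat" and x
  proof -
    have "(\<Sum>j\<in>C - {i}. (v(i := x)) j) = (\<Sum>j\<in>C - {i}. v j)" by (intro sum.cong) auto
    thus ?thesis unfolding sum.remove[OF C i] by simp
  qed
  show "(\<lambda>v. v(i := Suc (v i))) \<in> compositions C l \<rightarrow> {w \<in> compositions C (Suc l). 0 < w i}"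
  proof (intro Pi_I CollectI conjI)
    fix v assume v: "v \<in> compositions C l"
    have "(\<Sum>j\<in>C. (v(i := Suc (v i))) j) = Suc l"
      using v unfolding upd by (simp add: compositions_def sum.remove[OF C i])
    moreover have "v(i := Suc (v i)) \<in> C \<rightarrow>\<^sub>E UNIV"
      using v i by (simp add: compositions_def PiE_iff extensional_def)
    ultimately show "v(i := Suc (v i)) \<in> compositions C (Suc l)" unfolding compositions_def by blast
  qed auto
  show "(\<lambda>w. w(i := w i - 1)) \<in> {w \<in> compositions C (Suc l). 0 < w i} \<rightarrow> compositions C l"
  proof (intro Pi_I)
    fix w assume w: "w \<in> {w \<in> compositions C (Suc l). 0 < w i}"
    have "(\<Sum>j\<in>C. (w(i := w i - 1)) j) = l"
      using w unfolding upd by (simp add: compositions_def sum.remove[OF C i])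
    moreover have "w(i := w i - 1) \<in> C \<rightarrow>\<^sub>E UNIV"
      using w i by (simp add: compositions_def PiE_iff extensional_def)
    ultimately show "w(i := w i - 1) \<in> compositions C l" unfolding compositions_def by blast
  qed
qed auto

text \<open>
  One of the \<open>l + 1\<close> trials is split off. This comes from \<open>l + 1 = \<Sum>\<^sub>i w\<^sub>i\<close>: the factor \<open>w\<^sub>i\<close> cancels
  against \<open>w\<^sub>i!\<close>, and \<open>w = v + e\<^sub>i\<close> is substituted.
\<close>

lemma multinomial_sum_Suc:
  assumes C: "finite C"
  shows "multinomial_sum C P (Suc l) \<phi> = (\<Sum>i\<in>C. P i * multinomial_sum C P l (\<lambda>v. \<phi> (v(i := Suc (v i)))))"
proof -
  define W where "W w = fact l / (\<Prod>i\<in>C. fact (w i)) * (\<Prod>i\<in>C. P i ^ w i) * \<phi> w" for w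
  have "multinomial_sum C P (Suc l) \<phi> = (\<Sum>w\<in>compositions C (Suc l). \<Sum>i\<in>C. real (w i) * W w)"
    unfolding multinomial_sum_def
  proof (rule sum.cong[OF refl])
    fix w assume w: "w \<in> compositions C (Suc l)"
    have "(\<Sum>i\<in>C. real (w i) * W w) = real (\<Sum>i\<in>C. w i) * W w" by (simp add: sum_distrib_right)
    also have "\<dots> = real (Suc l) * W w" using w by (simp add: compositions_def)
    also have "\<dots> = fact (Suc l) / (\<Prod>i\<in>C. fact (w i)) * (\<Prod>i\<in>C. P i ^ w i) * \<phi> w"
      by (simp add: W_def mult_ac)
    finally show "fact (Suc l) / (\<Prod>i\<in>C. fact (w i)) * (\<Prod>i\<in>C. P i ^ w i) * \<phi> w = (\<Sum>i\<in>C. real (w i) * W w)" ..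
  qed
  also have "\<dots> = (\<Sum>i\<in>C. \<Sum>w\<in>compositions C (Suc l). real (w i) * W w)" by (rule sum.swap)
  also have "\<dots> = (\<Sum>i\<in>C. P i * multinomial_sum C P l (\<lambda>v. \<phi> (v(i := Suc (v i)))))"
  proof (rule sum.cong[OF refl])
    fix i assume i: "i \<in> C"
    have "(\<Sum>w\<in>compositions C (Suc l). real (w i) * W w) = (\<Sum>w\<in>{w \<in> compositions C (Suc l). 0 < w i}. real (w i) * W w)"
      using finite_compositions[OF C] by (intro sum.mono_neutral_right) auto
    also have "\<dots> = (\<Sum>v\<in>compositions C l. real (Suc (v i)) * W (v(i := Suc (v i))))"
      using sum.reindex_bij_betw[OF compositions_increment_bij[OF C i], of "\<lambda>w. real (w i) * W w" l] by simp
    also have "\<dots> = (\<Sum>v\<in>compositions C l. P i * (fact l / (\<Prod>i\<in>C. fact (v i)) * (\<Prod>i\<in>C. P i ^ v i) * \<phi> (v(i := Suc (v i)))))"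
    proof (rule sum.cong[OF refl])
      fix v
      have a: "(\<Prod>j\<in>C - {i}. fact ((v(i := Suc (v i))) j)) = (\<Prod>j\<in>C - {i}. fact (v j) :: real)" by (intro prod.cong) auto
      have b: "(\<Prod>j\<in>C - {i}. P j ^ (v(i := Suc (v i))) j) = (\<Prod>j\<in>C - {i}. P j ^ v j)" by (intro prod.cong) auto
      have arith: "S * (f / (S * g * h) * (P i * x * y) * z) = P i * (f / (g * h) * (x * y) * z)"
        if "S \<noteq> 0" for S f g h x y z :: real using that by simp
      show "real (Suc (v i)) * W (v(i := Suc (v i)))
          = P i * (fact l / (\<Prod>i\<in>C. fact (v i)) * (\<Prod>i\<in>C. P i ^ v i) * \<phi> (v(i := Suc (v i))))"
        unfolding W_def prod.remove[OF C i] a b using arith[of "real (Suc (v i))"] by simp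
    qed
    finally show "(\<Sum>w\<in>compositions C (Suc l). real (w i) * W w) = P i * multinomial_sum C P l (\<lambda>v. \<phi> (v(i := Suc (v i))))"
      by (simp add: multinomial_sum_def sum_distrib_left)
  qed
  finally show ?thesis .
qed

text \<open>
  A cell \<open>i\<close> of a table with factors \<open>n 1, \<dots>, n dd\<close> consists of one draw from each factor. For an
  arbitrary \<open>n\<close> a population may be drawn several times; for a strictly increasing \<open>n\<close> the counts are
  \<open>0\<close> or \<open>1\<close>.
\<close>

definition cell_count :: "(nat \<Rightarrow> nat) \<Rightarrow> nat \<Rightarrow> (nat \<Rightarrow> nat) \<Rightarrow> nat \<Rightarrow> nat \<Rightarrow> nat" where
  "cell_count n dd i \<nu> j = (\<Sum>h=1..dd. if n h = \<nu> \<and> i h = j then 1 else 0)"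

definition cell_hits :: "(nat \<Rightarrow> nat) \<Rightarrow> nat \<Rightarrow> nat \<Rightarrow> nat" where
  "cell_hits n dd \<nu> = (\<Sum>h=1..dd. if n h = \<nu> then 1 else 0)"

definition table_count :: "(nat \<Rightarrow> nat) \<Rightarrow> nat \<Rightarrow> (nat \<Rightarrow> nat) \<Rightarrow> ((nat \<Rightarrow> nat) \<Rightarrow> nat) \<Rightarrow> nat \<Rightarrow> nat \<Rightarrow> nat" where
  "table_count m dd n v \<nu> j = (\<Sum>i\<in>table_cells m dd n. v i * cell_count n dd i \<nu> j)"

definition pred_count ::
    "(nat \<Rightarrow> nat) \<Rightarrow> nat \<Rightarrow> (nat \<Rightarrow> nat) \<Rightarrow> (nat \<Rightarrow> nat \<Rightarrow> nat) \<Rightarrow> (nat \<Rightarrow> (nat \<Rightarrow> nat) \<Rightarrow> nat) \<Rightarrow> nat \<Rightarrow> nat \<Rightarrow> nat" where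
  "pred_count m L d nu w \<nu> j = (\<Sum>lam=1..L. table_count m (d lam) (nu lam) (w lam) \<nu> j)"

definition pred_hits :: "nat \<Rightarrow> (nat \<Rightarrow> nat) \<Rightarrow> (nat \<Rightarrow> nat) \<Rightarrow> (nat \<Rightarrow> nat \<Rightarrow> nat) \<Rightarrow> nat \<Rightarrow> nat" where
  "pred_hits L d l nu \<nu> = (\<Sum>lam=1..L. l lam * cell_hits (nu lam) (d lam) \<nu>)"

lemma cell_count_le_hits: "cell_count n dd i \<nu> j \<le> cell_hits n dd \<nu>"
  unfolding cell_count_def cell_hits_def by (intro sum_mono) auto

lemma finite_table_cells: "finite (table_cells m dd n)"
  unfolding table_cells_def by (intro finite_PiE) auto

lemma tables_eq_compositions: "tables m dd ll n = compositions (table_cells m dd n) ll"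
  by (simp add: tables_def compositions_def)

lemma finite_tables: "finite (tables m dd ll n)"
  unfolding tables_eq_compositions by (intro finite_compositions finite_table_cells)

lemma finite_pred_space: "finite (pred_space m L d l nu)"
  unfolding pred_space_def by (intro finite_PiE finite_tables) auto

lemma table_count_le_hits:
  assumes "v \<in> tables m dd ll n"
  shows "table_count m dd n v \<nu> j \<le> ll * cell_hits n dd \<nu>"
proof -
  have "table_count m dd n v \<nu> j \<le> (\<Sum>i\<in>table_cells m dd n. v i * cell_hits n dd \<nu>)"
    unfolding table_count_def by (intro sum_mono mult_left_mono cell_count_le_hits) auto
  also have "\<dots> = ll * cell_hits n dd \<nu>"
    using assms by (simp add: sum_distrib_right[symmetric] tables_def)
  finally show ?thesis .
qed

lemma pred_count_le_hits:
  assumes "w \<in> pred_space m L d l nu"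
  shows "pred_count m L d nu w \<nu> j \<le> pred_hits L d l nu \<nu>"
  unfolding pred_count_def pred_hits_def
  using assms by (intro sum_mono table_count_le_hits) (auto simp: pred_space_def)

text \<open>
  A function \<open>V\<close> of the state that increases on average with each draw, as long as the budget \<open>K\<close> of
  draws is not exceeded. The increase extends from one draw to a cell, a table and a family of tables.
  Each of these extensions has a weak form, which also covers the empty case and serves as
  induction hypothesis, and a strict form.
\<close>

locale drift =
  fixes N :: nat and m :: "nat \<Rightarrow> nat" and p :: "nat \<Rightarrow> nat \<Rightarrow> real"
    and V :: "(nat \<Rightarrow> nat) \<Rightarrow> (nat \<Rightarrow> nat) \<Rightarrow> real" and K :: "nat \<Rightarrow> nat"
  assumes q_pos: "\<And>\<nu> j. \<nu> \<in> {1..N} \<Longrightarrow> j \<le> m \<nu> \<Longrightarrow> 0 < cell_prob (m \<nu>) (p \<nu>) j"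
    and q_sum: "\<And>\<nu>. \<nu> \<in> {1..N} \<Longrightarrow> (\<Sum>j=0..m \<nu>. cell_prob (m \<nu>) (p \<nu>) j) = 1"
    and drift: "\<And>\<nu> c k. \<nu> \<in> {1..N} \<Longrightarrow> (\<And>\<mu>. \<mu> \<in> {1..N} \<Longrightarrow> c \<mu> \<le> k \<mu>) \<Longrightarrow> k \<nu> < K \<nu> \<Longrightarrow>
        V c k < cell_prob (m \<nu>) (p \<nu>) 0 * V (c(\<nu> := Suc (c \<nu>))) (k(\<nu> := Suc (k \<nu>)))
           + (1 - cell_prob (m \<nu>) (p \<nu>) 0) * V c (k(\<nu> := Suc (k \<nu>)))"
begin

abbreviation "q \<nu> \<equiv> cell_prob (m \<nu>) (p \<nu>)"

definition cell_mass :: "(nat \<Rightarrow> nat) \<Rightarrow> nat \<Rightarrow> (nat \<Rightarrow> nat) \<Rightarrow> real" where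
  "cell_mass n dd i = (\<Prod>h=1..dd. q (n h) (i h))"

lemma cell_mass_pos:
  assumes "\<And>h. h \<in> {1..dd} \<Longrightarrow> n h \<in> {1..N}" "i \<in> table_cells m dd n"
  shows "0 < cell_mass n dd i"
  unfolding cell_mass_def using assms by (intro prod_pos ballI q_pos) (auto simp: table_cells_def PiE_iff)

text \<open>
  The coordinates of the cell are drawn one after another, the last one conditionally on the others.
\<close>

lemma one_cell_drift:
  assumes "\<And>h. h \<in> {1..dd} \<Longrightarrow> n h \<in> {1..N}" "\<And>\<mu>. \<mu> \<in> {1..N} \<Longrightarrow> c \<mu> \<le> k \<mu>"
    "\<And>\<mu>. \<mu> \<in> {1..N} \<Longrightarrow> k \<mu> + cell_hits n dd \<mu> \<le> K \<mu>"
  shows "V c k \<le> (\<Sum>i\<in>table_cells m dd n. cell_mass n dd i *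
            V (\<lambda>\<nu>. c \<nu> + cell_count n dd i \<nu> 0) (\<lambda>\<nu>. k \<nu> + cell_hits n dd \<nu>)) \<and>
         (0 < dd \<longrightarrow> V c k < (\<Sum>i\<in>table_cells m dd n. cell_mass n dd i *
            V (\<lambda>\<nu>. c \<nu> + cell_count n dd i \<nu> 0) (\<lambda>\<nu>. k \<nu> + cell_hits n dd \<nu>)))"
  using assms
proof (induction dd)
  case 0
  show ?case by (simp add: table_cells_def cell_mass_def cell_count_def cell_hits_def)
next
  case (Suc dd)
  define \<mu> where "\<mu> = n (Suc dd)"
  have \<mu>: "\<mu> \<in> {1..N}" unfolding \<mu>_def using Suc.prems(1) by simp
  have hits: "cell_hits n (Suc dd) = (\<lambda>\<nu>. cell_hits n dd \<nu> + (if \<mu> = \<nu> then 1 else 0))"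
    by (auto simp: cell_hits_def \<mu>_def)
  have IH: "V c k \<le> (\<Sum>i\<in>table_cells m dd n. cell_mass n dd i *
            V (\<lambda>\<nu>. c \<nu> + cell_count n dd i \<nu> 0) (\<lambda>\<nu>. k \<nu> + cell_hits n dd \<nu>))"
  proof (rule Suc.IH[THEN conjunct1])
    show "k \<nu> + cell_hits n dd \<nu> \<le> K \<nu>" if "\<nu> \<in> {1..N}" for \<nu>
      using Suc.prems(3)[OF that] unfolding hits by (auto split: if_splits)
  qed (use Suc.prems in auto)
  let ?C = "\<lambda>i \<nu>. c \<nu> + cell_count n dd i \<nu> 0" and ?K = "\<lambda>\<nu>. k \<nu> + cell_hits n dd \<nu>"
  let ?K' = "\<lambda>\<nu>. k \<nu> + cell_hits n (Suc dd) \<nu>"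
  have K': "?K' = ?K(\<mu> := Suc (?K \<mu>))" by (auto simp: hits)
  \<comment> \<open>Only whether the new coordinate is \<open>0\<close> matters for the state.\<close>
  have less: "V (?C i) ?K < (\<Sum>j\<in>{0..m \<mu>}. q \<mu> j * V (\<lambda>\<nu>. c \<nu> + cell_count n (Suc dd) (i(Suc dd := j)) \<nu> 0) ?K')" for i
  proof -
    have C': "(\<lambda>\<nu>. c \<nu> + cell_count n (Suc dd) (i(Suc dd := j)) \<nu> 0) = (if j = 0 then (?C i)(\<mu> := Suc (?C i \<mu>)) else ?C i)" for j
    proof -
      have "(\<Sum>h=1..dd. if n h = \<nu> \<and> (i(Suc dd := j)) h = 0 then 1 else 0 :: nat) = cell_count n dd i \<nu> 0" for \<nu>
        unfolding cell_count_def by (intro sum.cong) auto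
      hence "cell_count n (Suc dd) (i(Suc dd := j)) \<nu> 0 = cell_count n dd i \<nu> 0 + (if \<mu> = \<nu> \<and> j = 0 then 1 else 0)" for \<nu>
        by (simp add: cell_count_def[of n "Suc dd"] \<mu>_def)
      thus ?thesis by auto
    qed
    have q1: "(\<Sum>j=1..m \<mu>. q \<mu> j) = 1 - q \<mu> 0"
      using q_sum[OF \<mu>] by (simp add: sum.atLeast_Suc_atMost)
    have "(\<Sum>j\<in>{0..m \<mu>}. q \<mu> j * V (\<lambda>\<nu>. c \<nu> + cell_count n (Suc dd) (i(Suc dd := j)) \<nu> 0) ?K')
        = q \<mu> 0 * V ((?C i)(\<mu> := Suc (?C i \<mu>))) ?K' + (\<Sum>j=1..m \<mu>. q \<mu> j * V (?C i) ?K')"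
      unfolding C' by (subst sum.atLeast_Suc_atMost) (auto intro!: sum.cong)
    also have "(\<Sum>j=1..m \<mu>. q \<mu> j * V (?C i) ?K') = (1 - q \<mu> 0) * V (?C i) ?K'"
      unfolding q1[symmetric] by (rule sum_distrib_right[symmetric])
    finally have eq: "(\<Sum>j\<in>{0..m \<mu>}. q \<mu> j * V (\<lambda>\<nu>. c \<nu> + cell_count n (Suc dd) (i(Suc dd := j)) \<nu> 0) ?K')
        = q \<mu> 0 * V ((?C i)(\<mu> := Suc (?C i \<mu>))) (?K(\<mu> := Suc (?K \<mu>))) + (1 - q \<mu> 0) * V (?C i) (?K(\<mu> := Suc (?K \<mu>)))"
      unfolding K' .
    show ?thesis unfolding eq
    proof (rule drift[OF \<mu>])
      show "?C i \<nu> \<le> ?K \<nu>" if "\<nu> \<in> {1..N}" for \<nu>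
        using Suc.prems(2)[OF that] cell_count_le_hits by (intro add_mono)
      show "?K \<mu> < K \<mu>" using Suc.prems(3)[OF \<mu>] by (simp add: hits)
    qed
  qed
  have ins: "{1..Suc dd} = insert (Suc dd) {1..dd}" by auto
  have split: "(\<Sum>i\<in>table_cells m (Suc dd) n. cell_mass n (Suc dd) i * G i)
      = (\<Sum>i\<in>table_cells m dd n. cell_mass n dd i * (\<Sum>j\<in>{0..m \<mu>}. q \<mu> j * G (i(Suc dd := j))))" for G
  proof -
    have "cell_mass n (Suc dd) (i(Suc dd := j)) = cell_mass n dd i * q \<mu> j" for i j
    proof -
      have "(\<Prod>h=1..dd. q (n h) ((i(Suc dd := j)) h)) = cell_mass n dd i"
        unfolding cell_mass_def by (intro prod.cong) auto
      thus ?thesis by (simp add: cell_mass_def[of n "Suc dd"] \<mu>_def)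
    qed
    thus ?thesis unfolding table_cells_def ins
      by (subst sum_PiE_insert) (auto simp: \<mu>_def sum_distrib_left mult_ac)
  qed
  have "(\<Sum>i\<in>table_cells m dd n. cell_mass n dd i * V (?C i) ?K)
     < (\<Sum>i\<in>table_cells m dd n. cell_mass n dd i *
          (\<Sum>j\<in>{0..m \<mu>}. q \<mu> j * V (\<lambda>\<nu>. c \<nu> + cell_count n (Suc dd) (i(Suc dd := j)) \<nu> 0) ?K'))"
  proof (rule sum_strict_mono)
    show "finite (table_cells m dd n)" by (rule finite_table_cells)
    show "table_cells m dd n \<noteq> {}" by (simp add: table_cells_def PiE_eq_empty_iff)
    fix i assume i: "i \<in> table_cells m dd n"
    show "cell_mass n dd i * V (?C i) ?K < cell_mass n dd i *
          (\<Sum>j\<in>{0..m \<mu>}. q \<mu> j * V (\<lambda>\<nu>. c \<nu> + cell_count n (Suc dd) (i(Suc dd := j)) \<nu> 0) ?K')"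
      using cell_mass_pos[OF _ i] Suc.prems(1) less by (intro mult_strict_left_mono) auto
  qed
  with IH show ?case unfolding split by (auto intro: less_imp_le le_less_trans)
qed

text \<open>
  By \<open>multinomial_sum_Suc\<close> the trials of the table are performed one after another; the hypothesis for
  the remaining trials is applied in the state reached after the first one.
\<close>

lemma one_table_drift:
  assumes "\<And>h. h \<in> {1..dd} \<Longrightarrow> n h \<in> {1..N}" "\<And>\<mu>. \<mu> \<in> {1..N} \<Longrightarrow> c \<mu> \<le> k \<mu>"
    "\<And>\<mu>. \<mu> \<in> {1..N} \<Longrightarrow> k \<mu> + ll * cell_hits n dd \<mu> \<le> K \<mu>"
  shows "V c k \<le> (\<Sum>v\<in>tables m dd ll n. table_mass m dd ll n p v *
            V (\<lambda>\<nu>. c \<nu> + table_count m dd n v \<nu> 0) (\<lambda>\<nu>. k \<nu> + ll * cell_hits n dd \<nu>)) \<and>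
         (0 < dd \<longrightarrow> 0 < ll \<longrightarrow> V c k < (\<Sum>v\<in>tables m dd ll n. table_mass m dd ll n p v *
            V (\<lambda>\<nu>. c \<nu> + table_count m dd n v \<nu> 0) (\<lambda>\<nu>. k \<nu> + ll * cell_hits n dd \<nu>)))"
proof -
  have eq: "(\<Sum>v\<in>tables m dd ll n. table_mass m dd ll n p v * G v)
     = multinomial_sum (table_cells m dd n) (cell_mass n dd) ll G" for ll G
    unfolding multinomial_sum_def tables_eq_compositions table_mass_def cell_mass_def by simp
  show ?thesis unfolding eq using assms
  proof (induction ll arbitrary: c k)
    case 0
    show ?case by (simp add: multinomial_sum_0[OF finite_table_cells] table_count_def)
  next
    case (Suc ll)
    let ?cells = "table_cells m dd n"
    let ?K = "\<lambda>\<nu>. k \<nu> + cell_hits n dd \<nu>" and ?K' = "\<lambda>\<nu>. k \<nu> + Suc ll * cell_hits n dd \<nu>"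
    let ?R = "multinomial_sum ?cells (cell_mass n dd) (Suc ll) (\<lambda>v. V (\<lambda>\<nu>. c \<nu> + table_count m dd n v \<nu> 0) ?K')"
    have step: "V (\<lambda>\<nu>. c \<nu> + cell_count n dd i \<nu> 0) ?K
       \<le> multinomial_sum ?cells (cell_mass n dd) ll
           (\<lambda>v. V (\<lambda>\<nu>. c \<nu> + table_count m dd n (v(i := Suc (v i))) \<nu> 0) ?K')" if i: "i \<in> ?cells" for i
    proof -
      have tc: "table_count m dd n (v(i := Suc (v i))) \<nu> 0 = cell_count n dd i \<nu> 0 + table_count m dd n v \<nu> 0" for v \<nu>
      proof -
        have "(\<Sum>i'\<in>?cells - {i}. (v(i := Suc (v i))) i' * cell_count n dd i' \<nu> 0) = (\<Sum>i'\<in>?cells - {i}. v i' * cell_count n dd i' \<nu> 0)"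
          by (intro sum.cong) auto
        thus ?thesis unfolding table_count_def sum.remove[OF finite_table_cells i] by simp
      qed
      have K': "?K' = (\<lambda>\<nu>. ?K \<nu> + ll * cell_hits n dd \<nu>)" by (auto simp: add_ac)
      have "V (\<lambda>\<nu>. c \<nu> + cell_count n dd i \<nu> 0) ?K \<le> multinomial_sum ?cells (cell_mass n dd) ll
           (\<lambda>v. V (\<lambda>\<nu>. (c \<nu> + cell_count n dd i \<nu> 0) + table_count m dd n v \<nu> 0) (\<lambda>\<nu>. ?K \<nu> + ll * cell_hits n dd \<nu>))"
      proof (rule Suc.IH[THEN conjunct1])
        show "c \<mu> + cell_count n dd i \<mu> 0 \<le> ?K \<mu>" if "\<mu> \<in> {1..N}" for \<mu>
          using Suc.prems(2)[OF that] cell_count_le_hits by (intro add_mono)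
        show "?K \<mu> + ll * cell_hits n dd \<mu> \<le> K \<mu>" if "\<mu> \<in> {1..N}" for \<mu>
          using Suc.prems(3)[OF that] by simp
      qed (use Suc.prems in auto)
      thus ?thesis unfolding K' tc by (simp only: add.assoc)
    qed
    have *: "(\<Sum>i\<in>?cells. cell_mass n dd i * V (\<lambda>\<nu>. c \<nu> + cell_count n dd i \<nu> 0) ?K) \<le> ?R"
      unfolding multinomial_sum_Suc[OF finite_table_cells]
      using step cell_mass_pos Suc.prems(1) by (intro sum_mono_weighted) (auto intro: less_imp_le)
    have hits: "k \<mu> + cell_hits n dd \<mu> \<le> K \<mu>" if "\<mu> \<in> {1..N}" for \<mu>
      using Suc.prems(3)[OF that] by simp
    show ?case using one_cell_drift[OF Suc.prems(1,2) hits] * by (auto intro: order.trans less_le_trans)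
  qed
qed

lemma all_tables_drift:
  assumes "\<And>lam h. lam \<in> {1..L} \<Longrightarrow> h \<in> {1..d lam} \<Longrightarrow> nu lam h \<in> {1..N}" "\<And>\<mu>. \<mu> \<in> {1..N} \<Longrightarrow> c \<mu> \<le> k \<mu>"
    "\<And>\<mu>. \<mu> \<in> {1..N} \<Longrightarrow> k \<mu> + pred_hits L d l nu \<mu> \<le> K \<mu>"
    "\<And>lam. lam \<in> {1..L} \<Longrightarrow> 0 < d lam" "\<And>lam. lam \<in> {1..L} \<Longrightarrow> 0 < l lam"
  shows "V c k \<le> (\<Sum>w\<in>pred_space m L d l nu. pred_mass m L d l nu p w *
            V (\<lambda>\<nu>. c \<nu> + pred_count m L d nu w \<nu> 0) (\<lambda>\<nu>. k \<nu> + pred_hits L d l nu \<nu>)) \<and>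
         (0 < L \<longrightarrow> V c k < (\<Sum>w\<in>pred_space m L d l nu. pred_mass m L d l nu p w *
            V (\<lambda>\<nu>. c \<nu> + pred_count m L d nu w \<nu> 0) (\<lambda>\<nu>. k \<nu> + pred_hits L d l nu \<nu>)))"
  using assms
proof (induction L)
  case 0
  show ?case by (simp add: pred_space_def pred_mass_def pred_count_def pred_hits_def)
next
  case (Suc L)
  let ?d = "d (Suc L)" and ?n = "nu (Suc L)" and ?l = "l (Suc L)"
  have hits: "pred_hits (Suc L) d l nu \<nu> = pred_hits L d l nu \<nu> + ?l * cell_hits ?n ?d \<nu>" for \<nu>
    by (simp add: pred_hits_def)
  let ?C = "\<lambda>w \<nu>. c \<nu> + pred_count m L d nu w \<nu> 0" and ?K = "\<lambda>\<nu>. k \<nu> + pred_hits L d l nu \<nu>"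
  let ?K' = "\<lambda>\<nu>. k \<nu> + pred_hits (Suc L) d l nu \<nu>"
  have IH: "V c k \<le> (\<Sum>w\<in>pred_space m L d l nu. pred_mass m L d l nu p w * V (?C w) ?K)"
  proof (rule Suc.IH[THEN conjunct1])
    show "k \<nu> + pred_hits L d l nu \<nu> \<le> K \<nu>" if "\<nu> \<in> {1..N}" for \<nu>
      using Suc.prems(3)[OF that] unfolding hits by auto
  qed (use Suc.prems in auto)
  have ins: "{1..Suc L} = insert (Suc L) {1..L}" by auto
  have pm: "pred_mass m (Suc L) d l nu p (w(Suc L := v)) = pred_mass m L d l nu p w * table_mass m ?d ?l ?n p v" for w v
  proof -
    have "(\<Prod>lam=1..L. table_mass m (d lam) (l lam) (nu lam) p ((w(Suc L := v)) lam)) = pred_mass m L d l nu p w"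
      unfolding pred_mass_def by (intro prod.cong) auto
    thus ?thesis by (simp add: pred_mass_def[of m "Suc L"])
  qed
  have pc: "pred_count m (Suc L) d nu (w(Suc L := v)) \<nu> 0 = pred_count m L d nu w \<nu> 0 + table_count m ?d ?n v \<nu> 0" for w v \<nu>
  proof -
    have "(\<Sum>lam=1..L. table_count m (d lam) (nu lam) ((w(Suc L := v)) lam) \<nu> 0) = pred_count m L d nu w \<nu> 0"
      unfolding pred_count_def by (intro sum.cong) auto
    thus ?thesis by (simp add: pred_count_def[of m "Suc L"])
  qed
  have split: "(\<Sum>w\<in>pred_space m (Suc L) d l nu. pred_mass m (Suc L) d l nu p w * V (\<lambda>\<nu>. c \<nu> + pred_count m (Suc L) d nu w \<nu> 0) ?K')
     = (\<Sum>w\<in>pred_space m L d l nu. pred_mass m L d l nu p w *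
          (\<Sum>v\<in>tables m ?d ?l ?n. table_mass m ?d ?l ?n p v *
             V (\<lambda>\<nu>. ?C w \<nu> + table_count m ?d ?n v \<nu> 0) (\<lambda>\<nu>. ?K \<nu> + ?l * cell_hits ?n ?d \<nu>)))"
    unfolding pred_space_def ins
    by (subst sum_PiE_insert) (simp_all add: pm pc hits sum_distrib_left mult.assoc add.assoc)
  have mass_pos: "0 < pred_mass m L d l nu p w" if "w \<in> pred_space m L d l nu" for w
    unfolding pred_mass_def table_mass_def
  proof (intro prod_pos ballI mult_pos_pos divide_pos_pos zero_less_power q_pos)
    fix lam i h assume "lam \<in> {1..L}" "i \<in> table_cells m (d lam) (nu lam)" "h \<in> {1..d lam}"
    thus "nu lam h \<in> {1..N}" "i h \<le> m (nu lam h)" using Suc.prems(1)[of lam h] by (auto simp: table_cells_def PiE_iff)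
  qed auto
  have "(\<Sum>w\<in>pred_space m L d l nu. pred_mass m L d l nu p w * V (?C w) ?K)
     < (\<Sum>w\<in>pred_space m L d l nu. pred_mass m L d l nu p w *
          (\<Sum>v\<in>tables m ?d ?l ?n. table_mass m ?d ?l ?n p v *
             V (\<lambda>\<nu>. ?C w \<nu> + table_count m ?d ?n v \<nu> 0) (\<lambda>\<nu>. ?K \<nu> + ?l * cell_hits ?n ?d \<nu>)))"
  proof (rule sum_strict_mono)
    show "finite (pred_space m L d l nu)" by (rule finite_pred_space)
    have "tables m dd ll n \<noteq> {}" for dd ll n
    proof -
      define i0 where "i0 = (\<lambda>h\<in>{1..dd}. 0::nat)"
      have i0: "i0 \<in> table_cells m dd n" by (auto simp: table_cells_def i0_def)
      have "(\<lambda>i\<in>table_cells m dd n. if i = i0 then ll else 0) \<in> tables m dd ll n"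
        using i0 finite_table_cells by (auto simp: tables_def)
      thus ?thesis by blast
    qed
    thus "pred_space m L d l nu \<noteq> {}" by (simp add: pred_space_def PiE_eq_empty_iff)
    fix w assume w: "w \<in> pred_space m L d l nu"
    have "V (?C w) ?K < (\<Sum>v\<in>tables m ?d ?l ?n. table_mass m ?d ?l ?n p v *
             V (\<lambda>\<nu>. ?C w \<nu> + table_count m ?d ?n v \<nu> 0) (\<lambda>\<nu>. ?K \<nu> + ?l * cell_hits ?n ?d \<nu>))"
    proof (rule one_table_drift[THEN conjunct2, rule_format])
      show "?C w \<mu> \<le> ?K \<mu>" if "\<mu> \<in> {1..N}" for \<mu>
        using Suc.prems(2)[OF that] pred_count_le_hits[OF w] by (intro add_mono)
      show "?K \<mu> + ?l * cell_hits ?n ?d \<mu> \<le> K \<mu>" if "\<mu> \<in> {1..N}" for \<mu>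
        using Suc.prems(3)[OF that] by (simp add: hits)
    qed (use Suc.prems in auto)
    thus "pred_mass m L d l nu p w * V (?C w) ?K < pred_mass m L d l nu p w *
          (\<Sum>v\<in>tables m ?d ?l ?n. table_mass m ?d ?l ?n p v *
             V (\<lambda>\<nu>. ?C w \<nu> + table_count m ?d ?n v \<nu> 0) (\<lambda>\<nu>. ?K \<nu> + ?l * cell_hits ?n ?d \<nu>))"
      using mass_pos[OF w] by (intro mult_strict_left_mono)
  qed
  with IH show ?case unfolding split by (auto intro: less_imp_le le_less_trans)
qed

end

lemma cell_hits_strict_mono:
  assumes "strict_mono_on {1..dd} n"
  shows "cell_hits n dd \<nu> = (if \<nu> \<in> n ` {1..dd} then 1 else 0)"
proof -
  have inj: "inj_on n {1..dd}" using assms by (rule strict_mono_on_imp_inj_on)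
  show ?thesis
  proof (cases "\<nu> \<in> n ` {1..dd}")
    case True
    then obtain h0 where h0: "h0 \<in> {1..dd}" "n h0 = \<nu>" by auto
    have "cell_hits n dd \<nu> = (\<Sum>h=1..dd. if h = h0 then 1 else 0)"
      unfolding cell_hits_def using h0 inj by (intro sum.cong refl) (auto dest: inj_onD)
    thus ?thesis using h0 True by simp
  next
    case False
    thus ?thesis unfolding cell_hits_def by (auto intro!: sum.neutral)
  qed
qed

lemma pred_hits_strict_mono:
  assumes "\<And>lam. lam \<in> {1..L} \<Longrightarrow> strict_mono_on {1..d lam} (nu lam)"
  shows "pred_hits L d l nu \<nu> = (\<Sum>lam\<in>tables_involving L d nu \<nu>. l lam)"
proof -
  have "pred_hits L d l nu \<nu> = (\<Sum>lam=1..L. if \<nu> \<in> nu lam ` {1..d lam} then l lam else 0)"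
    unfolding pred_hits_def by (intro sum.cong refl) (simp add: cell_hits_strict_mono[OF assms])
  also have "\<dots> = (\<Sum>lam\<in>tables_involving L d nu \<nu>. l lam)"
    unfolding tables_involving_def by (rule sum.inter_filter[symmetric]) simp
  finally show ?thesis .
qed

lemma table_mass_counts:
  assumes n: "\<And>h. h \<in> {1..dd} \<Longrightarrow> n h \<in> {1..N}"
  shows "table_mass m dd ll n p v = fact ll / (\<Prod>i\<in>table_cells m dd n. fact (v i)) *
     (\<Prod>\<nu>=1..N. \<Prod>j=0..m \<nu>. cell_prob (m \<nu>) (p \<nu>) j ^ table_count m dd n v \<nu> j)"
proof -
  have cell: "(\<Prod>h=1..dd. cell_prob (m (n h)) (p (n h)) (i h)) = (\<Prod>\<nu>=1..N. \<Prod>j=0..m \<nu>. cell_prob (m \<nu>) (p \<nu>) j ^ cell_count n dd i \<nu> j)"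
    if i: "i \<in> table_cells m dd n" for i
  proof -
    have "(\<Prod>\<nu>=1..N. \<Prod>j=0..m \<nu>. cell_prob (m \<nu>) (p \<nu>) j ^ cell_count n dd i \<nu> j)
        = (\<Prod>\<nu>=1..N. \<Prod>j=0..m \<nu>. \<Prod>h=1..dd. if n h = \<nu> \<and> i h = j then cell_prob (m \<nu>) (p \<nu>) j else 1)"
      unfolding cell_count_def power_sum by (intro prod.cong refl) auto
    also have "\<dots> = (\<Prod>\<nu>=1..N. \<Prod>h=1..dd. \<Prod>j=0..m \<nu>. if n h = \<nu> \<and> i h = j then cell_prob (m \<nu>) (p \<nu>) j else 1)"
      by (intro prod.cong refl prod.swap)
    also have "\<dots> = (\<Prod>h=1..dd. \<Prod>\<nu>=1..N. \<Prod>j=0..m \<nu>. if n h = \<nu> \<and> i h = j then cell_prob (m \<nu>) (p \<nu>) j else 1)"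
      by (rule prod.swap)
    also have "\<dots> = (\<Prod>h=1..dd. cell_prob (m (n h)) (p (n h)) (i h))"
    proof (rule prod.cong[OF refl])
      fix h assume h: "h \<in> {1..dd}"
      have ih: "i h \<in> {0..m (n h)}" using i h by (auto simp: table_cells_def)
      have "(\<Prod>\<nu>=1..N. \<Prod>j=0..m \<nu>. if n h = \<nu> \<and> i h = j then cell_prob (m \<nu>) (p \<nu>) j else 1)
         = (\<Prod>\<nu>=1..N. if \<nu> = n h then cell_prob (m (n h)) (p (n h)) (i h) else 1)"
      proof (rule prod.cong[OF refl])
        fix \<nu>
        show "(\<Prod>j=0..m \<nu>. if n h = \<nu> \<and> i h = j then cell_prob (m \<nu>) (p \<nu>) j else 1)
            = (if \<nu> = n h then cell_prob (m (n h)) (p (n h)) (i h) else 1)"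
        proof (cases "\<nu> = n h")
          case True
          thus ?thesis using ih by (simp add: prod.delta)
        qed auto
      qed
      also have "\<dots> = cell_prob (m (n h)) (p (n h)) (i h)" using n[OF h] by (simp add: prod.delta)
      finally show "(\<Prod>\<nu>=1..N. \<Prod>j=0..m \<nu>. if n h = \<nu> \<and> i h = j then cell_prob (m \<nu>) (p \<nu>) j else 1)
         = cell_prob (m (n h)) (p (n h)) (i h)" .
    qed
    finally show ?thesis ..
  qed
  have "(\<Prod>i\<in>table_cells m dd n. (\<Prod>h=1..dd. cell_prob (m (n h)) (p (n h)) (i h)) ^ v i)
      = (\<Prod>i\<in>table_cells m dd n. \<Prod>\<nu>=1..N. \<Prod>j=0..m \<nu>. cell_prob (m \<nu>) (p \<nu>) j ^ (v i * cell_count n dd i \<nu> j))"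
  proof (rule prod.cong[OF refl])
    fix i assume i: "i \<in> table_cells m dd n"
    show "(\<Prod>h=1..dd. cell_prob (m (n h)) (p (n h)) (i h)) ^ v i
        = (\<Prod>\<nu>=1..N. \<Prod>j=0..m \<nu>. cell_prob (m \<nu>) (p \<nu>) j ^ (v i * cell_count n dd i \<nu> j))"
      unfolding cell[OF i] prod_power_distrib
      by (intro prod.cong refl) (simp add: power_mult[symmetric] mult.commute)
  qed
  also have "\<dots> = (\<Prod>\<nu>=1..N. \<Prod>i\<in>table_cells m dd n. \<Prod>j=0..m \<nu>. cell_prob (m \<nu>) (p \<nu>) j ^ (v i * cell_count n dd i \<nu> j))"
    by (rule prod.swap)
  also have "\<dots> = (\<Prod>\<nu>=1..N. \<Prod>j=0..m \<nu>. \<Prod>i\<in>table_cells m dd n. cell_prob (m \<nu>) (p \<nu>) j ^ (v i * cell_count n dd i \<nu> j))"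
    by (intro prod.cong refl prod.swap)
  also have "\<dots> = (\<Prod>\<nu>=1..N. \<Prod>j=0..m \<nu>. cell_prob (m \<nu>) (p \<nu>) j ^ table_count m dd n v \<nu> j)"
    unfolding table_count_def power_sum ..
  finally show ?thesis unfolding table_mass_def by simp
qed

definition pred_coeff :: "(nat \<Rightarrow> nat) \<Rightarrow> nat \<Rightarrow> (nat \<Rightarrow> nat) \<Rightarrow> (nat \<Rightarrow> nat) \<Rightarrow> (nat \<Rightarrow> nat \<Rightarrow> nat) \<Rightarrow>
     (nat \<Rightarrow> (nat \<Rightarrow> nat) \<Rightarrow> nat) \<Rightarrow> real" where
  "pred_coeff m L d l nu w = (\<Prod>lam=1..L. fact (l lam) / (\<Prod>i\<in>table_cells m (d lam) (nu lam). fact (w lam i)))"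

lemma pred_coeff_pos: "0 < pred_coeff m L d l nu w"
  unfolding pred_coeff_def by (intro prod_pos ballI divide_pos_pos) auto

lemma pred_mass_counts:
  assumes "\<And>lam h. lam \<in> {1..L} \<Longrightarrow> h \<in> {1..d lam} \<Longrightarrow> nu lam h \<in> {1..N}"
  shows "pred_mass m L d l nu p w = pred_coeff m L d l nu w *
     (\<Prod>\<nu>=1..N. \<Prod>j=0..m \<nu>. cell_prob (m \<nu>) (p \<nu>) j ^ pred_count m L d nu w \<nu> j)"
proof -
  have "pred_mass m L d l nu p w = pred_coeff m L d l nu w *
     (\<Prod>lam=1..L. \<Prod>\<nu>=1..N. \<Prod>j=0..m \<nu>. cell_prob (m \<nu>) (p \<nu>) j ^ table_count m (d lam) (nu lam) (w lam) \<nu> j)"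
    unfolding pred_mass_def pred_coeff_def prod.distrib[symmetric]
    by (intro prod.cong refl table_mass_counts assms)
  also have "(\<Prod>lam=1..L. \<Prod>\<nu>=1..N. \<Prod>j=0..m \<nu>. cell_prob (m \<nu>) (p \<nu>) j ^ table_count m (d lam) (nu lam) (w lam) \<nu> j)
    = (\<Prod>\<nu>=1..N. \<Prod>lam=1..L. \<Prod>j=0..m \<nu>. cell_prob (m \<nu>) (p \<nu>) j ^ table_count m (d lam) (nu lam) (w lam) \<nu> j)"
    by (rule prod.swap)
  also have "\<dots> = (\<Prod>\<nu>=1..N. \<Prod>j=0..m \<nu>. \<Prod>lam=1..L. cell_prob (m \<nu>) (p \<nu>) j ^ table_count m (d lam) (nu lam) (w lam) \<nu> j)"
    by (intro prod.cong refl prod.swap)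
  also have "\<dots> = (\<Prod>\<nu>=1..N. \<Prod>j=0..m \<nu>. cell_prob (m \<nu>) (p \<nu>) j ^ pred_count m L d nu w \<nu> j)"
    unfolding pred_count_def power_sum ..
  finally show ?thesis .
qed

lemma cell_count_total:
  assumes "i \<in> table_cells m dd n"
  shows "(\<Sum>j=0..m \<nu>. cell_count n dd i \<nu> j) = cell_hits n dd \<nu>"
proof -
  have "(\<Sum>j=0..m \<nu>. cell_count n dd i \<nu> j) = (\<Sum>h=1..dd. \<Sum>j=0..m \<nu>. if n h = \<nu> \<and> i h = j then 1 else 0)"
    unfolding cell_count_def by (rule sum.swap)
  also have "\<dots> = cell_hits n dd \<nu>"
    unfolding cell_hits_def
  proof (rule sum.cong[OF refl])
    fix h assume "h \<in> {1..dd}"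
    hence "i h \<in> {0..m (n h)}" using assms by (auto simp: table_cells_def)
    thus "(\<Sum>j=0..m \<nu>. if n h = \<nu> \<and> i h = j then 1 else 0 :: nat) = (if n h = \<nu> then 1 else 0)"
      by (cases "n h = \<nu>") (auto simp: sum.delta)
  qed
  finally show ?thesis .
qed

lemma pred_count_total:
  assumes "w \<in> pred_space m L d l nu"
  shows "(\<Sum>j=0..m \<nu>. pred_count m L d nu w \<nu> j) = pred_hits L d l nu \<nu>"
proof -
  have "(\<Sum>j=0..m \<nu>. pred_count m L d nu w \<nu> j) = (\<Sum>lam=1..L. \<Sum>j=0..m \<nu>. table_count m (d lam) (nu lam) (w lam) \<nu> j)"
    unfolding pred_count_def by (rule sum.swap)
  also have "\<dots> = pred_hits L d l nu \<nu>"
    unfolding pred_hits_def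
  proof (rule sum.cong[OF refl])
    fix lam assume "lam \<in> {1..L}"
    hence w: "w lam \<in> tables m (d lam) (l lam) (nu lam)" using assms by (auto simp: pred_space_def)
    have "(\<Sum>j=0..m \<nu>. table_count m (d lam) (nu lam) (w lam) \<nu> j)
        = (\<Sum>i\<in>table_cells m (d lam) (nu lam). w lam i * (\<Sum>j=0..m \<nu>. cell_count (nu lam) (d lam) i \<nu> j))"
      unfolding table_count_def sum_distrib_left by (rule sum.swap)
    also have "\<dots> = (\<Sum>i\<in>table_cells m (d lam) (nu lam). w lam i * cell_hits (nu lam) (d lam) \<nu>)"
      by (intro sum.cong refl) (simp add: cell_count_total)
    also have "\<dots> = l lam * cell_hits (nu lam) (d lam) \<nu>"
      using w by (simp add: sum_distrib_right[symmetric] tables_def)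
    finally show "(\<Sum>j=0..m \<nu>. table_count m (d lam) (nu lam) (w lam) \<nu> j) = l lam * cell_hits (nu lam) (d lam) \<nu>" .
  qed
  finally show ?thesis .
qed

section \<open>Dirichlet integrals\<close>

definition dirichlet_const :: "nat \<Rightarrow> real \<Rightarrow> (nat \<Rightarrow> real) \<Rightarrow> real" where
  "dirichlet_const k b0 b = Gamma b0 * (\<Prod>i=1..k. Gamma (b i)) / Gamma (b0 + (\<Sum>i=1..k. b i))"

text \<open>
  Unnormalized, and for all arguments; it is integrated over the open simplex only.
\<close>

definition dirichlet_density :: "nat \<Rightarrow> real \<Rightarrow> (nat \<Rightarrow> real) \<Rightarrow> (nat \<Rightarrow> real) \<Rightarrow> real" where
  "dirichlet_density k b0 b q = cell_prob k q 0 powr (b0 - 1) * (\<Prod>i=1..k. cell_prob k q i powr (b i - 1))"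

lemma dirichlet_const_pos:
  assumes "0 < b0" "\<And>i. i \<in> {1..k} \<Longrightarrow> 0 < b i"
  shows "0 < dirichlet_const k b0 b"
  unfolding dirichlet_const_def using assms
  by (intro divide_pos_pos mult_pos_pos prod_pos ballI Gamma_real_pos add_pos_nonneg sum_nonneg) (auto intro: less_imp_le)

lemma Beta_pos: "0 < a \<Longrightarrow> 0 < b \<Longrightarrow> 0 < Beta a (b :: real)"
  by (simp add: Beta_def Gamma_real_pos)

text \<open>
  The Beta integral after the substitution \<open>y \<mapsto> T y\<close>.
\<close>

lemma nn_integral_scaled_beta:
  fixes a b T :: real
  assumes a: "0 < a" and b: "0 < b" and T: "0 < T"
  shows "(\<integral>\<^sup>+y. ennreal (y powr (a - 1) * (T - y) powr (b - 1)) * indicator {0<..<T} y \<partial>lborel)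
       = ennreal (T powr (a + b - 1) * Beta a b)"
proof -
  have "(\<integral>\<^sup>+y. ennreal (y powr (a - 1) * (T - y) powr (b - 1)) * indicator {0<..<T} y \<partial>lborel)
      = ennreal \<bar>T\<bar> * (\<integral>\<^sup>+y. ennreal ((0 + T * y) powr (a - 1) * (T - (0 + T * y)) powr (b - 1)) * indicator {0<..<T} (0 + T * y) \<partial>lborel)"
    using T by (intro nn_integral_real_affine) auto
  also have "\<dots> = ennreal T * (\<integral>\<^sup>+y. ennreal (T powr (a + b - 2)) * (ennreal (y powr (a - 1) * (1 - y) powr (b - 1)) * indicator {0<..<1} y) \<partial>lborel)"
  proof -
    have "ennreal ((0 + T * y) powr (a - 1) * (T - (0 + T * y)) powr (b - 1)) * indicator {0<..<T} (0 + T * y)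
        = ennreal (T powr (a + b - 2)) * (ennreal (y powr (a - 1) * (1 - y) powr (b - 1)) * indicator {0<..<1} y)" for y
    proof (cases "y \<in> {0<..<1}")
      case True
      have "T - T * y = T * (1 - y)" by (simp add: algebra_simps)
      moreover have "T powr (a + b - 2) = T powr (a - 1) * T powr (b - 1)"
        by (simp add: powr_add[symmetric])
      ultimately show ?thesis using True T
        by (simp add: powr_mult indicator_def ennreal_mult'[symmetric] mult_ac)
    next
      case False
      hence "0 + T * y \<notin> {0<..<T}" using T by (auto simp: zero_less_mult_iff)
      thus ?thesis using False by simp
    qed
    thus ?thesis using T by simp
  qed
  also have "\<dots> = ennreal T * (ennreal (T powr (a + b - 2)) * (\<integral>\<^sup>+y. ennreal (y powr (a - 1) * (1 - y) powr (b - 1)) * indicator {0<..<1} y \<partial>lborel))"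
    by (subst nn_integral_cmult) auto
  also have "(\<integral>\<^sup>+y. ennreal (y powr (a - 1) * (1 - y) powr (b - 1)) * indicator {0<..<1} y \<partial>lborel) = ennreal (Beta a b)"
    using has_integral_Beta_real[OF a b] unfolding has_integral_Icc_iff_Ioo
    by (intro nn_integral_has_integral_lebesgue') auto
  also have "ennreal T * (ennreal (T powr (a + b - 2)) * ennreal (Beta a b)) = ennreal (T * T powr (a + b - 2) * Beta a b)"
    using T a b by (simp add: ennreal_mult'[symmetric] Beta_pos less_imp_le mult.assoc ennreal_mult''[symmetric])
  also have "T * T powr (a + b - 2) = T powr (a + b - 1)"
    using powr_mult_base[of T "a + b - 2"] T by simp
  finally show ?thesis .
qed

lemma product_sigma_finite_lborel: "product_sigma_finite (\<lambda>_. lborel :: real measure)"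
  by standard

lemma coordinate_measurable:
  "i \<in> J \<Longrightarrow> (\<lambda>q. q i) \<in> borel_measurable (\<Pi>\<^sub>M i\<in>J. (lborel :: real measure))"
  using measurable_component_singleton[of i J "\<lambda>_. lborel :: real measure"] by simp

lemma open_simplex_sets: "open_simplex k \<in> sets (\<Pi>\<^sub>M i\<in>{1..k}. (lborel :: real measure))"
proof -
  have "open_simplex k = {q \<in> space (\<Pi>\<^sub>M i\<in>{1..k}. (lborel :: real measure)). (\<forall>i\<in>{1..k}. 0 < q i) \<and> (\<Sum>i=1..k. q i) < 1}"
    by (auto simp: open_simplex_def space_PiM)
  also have "\<dots> \<in> sets (\<Pi>\<^sub>M i\<in>{1..k}. (lborel :: real measure))"
    by (intro sets.sets_Collect_conj sets.sets_Collect_finite_All borel_measurable_less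
          borel_measurable_sum coordinate_measurable borel_measurable_const) auto
  finally show ?thesis .
qed

lemma cell_prob_coordinate_measurable:
  "i \<le> k \<Longrightarrow> (\<lambda>q. cell_prob k q i) \<in> borel_measurable (\<Pi>\<^sub>M i\<in>{1..k}. (lborel :: real measure))"
  unfolding cell_prob_def
  by (cases "i = 0") (auto intro!: borel_measurable_diff borel_measurable_sum coordinate_measurable)

lemma dirichlet_density_measurable:
  "dirichlet_density k b0 b \<in> borel_measurable (\<Pi>\<^sub>M i\<in>{1..k}. (lborel :: real measure))"
  unfolding dirichlet_density_def[abs_def]
  by (intro borel_measurable_times borel_measurable_prod powr_real_measurable borel_measurable_const
        cell_prob_coordinate_measurable) auto

text \<open>
  Induction on the dimension. Integrating out the last coordinate is a Beta integral over
  \<open>(0, 1 - S)\<close>, where \<open>S\<close> is the sum of the other coordinates; it leaves a Dirichlet density in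
  which the parameter of cell \<open>0\<close> has absorbed that of the last cell.
\<close>

lemma nn_integral_dirichlet_density:
  assumes "0 < b0" "\<And>i. i \<in> {1..k} \<Longrightarrow> 0 < b i"
  shows "(\<integral>\<^sup>+q. ennreal (dirichlet_density k b0 b q) * indicator (open_simplex k) q \<partial>(\<Pi>\<^sub>M i\<in>{1..k}. lborel))
       = ennreal (dirichlet_const k b0 b)"
  using assms
proof (induction k arbitrary: b0)
  case 0
  have "open_simplex 0 = {\<lambda>_. undefined}" by (auto simp: open_simplex_def)
  thus ?case using 0 by (simp add: PiM_empty nn_integral_count_space_finite dirichlet_density_def dirichlet_const_def
        cell_prob_def Gamma_real_pos less_imp_neq[symmetric])
next
  case (Suc k)
  interpret product_sigma_finite "\<lambda>_. lborel :: real measure" by (rule product_sigma_finite_lborel)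
  define \<beta> where "\<beta> = b (Suc k)"
  have \<beta>: "0 < \<beta>" using Suc.prems(2)[of "Suc k"] by (simp add: \<beta>_def)
  have ins: "{1..Suc k} = insert (Suc k) {1..k}" by auto
  let ?f = "\<lambda>q. ennreal (dirichlet_density (Suc k) b0 b q) * indicator (open_simplex (Suc k)) q"
  have "(\<integral>\<^sup>+q. ?f q \<partial>(\<Pi>\<^sub>M i\<in>{1..Suc k}. lborel)) = (\<integral>\<^sup>+q. (\<integral>\<^sup>+y. ?f (q(Suc k := y)) \<partial>lborel) \<partial>(\<Pi>\<^sub>M i\<in>{1..k}. lborel))"
    unfolding ins
  proof (rule product_nn_integral_insert)
    show "?f \<in> borel_measurable (Pi\<^sub>M (insert (Suc k) {1..k}) (\<lambda>_. lborel))"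
      unfolding ins[symmetric]
      by (intro borel_measurable_times_ennreal measurable_compose[OF dirichlet_density_measurable measurable_ennreal]
            borel_measurable_indicator open_simplex_sets)
  qed auto
  also have "\<dots> = (\<integral>\<^sup>+q. ennreal (Beta \<beta> b0) * (ennreal (dirichlet_density k (b0 + \<beta>) b q) * indicator (open_simplex k) q) \<partial>(\<Pi>\<^sub>M i\<in>{1..k}. lborel))"
  proof (rule nn_integral_cong)
    fix q assume "q \<in> space (\<Pi>\<^sub>M i\<in>{1..k}. (lborel :: real measure))"
    hence q: "q \<in> {1..k} \<rightarrow>\<^sub>E UNIV" by (simp add: space_PiM)
    define S where "S = (\<Sum>i=1..k. q i)"
    define P where "P = (\<Prod>i=1..k. q i powr (b i - 1))"
    have sum: "(\<Sum>i=1..Suc k. (q(Suc k := y)) i) = S + y" for y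
    proof -
      have "(\<Sum>i=1..k. (q(Suc k := y)) i) = S" unfolding S_def by (intro sum.cong) auto
      thus ?thesis by simp
    qed
    have mem: "q(Suc k := y) \<in> open_simplex (Suc k) \<longleftrightarrow> q \<in> open_simplex k \<and> y \<in> {0<..<1 - S}" for y
    proof -
      have "(\<forall>i\<in>{1..Suc k}. 0 < (q(Suc k := y)) i) \<longleftrightarrow> (\<forall>i\<in>{1..k}. 0 < q i) \<and> 0 < y"
        unfolding ins by auto
      moreover have "q(Suc k := y) \<in> {1..Suc k} \<rightarrow>\<^sub>E UNIV" using q by (auto simp: PiE_iff extensional_def)
      moreover have "S + y < 1 \<longleftrightarrow> y < 1 - S" by auto
      moreover have "0 < y \<Longrightarrow> y < 1 - S \<Longrightarrow> S < 1" by auto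
      ultimately show ?thesis using q unfolding open_simplex_def mem_Collect_eq sum S_def[symmetric] greaterThanLessThan_iff
        by blast
    qed
    have dens: "dirichlet_density (Suc k) b0 b (q(Suc k := y)) = P * (y powr (\<beta> - 1) * (1 - S - y) powr (b0 - 1))" for y
    proof -
      have "(\<Prod>i=1..k. cell_prob (Suc k) (q(Suc k := y)) i powr (b i - 1)) = P"
        unfolding P_def cell_prob_def by (intro prod.cong) auto
      moreover have "cell_prob (Suc k) (q(Suc k := y)) 0 = 1 - S - y" unfolding cell_prob_def sum by simp
      moreover have "cell_prob (Suc k) (q(Suc k := y)) (Suc k) = y" by (simp add: cell_prob_def)
      ultimately show ?thesis by (simp add: dirichlet_density_def \<beta>_def mult_ac)
    qed
    show "(\<integral>\<^sup>+y. ?f (q(Suc k := y)) \<partial>lborel) = ennreal (Beta \<beta> b0) * (ennreal (dirichlet_density k (b0 + \<beta>) b q) * indicator (open_simplex k) q)"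
    proof (cases "q \<in> open_simplex k")
      case False
      thus ?thesis by (simp add: mem indicator_def)
    next
      case True
      have S: "0 < 1 - S" using True by (simp add: open_simplex_def S_def)
      have P: "0 \<le> P" unfolding P_def by (intro prod_nonneg) auto
      have "(\<integral>\<^sup>+y. ?f (q(Suc k := y)) \<partial>lborel)
          = (\<integral>\<^sup>+y. ennreal P * (ennreal (y powr (\<beta> - 1) * (1 - S - y) powr (b0 - 1)) * indicator {0<..<1 - S} y) \<partial>lborel)"
        using True P by (intro nn_integral_cong) (simp add: dens mem indicator_def ennreal_mult')
      also have "\<dots> = ennreal P * ennreal ((1 - S) powr (\<beta> + b0 - 1) * Beta \<beta> b0)"
        by (subst nn_integral_cmult) (auto simp: nn_integral_scaled_beta[OF \<beta> Suc.prems(1) S])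
      also have "\<dots> = ennreal (Beta \<beta> b0) * ennreal (dirichlet_density k (b0 + \<beta>) b q)"
      proof -
        have "(\<Prod>i=1..k. cell_prob k q i powr (b i - 1)) = P"
          unfolding P_def cell_prob_def by (intro prod.cong) auto
        moreover have "cell_prob k q 0 = 1 - S" by (simp add: cell_prob_def S_def)
        ultimately have "dirichlet_density k (b0 + \<beta>) b q = (1 - S) powr (\<beta> + b0 - 1) * P"
          by (simp add: dirichlet_density_def add.commute)
        thus ?thesis using P Beta_pos[OF \<beta> Suc.prems(1)]
          by (simp add: ennreal_mult''[symmetric] mult_ac less_imp_le)
      qed
      finally show ?thesis using True by simp
    qed
  qed
  also have "\<dots> = ennreal (Beta \<beta> b0) * (\<integral>\<^sup>+q. ennreal (dirichlet_density k (b0 + \<beta>) b q) * indicator (open_simplex k) q \<partial>(\<Pi>\<^sub>M i\<in>{1..k}. lborel))"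
    by (intro nn_integral_cmult borel_measurable_times_ennreal measurable_compose[OF dirichlet_density_measurable measurable_ennreal]
            borel_measurable_indicator open_simplex_sets)
  also have "\<dots> = ennreal (Beta \<beta> b0) * ennreal (dirichlet_const k (b0 + \<beta>) b)"
    using Suc.prems \<beta> by (subst Suc.IH) auto
  also have "\<dots> = ennreal (Beta \<beta> b0 * dirichlet_const k (b0 + \<beta>) b)"
    using Beta_pos[OF \<beta> Suc.prems(1)] by (simp add: ennreal_mult' less_imp_le)
  also have "Beta \<beta> b0 * dirichlet_const k (b0 + \<beta>) b = dirichlet_const (Suc k) b0 b"
  proof -
    have "Gamma (b0 + \<beta>) > 0" using Suc.prems(1) \<beta> by (simp add: Gamma_real_pos)
    thus ?thesis by (simp add: dirichlet_const_def Beta_def \<beta>_def[symmetric] add_ac mult_ac)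
  qed
  finally show ?case .
qed

lemma sigma_finite_simplex_lborel: "sigma_finite_measure (\<Pi>\<^sub>M i\<in>{1..k::nat}. (lborel :: real measure))"
  by (rule product_sigma_finite.sigma_finite[OF product_sigma_finite_lborel]) auto

lemma product_sigma_finite_simplex: "product_sigma_finite (\<lambda>\<nu>. \<Pi>\<^sub>M i\<in>{1..m \<nu> :: nat}. (lborel :: real measure))"
  unfolding product_sigma_finite_def using sigma_finite_simplex_lborel by blast

lemma sigma_finite_param_lborel: "sigma_finite_measure (param_lborel N m)"
  unfolding param_lborel_def
  by (rule product_sigma_finite.sigma_finite[OF product_sigma_finite_simplex]) auto

lemma param_space_sets: "param_space N m \<in> sets (param_lborel N m)"
  unfolding param_space_def param_lborel_def
  by (intro sets_PiM_I_finite open_simplex_sets) auto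

lemma cell_prob_measurable:
  assumes "\<nu> \<in> {1..N}" "i \<le> m \<nu>"
  shows "(\<lambda>p. cell_prob (m \<nu>) (p \<nu>) i) \<in> borel_measurable (param_lborel N m)"
  unfolding param_lborel_def
  by (rule measurable_compose[OF _ cell_prob_coordinate_measurable[OF assms(2)]])
     (rule measurable_component_singleton[OF assms(1)])

lemma dirichlet_prior_eq: "dirichlet_prior N m b0 b p = (\<Prod>\<nu>=1..N. dirichlet_density (m \<nu>) (b0 \<nu>) (b \<nu>) (p \<nu>))"
  by (simp add: dirichlet_prior_def dirichlet_density_def)

lemma dirichlet_prior_nonneg: "0 \<le> dirichlet_prior N m b0 b p"
  unfolding dirichlet_prior_def by (intro prod_nonneg) (auto intro!: mult_nonneg_nonneg prod_nonneg)

lemma dirichlet_prior_measurable: "dirichlet_prior N m b0 b \<in> borel_measurable (param_lborel N m)"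
  unfolding dirichlet_prior_def[abs_def]
  by (intro borel_measurable_times borel_measurable_prod powr_real_measurable borel_measurable_const
        cell_prob_measurable) auto

lemma nn_integral_dirichlet_prior:
  assumes "\<And>\<nu>. \<nu> \<in> {1..N} \<Longrightarrow> 0 < b0 \<nu>" "\<And>\<nu> i. \<nu> \<in> {1..N} \<Longrightarrow> i \<in> {1..m \<nu>} \<Longrightarrow> 0 < b \<nu> i"
  shows "(\<integral>\<^sup>+p. ennreal (dirichlet_prior N m b0 b p) * indicator (param_space N m) p \<partial>param_lborel N m)
       = ennreal (\<Prod>\<nu>=1..N. dirichlet_const (m \<nu>) (b0 \<nu>) (b \<nu>))"
proof -
  have nn: "0 \<le> dirichlet_density k c0 c q" for k c0 c q
    unfolding dirichlet_density_def by (intro mult_nonneg_nonneg prod_nonneg) auto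
  have "(\<integral>\<^sup>+p. ennreal (dirichlet_prior N m b0 b p) * indicator (param_space N m) p \<partial>param_lborel N m)
    = (\<integral>\<^sup>+p. (\<Prod>\<nu>=1..N. ennreal (dirichlet_density (m \<nu>) (b0 \<nu>) (b \<nu>) (p \<nu>)) * indicator (open_simplex (m \<nu>)) (p \<nu>)) \<partial>param_lborel N m)"
  proof (rule nn_integral_cong)
    fix p assume "p \<in> space (param_lborel N m)"
    hence p: "p \<in> extensional {1..N}" by (simp add: param_lborel_def space_PiM PiE_iff)
    have "(indicator (param_space N m) p :: ennreal) = (\<Prod>\<nu>=1..N. indicator (open_simplex (m \<nu>)) (p \<nu>))"
    proof (cases "p \<in> param_space N m")
      case True
      thus ?thesis by (auto simp: param_space_def PiE_iff intro!: prod.neutral[symmetric])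
    next
      case False
      then obtain \<nu> where \<nu>: "\<nu> \<in> {1..N}" "p \<nu> \<notin> open_simplex (m \<nu>)" using p by (auto simp: param_space_def PiE_iff)
      hence "(\<Prod>\<nu>=1..N. indicator (open_simplex (m \<nu>)) (p \<nu>)) = (0 :: ennreal)"
        by (intro prod_zero bexI[of _ \<nu>]) auto
      thus ?thesis using False by simp
    qed
    thus "ennreal (dirichlet_prior N m b0 b p) * indicator (param_space N m) p
      = (\<Prod>\<nu>=1..N. ennreal (dirichlet_density (m \<nu>) (b0 \<nu>) (b \<nu>) (p \<nu>)) * indicator (open_simplex (m \<nu>)) (p \<nu>))"
      unfolding dirichlet_prior_eq prod.distrib by (simp add: prod_ennreal nn)
  qed
  also have "\<dots> = (\<Prod>\<nu>\<in>{1..N}. \<integral>\<^sup>+q. ennreal (dirichlet_density (m \<nu>) (b0 \<nu>) (b \<nu>) q) * indicator (open_simplex (m \<nu>)) q \<partial>(\<Pi>\<^sub>M i\<in>{1..m \<nu>}. lborel))"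
    unfolding param_lborel_def
    by (intro product_sigma_finite.product_nn_integral_prod[OF product_sigma_finite_simplex]
          borel_measurable_times_ennreal measurable_compose[OF dirichlet_density_measurable measurable_ennreal]
            borel_measurable_indicator open_simplex_sets) auto
  also have "\<dots> = (\<Prod>\<nu>\<in>{1..N}. ennreal (dirichlet_const (m \<nu>) (b0 \<nu>) (b \<nu>)))"
    by (intro prod.cong refl nn_integral_dirichlet_density assms)
  also have "\<dots> = ennreal (\<Prod>\<nu>=1..N. dirichlet_const (m \<nu>) (b0 \<nu>) (b \<nu>))"
    using assms by (intro prod_ennreal less_imp_le dirichlet_const_pos) auto
  finally show ?thesis .
qed

lemma set_integral_eqI_nn:
  fixes f :: "'a \<Rightarrow> real"
  assumes "A \<in> sets M" "f \<in> borel_measurable M" "\<And>x. x \<in> A \<Longrightarrow> 0 \<le> f x" "0 \<le> c"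
    "(\<integral>\<^sup>+x. ennreal (f x) * indicator A x \<partial>M) = ennreal c"
  shows "(LINT x:A|M. f x) = c"
proof -
  have "(LINT x:A|M. f x) = enn2real (\<integral>\<^sup>+x. ennreal (indicator A x *\<^sub>R f x) \<partial>M)"
    unfolding set_lebesgue_integral_def
    using assms by (intro integral_eq_nn_integral borel_measurable_scaleR borel_measurable_indicator AE_I2)
       (auto simp: indicator_def)
  also have "(\<integral>\<^sup>+x. ennreal (indicator A x *\<^sub>R f x) \<partial>M) = (\<integral>\<^sup>+x. ennreal (f x) * indicator A x \<partial>M)"
    by (intro nn_integral_cong) (auto simp: indicator_def)
  finally show ?thesis using assms by simp
qed

lemma integral_dirichlet_prior:
  assumes "\<And>\<nu>. \<nu> \<in> {1..N} \<Longrightarrow> 0 < b0 \<nu>" "\<And>\<nu> i. \<nu> \<in> {1..N} \<Longrightarrow> i \<in> {1..m \<nu>} \<Longrightarrow> 0 < b \<nu> i"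
  shows "(LINT p:param_space N m|param_lborel N m. dirichlet_prior N m b0 b p) = (\<Prod>\<nu>=1..N. dirichlet_const (m \<nu>) (b0 \<nu>) (b \<nu>))"
  using assms
  by (intro set_integral_eqI_nn param_space_sets dirichlet_prior_measurable nn_integral_dirichlet_prior dirichlet_prior_nonneg
       prod_nonneg less_imp_le dirichlet_const_pos) auto

lemma dirichlet_const_shift:
  assumes "0 \<le> s" "0 < b0" "\<And>i. i \<in> {1..k} \<Longrightarrow> 0 < b i"
  shows "dirichlet_const k (s + b0) b = dirichlet_const k b0 b * gamma_ratio s b0 (b0 + (\<Sum>i=1..k. b i))"
proof -
  have "0 \<le> (\<Sum>i=1..k. b i)" using assms by (intro sum_nonneg) (auto intro: less_imp_le)
  hence "0 < Gamma b0" "0 < Gamma (b0 + (\<Sum>i=1..k. b i))" using assms by (simp_all add: Gamma_real_pos)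
  thus ?thesis by (simp add: dirichlet_const_def gamma_ratio_def add.assoc)
qed

text \<open>
  The order of integration over \<open>p\<close> and \<open>u\<close> is exchanged by Tonelli's theorem. For fixed \<open>u\<close> the integral
  over \<open>p\<close> is a product of Dirichlet integrals with shifted parameters.
\<close>

lemma integral_shrinkage_prior:
  assumes mixing: "mixing {1..N} \<alpha> \<beta> \<gamma>"
    and b0: "\<And>\<nu>. \<nu> \<in> {1..N} \<Longrightarrow> 0 < b0 \<nu>" and b: "\<And>\<nu> i. \<nu> \<in> {1..N} \<Longrightarrow> i \<in> {1..m \<nu>} \<Longrightarrow> 0 < b \<nu> i"
  shows "(LINT p:param_space N m|param_lborel N m. shrinkage_prior N m \<alpha> \<beta> \<gamma> b0 b p)
       = (\<Prod>\<nu>=1..N. dirichlet_const (m \<nu>) (b0 \<nu>) (b \<nu>)) * mix_integral {1..N} \<alpha> \<beta> \<gamma> b0 (\<lambda>\<nu>. b0 \<nu> + (\<Sum>i=1..m \<nu>. b \<nu> i))"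
proof -
  interpret mixing "{1..N}" \<alpha> \<beta> \<gamma> by (rule mixing)
  let ?M = "param_lborel N m" and ?A = "param_space N m"
  let ?y = "\<lambda>\<nu>. b0 \<nu> + (\<Sum>i=1..m \<nu>. b \<nu> i)"
  define w where "w u = u powr (\<alpha> - 1) * exp (- \<beta> * u)" for u
  define D where "D u p = dirichlet_prior N m (\<lambda>\<nu>. \<gamma> \<nu> * u + b0 \<nu>) b p" for u p
  define c where "c = (\<Prod>\<nu>=1..N. dirichlet_const (m \<nu>) (b0 \<nu>) (b \<nu>))"
  have adm: "admissible b0 ?y"
    unfolding admissible_def using b0 b by (auto intro!: sum_nonneg intro: less_imp_le)
  have c: "0 < c" unfolding c_def using b0 b by (intro prod_pos ballI dirichlet_const_pos) auto
  have w: "0 \<le> w u" for u by (simp add: w_def)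
  have D_nonneg: "0 \<le> D u p" for u p unfolding D_def by (rule dirichlet_prior_nonneg)
  have prior: "shrinkage_prior N m \<alpha> \<beta> \<gamma> b0 b p = (LBINT u:{0<..}. w u * D u p)" for p
    unfolding shrinkage_prior_def w_def D_def dirichlet_prior_def by simp
  have mp: "(\<lambda>x. w (snd x) * D (snd x) (fst x)) \<in> borel_measurable (?M \<Otimes>\<^sub>M lborel)"
  proof -
    have "(\<lambda>x. cell_prob (m \<nu>) (fst x \<nu>) i) \<in> borel_measurable (?M \<Otimes>\<^sub>M (lborel :: real measure))"
      if "\<nu> \<in> {1..N}" "i \<le> m \<nu>" for \<nu> i
      by (rule measurable_compose[OF measurable_fst cell_prob_measurable[where \<nu> = \<nu> and i = i and m = m, OF that]])
    note cm = this
    have ex: "(\<lambda>x. \<gamma> \<nu> * snd x + b0 \<nu> - 1) \<in> borel_measurable (?M \<Otimes>\<^sub>M (lborel :: real measure))" for \<nu>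
      by measurable
    have "(\<lambda>x. D (snd x) (fst x)) \<in> borel_measurable (?M \<Otimes>\<^sub>M (lborel :: real measure))"
      unfolding D_def dirichlet_prior_def
    proof (intro borel_measurable_prod borel_measurable_times)
      fix \<nu> i assume \<nu>: "\<nu> \<in> {1..N}"
      show "(\<lambda>x. cell_prob (m \<nu>) (fst x \<nu>) 0 powr (\<gamma> \<nu> * snd x + b0 \<nu> - 1)) \<in> borel_measurable (?M \<Otimes>\<^sub>M lborel)"
        by (rule powr_real_measurable[OF cm[OF \<nu> le0] ex])
      assume "i \<in> {1..m \<nu>}"
      hence i: "i \<le> m \<nu>" by simp
      show "(\<lambda>x. cell_prob (m \<nu>) (fst x \<nu>) i powr (b \<nu> i - 1)) \<in> borel_measurable (?M \<Otimes>\<^sub>M (lborel :: real measure))"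
        by (rule powr_real_measurable[OF cm[OF \<nu> i] borel_measurable_const])
    qed
    thus ?thesis unfolding w_def by measurable
  qed
  have ind: "(\<lambda>x. indicator {0<..} (snd x)) \<in> borel_measurable (?M \<Otimes>\<^sub>M (lborel :: real measure))"
    by (rule measurable_compose[OF measurable_snd]) simp
  have prior_measurable: "shrinkage_prior N m \<alpha> \<beta> \<gamma> b0 b \<in> borel_measurable ?M"
  proof -
    have "(\<lambda>(p, u). indicator {0<..} u *\<^sub>R (w u * D u p)) \<in> borel_measurable (?M \<Otimes>\<^sub>M lborel)"
      unfolding case_prod_unfold by (rule borel_measurable_scaleR[OF ind mp])
    hence "(\<lambda>p. LINT u|lborel. indicator {0<..} u *\<^sub>R (w u * D u p)) \<in> borel_measurable ?M"
      by (rule sigma_finite_measure.borel_measurable_lebesgue_integral[OF sigma_finite_lborel])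
    moreover have "shrinkage_prior N m \<alpha> \<beta> \<gamma> b0 b = (\<lambda>p. LINT u|lborel. indicator {0<..} u *\<^sub>R (w u * D u p))"
      by (rule ext) (simp only: prior set_lebesgue_integral_def)
    ultimately show ?thesis by (simp only:)
  qed
  have prior_nonneg: "0 \<le> shrinkage_prior N m \<alpha> \<beta> \<gamma> b0 b p" for p
    unfolding prior set_lebesgue_integral_def using w D_nonneg by (intro Bochner_Integration.integral_nonneg) auto
  have prior_nn: "ennreal (shrinkage_prior N m \<alpha> \<beta> \<gamma> b0 b p) = (\<integral>\<^sup>+u. ennreal (w u * D u p) * indicator {0<..} u \<partial>lborel)"
    if p: "p \<in> ?A" for p
  proof -
    have cell0: "0 < cell_prob (m \<nu>) (p \<nu>) 0" "cell_prob (m \<nu>) (p \<nu>) 0 \<le> 1" if "\<nu> \<in> {1..N}" for \<nu>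
    proof -
      have "p \<nu> \<in> open_simplex (m \<nu>)" using p that by (auto simp: param_space_def)
      note Q = open_simplexD[OF this]
      show "0 < cell_prob (m \<nu>) (p \<nu>) 0" by (rule Q(1))
      show "cell_prob (m \<nu>) (p \<nu>) 0 \<le> 1" unfolding Q(4) using Q(2) by (auto intro!: sum_nonneg intro: less_imp_le)
    qed
    have le: "D u p \<le> D 0 p" if u: "0 < u" for u
      unfolding D_def dirichlet_prior_def
    proof (intro prod_mono conjI mult_right_mono)
      fix \<nu> assume \<nu>: "\<nu> \<in> {1..N}"
      have "0 \<le> \<gamma> \<nu> * u" using \<gamma>[of \<nu>] \<nu> u by (simp add: less_imp_le)
      thus "cell_prob (m \<nu>) (p \<nu>) 0 powr (\<gamma> \<nu> * u + b0 \<nu> - 1) \<le> cell_prob (m \<nu>) (p \<nu>) 0 powr (\<gamma> \<nu> * 0 + b0 \<nu> - 1)"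
        using cell0[OF \<nu>] by (intro powr_mono') auto
    qed (auto intro!: mult_nonneg_nonneg prod_nonneg)
    have [measurable]: "(\<lambda>u. D u p) \<in> borel_measurable lborel"
      unfolding D_def dirichlet_prior_def
      by (intro borel_measurable_prod borel_measurable_times powr_real_measurable borel_measurable_const) measurable
    have int: "integrable lborel (\<lambda>u. indicator {0<..} u *\<^sub>R (w u * D u p))"
    proof (rule Bochner_Integration.integrable_bound)
      show "integrable lborel (\<lambda>u. indicator {0<..} u *\<^sub>R (w u * D 0 p))"
        using set_integrable_mult_left[of "D 0 p" lborel "{0<..}" w] gamma_density_integrable[OF \<alpha> \<beta>]
        unfolding set_integrable_def w_def by simp
      show "(\<lambda>u. indicator {0<..} u *\<^sub>R (w u * D u p)) \<in> borel_measurable lborel"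
        unfolding w_def by measurable
      show "AE u in lborel. norm (indicator {0<..} u *\<^sub>R (w u * D u p)) \<le> norm (indicator {0<..} u *\<^sub>R (w u * D 0 p))"
        using le w D_nonneg by (intro AE_I2) (auto simp: indicator_def abs_mult intro!: mult_left_mono)
    qed
    have "(\<integral>\<^sup>+u. ennreal (indicator {0<..} u *\<^sub>R (w u * D u p)) \<partial>lborel) = ennreal (shrinkage_prior N m \<alpha> \<beta> \<gamma> b0 b p)"
      unfolding prior set_lebesgue_integral_def
      using int w D_nonneg by (intro nn_integral_eq_integral AE_I2) auto
    also have "(\<integral>\<^sup>+u. ennreal (indicator {0<..} u *\<^sub>R (w u * D u p)) \<partial>lborel) = (\<integral>\<^sup>+u. ennreal (w u * D u p) * indicator {0<..} u \<partial>lborel)"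
      by (intro nn_integral_cong) (auto simp: indicator_def)
    finally show ?thesis ..
  qed
  have inner: "(\<integral>\<^sup>+p. ennreal (D u p) * indicator ?A p \<partial>?M) = ennreal (c * (\<Prod>\<nu>\<in>{1..N}. gamma_ratio (\<gamma> \<nu> * u) (b0 \<nu>) (?y \<nu>)))"
    if u: "0 < u" for u
  proof -
    have g: "0 \<le> \<gamma> \<nu> * u" if "\<nu> \<in> {1..N}" for \<nu> using \<gamma>[of \<nu>] that u by (simp add: less_imp_le)
    have "(\<integral>\<^sup>+p. ennreal (D u p) * indicator ?A p \<partial>?M) = ennreal (\<Prod>\<nu>=1..N. dirichlet_const (m \<nu>) (\<gamma> \<nu> * u + b0 \<nu>) (b \<nu>))"
      unfolding D_def using b0 b g by (intro nn_integral_dirichlet_prior) (auto intro: add_nonneg_pos)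
    also have "(\<Prod>\<nu>=1..N. dirichlet_const (m \<nu>) (\<gamma> \<nu> * u + b0 \<nu>) (b \<nu>))
       = (\<Prod>\<nu>=1..N. dirichlet_const (m \<nu>) (b0 \<nu>) (b \<nu>) * gamma_ratio (\<gamma> \<nu> * u) (b0 \<nu>) (?y \<nu>))"
      using b0 b g by (intro prod.cong refl dirichlet_const_shift) auto
    finally show ?thesis by (simp add: c_def prod.distrib)
  qed
  have "(\<integral>\<^sup>+p. ennreal (shrinkage_prior N m \<alpha> \<beta> \<gamma> b0 b p) * indicator ?A p \<partial>?M)
     = (\<integral>\<^sup>+p. (\<integral>\<^sup>+u. ennreal (w u * D u p) * indicator {0<..} u * indicator ?A p \<partial>lborel) \<partial>?M)"
  proof (rule nn_integral_cong)
    fix p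
    show "ennreal (shrinkage_prior N m \<alpha> \<beta> \<gamma> b0 b p) * indicator ?A p
      = (\<integral>\<^sup>+u. ennreal (w u * D u p) * indicator {0<..} u * indicator ?A p \<partial>lborel)"
      using prior_nn by (cases "p \<in> ?A") auto
  qed
  also have "\<dots> = (\<integral>\<^sup>+u. (\<integral>\<^sup>+p. ennreal (w u * D u p) * indicator {0<..} u * indicator ?A p \<partial>?M) \<partial>lborel)"
  proof (rule pair_sigma_finite.Fubini'[symmetric])
    show "pair_sigma_finite ?M lborel"
      by (intro pair_sigma_finite.intro sigma_finite_param_lborel sigma_finite_lborel)
    have indA: "(\<lambda>x. indicator ?A (fst x)) \<in> borel_measurable (?M \<Otimes>\<^sub>M (lborel :: real measure))"
      by (rule measurable_compose[OF measurable_fst]) (rule borel_measurable_indicator[OF param_space_sets])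
    have indu: "(\<lambda>x. indicator {0<..} (snd x)) \<in> borel_measurable (?M \<Otimes>\<^sub>M (lborel :: real measure))"
      by (rule measurable_compose[OF measurable_snd]) simp
    show "(\<lambda>(p, u). ennreal (w u * D u p) * indicator {0<..} u * indicator ?A p) \<in> borel_measurable (?M \<Otimes>\<^sub>M lborel)"
      unfolding case_prod_unfold
      by (rule borel_measurable_times_ennreal[OF borel_measurable_times_ennreal[OF measurable_compose[OF mp measurable_ennreal] indu] indA])
  qed
  also have "\<dots> = (\<integral>\<^sup>+u. ennreal c * (ennreal (wt b0 ?y u) * indicator {0<..} u) \<partial>lborel)"
  proof (rule nn_integral_cong)
    fix u :: real
    show "(\<integral>\<^sup>+p. ennreal (w u * D u p) * indicator {0<..} u * indicator ?A p \<partial>?M) = ennreal c * (ennreal (wt b0 ?y u) * indicator {0<..} u)"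
    proof (cases "0 < u")
      case True
      have [measurable]: "?A \<in> sets ?M" by (rule param_space_sets)
      have [measurable]: "D u \<in> borel_measurable ?M" unfolding D_def[abs_def] by (rule dirichlet_prior_measurable)
      have "(\<integral>\<^sup>+p. ennreal (w u * D u p) * indicator {0<..} u * indicator ?A p \<partial>?M)
         = (\<integral>\<^sup>+p. ennreal (w u) * (ennreal (D u p) * indicator ?A p) \<partial>?M)"
        using True w by (intro nn_integral_cong) (auto simp: ennreal_mult' indicator_def)
      also have "\<dots> = ennreal (w u) * (\<integral>\<^sup>+p. (ennreal (D u p) * indicator ?A p) \<partial>?M)"
        by (rule nn_integral_cmult) measurable
      also have "\<dots> = ennreal (w u * (c * (\<Prod>\<nu>\<in>{1..N}. gamma_ratio (\<gamma> \<nu> * u) (b0 \<nu>) (?y \<nu>))))"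
        unfolding inner[OF True] using w by (simp add: ennreal_mult')
      also have "\<dots> = ennreal (c * wt b0 ?y u)" unfolding w_def mix_weight_def by (simp add: mult_ac)
      finally show ?thesis using True c by (simp add: ennreal_mult')
    qed auto
  qed
  also have "\<dots> = ennreal c * (\<integral>\<^sup>+u. ennreal (wt b0 ?y u) * indicator {0<..} u \<partial>lborel)"
    by (rule nn_integral_cmult) measurable
  also have "(\<integral>\<^sup>+u. ennreal (wt b0 ?y u) * indicator {0<..} u \<partial>lborel) = ennreal (F b0 ?y)"
  proof -
    have i: "integrable lborel (\<lambda>u. indicator {0<..} u *\<^sub>R wt b0 ?y u)"
      using wt_power_integrable[OF adm, of 0] by (simp add: set_integrable_def)
    have "(\<integral>\<^sup>+u. ennreal (indicator {0<..} u *\<^sub>R wt b0 ?y u) \<partial>lborel) = ennreal (F b0 ?y)"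
      unfolding mix_integral_def set_lebesgue_integral_def
      using i wt_pos[OF adm] by (intro nn_integral_eq_integral AE_I2) (auto simp: indicator_def less_imp_le)
    thus ?thesis by (subst nn_integral_cong) (auto simp: indicator_def)
  qed
  also have "ennreal c * ennreal (F b0 ?y) = ennreal (c * F b0 ?y)"
    using c by (simp add: ennreal_mult')
  finally show ?thesis unfolding c_def[symmetric]
    using c F_pos[OF adm] prior_nonneg prior_measurable
    by (intro set_integral_eqI_nn param_space_sets) auto
qed

section \<open>Closed forms of the predictive masses\<close>

lemma monomial_times_dirichlet_prior:
  assumes p: "p \<in> param_space N m"
  shows "(\<Prod>\<nu>=1..N. \<Prod>j=0..m \<nu>. cell_prob (m \<nu>) (p \<nu>) j ^ c \<nu> j) * dirichlet_prior N m b0 b p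
       = dirichlet_prior N m (\<lambda>\<nu>. b0 \<nu> + real (c \<nu> 0)) (\<lambda>\<nu> i. b \<nu> i + real (c \<nu> i)) p"
  unfolding dirichlet_prior_def prod.distrib[symmetric]
proof (rule prod.cong[OF refl])
  fix \<nu> assume "\<nu> \<in> {1..N}"
  hence "p \<nu> \<in> open_simplex (m \<nu>)" using p by (auto simp: param_space_def)
  note Q = open_simplexD[OF this]
  have P: "x ^ n * x powr (b - 1) = x powr (b + real n - 1)" if "0 < x" for x b :: real and n
    using that by (simp add: powr_realpow[symmetric] powr_add[symmetric] algebra_simps)
  let ?q = "cell_prob (m \<nu>) (p \<nu>)"
  have "(\<Prod>j=0..m \<nu>. ?q j ^ c \<nu> j) * (?q 0 powr (b0 \<nu> - 1) * (\<Prod>i=1..m \<nu>. ?q i powr (b \<nu> i - 1)))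
     = (?q 0 ^ c \<nu> 0 * ?q 0 powr (b0 \<nu> - 1)) * (\<Prod>i=1..m \<nu>. ?q i ^ c \<nu> i * ?q i powr (b \<nu> i - 1))"
    by (simp add: prod.atLeast_Suc_atMost prod.distrib mult_ac)
  also have "\<dots> = ?q 0 powr (b0 \<nu> + real (c \<nu> 0) - 1) * (\<Prod>i=1..m \<nu>. ?q i powr (b \<nu> i + real (c \<nu> i) - 1))"
    unfolding P[OF Q(1)] using Q(2) P by (intro arg_cong2[where f = "(*)"] refl prod.cong) auto
  finally show "(\<Prod>j=0..m \<nu>. ?q j ^ c \<nu> j) * (?q 0 powr (b0 \<nu> - 1) * (\<Prod>i=1..m \<nu>. ?q i powr (b \<nu> i - 1)))
     = ?q 0 powr (b0 \<nu> + real (c \<nu> 0) - 1) * (\<Prod>i=1..m \<nu>. ?q i powr (b \<nu> i + real (c \<nu> i) - 1))" .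
qed

definition obs_coeff :: "nat \<Rightarrow> (nat \<Rightarrow> nat) \<Rightarrow> (nat \<Rightarrow> real) \<Rightarrow> (nat \<Rightarrow> nat \<Rightarrow> nat) \<Rightarrow> real" where
  "obs_coeff N m r x = (\<Prod>\<nu>=1..N. Gamma (r \<nu> + real (obs_count m x \<nu>)) / (Gamma (r \<nu>) * (\<Prod>i=1..m \<nu>. fact (x \<nu> i))))"

lemma obs_coeff_pos:
  assumes "\<And>\<nu>. \<nu> \<in> {1..N} \<Longrightarrow> 0 < r \<nu>"
  shows "0 < obs_coeff N m r x"
  unfolding obs_coeff_def using assms
  by (intro prod_pos ballI divide_pos_pos mult_pos_pos Gamma_real_pos add_pos_nonneg of_nat_0_le_iff) auto

lemma obs_mass_times_dirichlet_prior:
  assumes p: "p \<in> param_space N m"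
  shows "obs_mass N m r p x * dirichlet_prior N m b0 b p
       = obs_coeff N m r x * dirichlet_prior N m (\<lambda>\<nu>. b0 \<nu> + r \<nu>) (\<lambda>\<nu> i. b \<nu> i + real (x \<nu> i)) p"
  unfolding dirichlet_prior_def obs_mass_def obs_coeff_def prod.distrib[symmetric]
proof (rule prod.cong[OF refl])
  fix \<nu> assume "\<nu> \<in> {1..N}"
  hence "p \<nu> \<in> open_simplex (m \<nu>)" using p by (auto simp: param_space_def)
  note Q = open_simplexD[OF this]
  have P: "x ^ n * x powr (b - 1) = x powr (b + real n - 1)" if "0 < x" for x b :: real and n
    using that by (simp add: powr_realpow[symmetric] powr_add[symmetric] algebra_simps)
  let ?q = "cell_prob (m \<nu>) (p \<nu>)"
  let ?c = "Gamma (r \<nu> + real (obs_count m x \<nu>)) / (Gamma (r \<nu>) * (\<Prod>i=1..m \<nu>. fact (x \<nu> i)))"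
  have "neg_multinomial_mass (m \<nu>) (r \<nu>) (p \<nu>) (x \<nu>) * (?q 0 powr (b0 \<nu> - 1) * (\<Prod>i=1..m \<nu>. ?q i powr (b \<nu> i - 1)))
     = ?c * ((?q 0 powr r \<nu> * ?q 0 powr (b0 \<nu> - 1)) * (\<Prod>i=1..m \<nu>. ?q i ^ x \<nu> i * ?q i powr (b \<nu> i - 1)))"
    by (simp add: neg_multinomial_mass_def obs_count_def prod.distrib mult_ac)
  also have "?q 0 powr r \<nu> * ?q 0 powr (b0 \<nu> - 1) = ?q 0 powr (b0 \<nu> + r \<nu> - 1)"
    by (simp add: powr_add[symmetric] algebra_simps)
  also have "(\<Prod>i=1..m \<nu>. ?q i ^ x \<nu> i * ?q i powr (b \<nu> i - 1)) = (\<Prod>i=1..m \<nu>. ?q i powr (b \<nu> i + real (x \<nu> i) - 1))"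
    using Q(2) P by (intro prod.cong) auto
  finally show "neg_multinomial_mass (m \<nu>) (r \<nu>) (p \<nu>) (x \<nu>) * (?q 0 powr (b0 \<nu> - 1) * (\<Prod>i=1..m \<nu>. ?q i powr (b \<nu> i - 1)))
     = ?c * (?q 0 powr (b0 \<nu> + r \<nu> - 1) * (\<Prod>i=1..m \<nu>. ?q i powr (b \<nu> i + real (x \<nu> i) - 1)))" .
qed

text \<open>
  Multiplication by the masses acts on every component of the mixture in the same way; this lifts the
  conjugacy of the Dirichlet prior to the shrinkage prior.
\<close>

lemma times_shrinkage_prior:
  assumes "\<And>b0. M * dirichlet_prior N m b0 b p = k * dirichlet_prior N m (\<lambda>\<nu>. b0 \<nu> + e \<nu>) b' p"
  shows "M * shrinkage_prior N m \<alpha> \<beta> \<gamma> b0 b p = k * shrinkage_prior N m \<alpha> \<beta> \<gamma> (\<lambda>\<nu>. b0 \<nu> + e \<nu>) b' p"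
proof -
  have prior: "shrinkage_prior N m \<alpha> \<beta> \<gamma> c0 c p
      = (LBINT u:{0<..}. u powr (\<alpha> - 1) * exp (- \<beta> * u) * dirichlet_prior N m (\<lambda>\<nu>. \<gamma> \<nu> * u + c0 \<nu>) c p)" for c0 c
    unfolding shrinkage_prior_def dirichlet_prior_def by simp
  have "M * (u powr (\<alpha> - 1) * exp (- \<beta> * u) * dirichlet_prior N m (\<lambda>\<nu>. \<gamma> \<nu> * u + b0 \<nu>) b p)
     = k * (u powr (\<alpha> - 1) * exp (- \<beta> * u) * dirichlet_prior N m (\<lambda>\<nu>. \<gamma> \<nu> * u + (b0 \<nu> + e \<nu>)) b' p)" for u
    using assms[of "\<lambda>\<nu>. \<gamma> \<nu> * u + b0 \<nu>"] by (simp add: add.assoc)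
  hence "(LBINT u:{0<..}. M * (u powr (\<alpha> - 1) * exp (- \<beta> * u) * dirichlet_prior N m (\<lambda>\<nu>. \<gamma> \<nu> * u + b0 \<nu>) b p))
      = (LBINT u:{0<..}. k * (u powr (\<alpha> - 1) * exp (- \<beta> * u) * dirichlet_prior N m (\<lambda>\<nu>. \<gamma> \<nu> * u + (b0 \<nu> + e \<nu>)) b' p))"
    by (simp only:)
  thus ?thesis unfolding prior by simp
qed

text \<open>
  Bayes' formula for a conjugate update from \<open>\<pi>\<close> to \<open>\<pi>1\<close> by the observation and to \<open>\<pi>2\<close> by the
  predicted tables; the coefficient of the observation cancels.
\<close>

lemma bayes_predictive_eq:
  assumes obs: "\<And>p. p \<in> param_space N m \<Longrightarrow> obs_mass N m r p x * \<pi> p = k * \<pi>1 p"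
    and pred: "\<And>p. p \<in> param_space N m \<Longrightarrow> pred_mass m L d l nu p w * \<pi>1 p = k' * \<pi>2 p"
    and k: "k \<noteq> 0"
    and I1: "(LINT p:param_space N m|param_lborel N m. \<pi>1 p) = Z1"
    and I2: "(LINT p:param_space N m|param_lborel N m. \<pi>2 p) = Z2"
  shows "bayes_predictive N m r L d l nu \<pi> x w = k' * Z2 / Z1"
proof -
  have "(LINT p:param_space N m|param_lborel N m. obs_mass N m r p x * \<pi> p) = (LINT p:param_space N m|param_lborel N m. k * \<pi>1 p)"
    by (intro set_lebesgue_integral_cong param_space_sets) (auto simp: obs)
  moreover have "(LINT p:param_space N m|param_lborel N m. pred_mass m L d l nu p w * (obs_mass N m r p x * \<pi> p))
      = (LINT p:param_space N m|param_lborel N m. k * (k' * \<pi>2 p))"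
    by (intro set_lebesgue_integral_cong param_space_sets allI impI) (metis obs pred mult.left_commute)
  ultimately show ?thesis unfolding bayes_predictive_def using k I1 I2 by simp
qed

section \<open>Finiteness of the risks\<close>

lemma ln_pochhammer:
  assumes "0 < (t::real)"
  shows "ln (pochhammer t (Suc c)) = ln (pochhammer t c) + ln (t + real c)"
  using assms pochhammer_pos[OF assms, of c] by (simp add: pochhammer_Suc ln_mult_pos add_pos_nonneg)

lemma Gamma_add_of_nat:
  assumes "0 < (t::real)"
  shows "Gamma (t + real c) = Gamma t * pochhammer t c"
proof -
  have "t \<notin> \<int>\<^sub>\<le>\<^sub>0" using assms by (rule pos_notin_nonpos_Ints)
  from pochhammer_Gamma[OF this, of c] Gamma_real_pos[OF assms] show ?thesis by (simp add: field_simps)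
qed

lemma dirichlet_const_ratio:
  assumes "0 < b0" "\<And>i. i \<in> {1..k} \<Longrightarrow> 0 < b i"
  shows "dirichlet_const k (b0 + real c0) (\<lambda>i. b i + real (c i)) / dirichlet_const k b0 b
       = pochhammer b0 c0 * (\<Prod>i=1..k. pochhammer (b i) (c i)) / pochhammer (b0 + (\<Sum>i=1..k. b i)) (c0 + (\<Sum>i=1..k. c i))"
proof -
  have s: "0 < b0 + (\<Sum>i=1..k. b i)"
    using assms by (intro add_pos_nonneg sum_nonneg) (auto intro: less_imp_le)
  have G1: "(\<Prod>i=1..k. Gamma (b i + real (c i))) = (\<Prod>i=1..k. Gamma (b i)) * (\<Prod>i=1..k. pochhammer (b i) (c i))"
    unfolding prod.distrib[symmetric] using assms by (intro prod.cong Gamma_add_of_nat) auto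
  have G2: "b0 + real c0 + (\<Sum>i=1..k. b i + real (c i)) = b0 + (\<Sum>i=1..k. b i) + real (c0 + (\<Sum>i=1..k. c i))"
    by (simp add: sum.distrib)
  have nz: "Gamma b0 \<noteq> 0" "Gamma (b0 + (\<Sum>i=1..k. b i)) \<noteq> 0" "(\<Prod>i=1..k. Gamma (b i)) \<noteq> 0"
    using assms s by (auto simp: Gamma_real_pos less_imp_neq[symmetric])
  have "(g * p * (G * P) / (S * s)) / (g * G / S) = p * P / s" if "g \<noteq> 0" "S \<noteq> 0" "G \<noteq> 0" for g p G P S s :: real
    using that by (simp add: field_simps)
  from this[OF nz] show ?thesis
    unfolding dirichlet_const_def G1 G2 Gamma_add_of_nat[OF assms(1)] Gamma_add_of_nat[OF s] .
qed

text \<open>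
  The predicted tables range over a finite set, so the joint expectation is a finite sum of expectations
  over the observation.
\<close>

lemma Sigma_sum_abs_summable:
  fixes f :: "'a \<times> 'b \<Rightarrow> real"
  assumes A: "countable A" and B: "finite B"
    and f: "\<And>y. y \<in> B \<Longrightarrow> Infinite_Set_Sum.abs_summable_on (\<lambda>x. f (x, y)) A"
  shows "Infinite_Set_Sum.abs_summable_on f (A \<times> B)"
    and "infsetsum f (A \<times> B) = (\<Sum>y\<in>B. \<Sum>\<^sub>ax\<in>A. f (x, y))"
proof -
  have "Infinite_Set_Sum.abs_summable_on (\<lambda>x. \<Sum>y\<in>B. norm (f (x, y))) A"
    using f by (intro abs_summable_sum abs_summable_on_normI) auto
  thus s: "Infinite_Set_Sum.abs_summable_on f (A \<times> B)"
    using A B by (subst abs_summable_on_Sigma_iff) (auto intro: countable_finite)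
  have "infsetsum f (A \<times> B) = (\<Sum>\<^sub>ax\<in>A. \<Sum>\<^sub>ay\<in>B. f (x, y))"
    using A B s by (intro infsetsum_Sigma) (auto intro: countable_finite)
  also have "\<dots> = (\<Sum>\<^sub>ax\<in>A. \<Sum>y\<in>B. f (x, y))" using B by simp
  also have "\<dots> = (\<Sum>y\<in>B. \<Sum>\<^sub>ax\<in>A. f (x, y))"
    using f by (intro sum_infsetsum[symmetric]) auto
  finally show "infsetsum f (A \<times> B) = (\<Sum>y\<in>B. \<Sum>\<^sub>ax\<in>A. f (x, y))" .
qed

lemma ln_dirichlet_const_ratio:
  assumes b0: "0 < b0" and b: "\<And>i. i \<in> {1..k} \<Longrightarrow> 0 < b i"
  shows "ln (dirichlet_const k (b0 + real c0) (\<lambda>i. b i + real (c i)) / dirichlet_const k b0 b)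
       = ln (pochhammer b0 c0) + (\<Sum>i=1..k. ln (pochhammer (b i) (c i)))
         - ln (pochhammer (b0 + (\<Sum>i=1..k. b i)) (c0 + (\<Sum>i=1..k. c i)))"
proof -
  have s: "0 < b0 + (\<Sum>i=1..k. b i)"
    using b0 b by (intro add_pos_nonneg sum_nonneg) (auto intro: less_imp_le)
  have P: "0 < (\<Prod>i=1..k. pochhammer (b i) (c i))"
    using b by (intro prod_pos ballI pochhammer_pos)
  have lnP: "ln (\<Prod>i=1..k. pochhammer (b i) (c i)) = (\<Sum>i=1..k. ln (pochhammer (b i) (c i)))"
    using b by (intro ln_prod finite_atLeastAtMost less_imp_neq[OF pochhammer_pos, symmetric])
  have "ln (A * B / S) = ln A + ln B - ln S" if "0 < A" "0 < B" "0 < S" for A B S :: real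
    using that by (simp add: ln_div ln_mult_pos)
  note ln_quot = this[OF pochhammer_pos[OF b0, of c0] P pochhammer_pos[OF s, of "c0 + (\<Sum>i=1..k. c i)"]]
  have "dirichlet_const k (b0 + real c0) (\<lambda>i. b i + real (c i)) / dirichlet_const k b0 b
      = pochhammer b0 c0 * (\<Prod>i=1..k. pochhammer (b i) (c i)) / pochhammer (b0 + (\<Sum>i=1..k. b i)) (c0 + (\<Sum>i=1..k. c i))"
    by (rule dirichlet_const_ratio) (use b0 b in auto)
  with ln_quot show ?thesis by (simp only: lnP)
qed

context observation
begin

text \<open>
  From \<open>ln t \<le> t\<close> and \<open>- ln t = ln (1 / t) \<le> 1 / t\<close>.
\<close>

lemma linearly_bounded_ln_shift:
  assumes t: "0 < t" and \<nu>: "\<nu> \<in> {1..N}" and f: "\<And>x. f x \<le> obs_count m x \<nu>"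
  shows "linearly_bounded N m (\<lambda>x. ln (t + real (f x)))"
proof -
  have "\<bar>ln (t + real (f x))\<bar> \<le> (t + 1 / t + 1) * (1 + (\<Sum>\<nu>=1..N. real (obs_count m x \<nu>)))" for x
  proof -
    let ?T = "t + real (f x)" and ?S = "\<Sum>\<nu>=1..N. real (obs_count m x \<nu>)"
    have T: "0 < ?T" using t by simp
    have "real (f x) \<le> real (obs_count m x \<nu>)" using f by simp
    also have "\<dots> \<le> ?S" using \<nu> by (intro member_le_sum) auto
    finally have fS: "real (f x) \<le> ?S" .
    have "ln ?T \<le> ?T" using ln_less_self[OF T] by simp
    moreover have "- ln ?T \<le> 1 / t"
    proof -
      have "- ln ?T = ln (1 / ?T)" using T by (simp add: ln_div)
      also have "\<dots> \<le> 1 / ?T" using T by (intro less_imp_le[OF ln_less_self]) simp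
      also have "\<dots> \<le> 1 / t" using t by (intro divide_left_mono) auto
      finally show ?thesis .
    qed
    moreover have "0 < 1 / t" using t by simp
    ultimately have "\<bar>ln ?T\<bar> \<le> t + 1 / t + ?S" using fS t by linarith
    also have "\<dots> \<le> (t + 1 / t + 1) * (1 + ?S)"
    proof -
      have "0 \<le> ?S" by (auto intro: sum_nonneg)
      hence "0 \<le> (t + 1 / t) * ?S" using t by simp
      thus ?thesis by (simp add: algebra_simps)
    qed
    finally show ?thesis .
  qed
  thus ?thesis unfolding linearly_bounded_def by blast
qed

lemma linearly_bounded_ln_pochhammer:
  assumes t: "0 < t" and \<nu>: "\<nu> \<in> {1..N}" and f: "\<And>x. f x \<le> obs_count m x \<nu>"
  shows "linearly_bounded N m (\<lambda>x. ln (pochhammer (t + real (f x)) c))"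
proof (induction c)
  case 0
  show ?case by (simp add: linearly_bounded_const)
next
  case (Suc c)
  have "ln (pochhammer (t + real (f x)) (Suc c)) = ln (pochhammer (t + real (f x)) c) + ln ((t + real c) + real (f x))" for x
    using t by (subst ln_pochhammer) (auto simp: add_ac add_pos_nonneg)
  moreover have "linearly_bounded N m (\<lambda>x. ln ((t + real c) + real (f x)))"
    using t by (intro linearly_bounded_ln_shift[OF _ \<nu> f]) auto
  ultimately show ?case using Suc by (simp add: linearly_bounded_add)
qed

text \<open>
  A single \<open>ln (Gamma (a + x))\<close> grows faster than linearly in \<open>x\<close>. The differences that occur here have
  integer increments and are therefore logarithms of Pochhammer symbols of fixed degree.
\<close>

lemma linearly_bounded_ln_dirichlet_ratio:
  assumes \<nu>: "\<nu> \<in> {1..N}" and b0: "0 < b0" and a: "\<And>i. i \<in> {1..m \<nu>} \<Longrightarrow> 0 < a i"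
  shows "linearly_bounded N m (\<lambda>x. ln (dirichlet_const (m \<nu>) (b0 + real c0) (\<lambda>i. a i + real (x \<nu> i) + real (c i))
           / dirichlet_const (m \<nu>) b0 (\<lambda>i. a i + real (x \<nu> i))))"
proof -
  have s: "b0 + (\<Sum>i=1..m \<nu>. a i + real (x \<nu> i)) = b0 + (\<Sum>i=1..m \<nu>. a i) + real (obs_count m x \<nu>)" for x
    by (simp add: obs_count_def sum.distrib)
  have eq: "ln (dirichlet_const (m \<nu>) (b0 + real c0) (\<lambda>i. a i + real (x \<nu> i) + real (c i))
           / dirichlet_const (m \<nu>) b0 (\<lambda>i. a i + real (x \<nu> i)))
       = ln (pochhammer b0 c0) + (\<Sum>i=1..m \<nu>. ln (pochhammer (a i + real (x \<nu> i)) (c i)))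
         - ln (pochhammer (b0 + (\<Sum>i=1..m \<nu>. a i) + real (obs_count m x \<nu>)) (c0 + (\<Sum>i=1..m \<nu>. c i)))" for x
    unfolding s[symmetric] by (rule ln_dirichlet_const_ratio[OF b0]) (simp add: a add_pos_nonneg)
  show ?thesis unfolding eq
  proof (intro linearly_bounded_diff linearly_bounded_const linearly_bounded_sum linearly_bounded_add finite_atLeastAtMost)
    show "linearly_bounded N m (\<lambda>x. ln (pochhammer (a i + real (x \<nu> i)) (c i)))" if i: "i \<in> {1..m \<nu>}" for i
      using a[OF i] member_le_sum[of i "{1..m \<nu>}"] i
      by (intro linearly_bounded_ln_pochhammer[OF _ \<nu>]) (auto simp: obs_count_def)
    have "0 \<le> (\<Sum>i=1..m \<nu>. a i)" using a by (intro sum_nonneg) (auto intro: less_imp_le)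
    thus "linearly_bounded N m (\<lambda>x. ln (pochhammer (b0 + (\<Sum>i=1..m \<nu>. a i) + real (obs_count m x \<nu>)) (c0 + (\<Sum>i=1..m \<nu>. c i))))"
      using b0 by (intro linearly_bounded_ln_pochhammer[OF _ \<nu>]) auto
  qed
qed

lemma integral_joint_law:
  assumes mass: "\<And>w. w \<in> pred_space m L d l nu \<Longrightarrow> 0 \<le> pred_mass m L d l nu p w"
    and h: "\<And>w. w \<in> pred_space m L d l nu \<Longrightarrow> linearly_bounded N m (\<lambda>x. h x w)"
  shows "integrable (joint_law N m r L d l nu p) (\<lambda>(x, w). h x w)"
    and "(LINT (x, w)|joint_law N m r L d l nu p. h x w)
       = (\<Sum>w\<in>pred_space m L d l nu. pred_mass m L d l nu p w * obs_expectation (\<lambda>x. h x w))"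
proof -
  let ?W = "pred_space m L d l nu" and ?X = "obs_space N m"
  let ?f = "\<lambda>xw. obs_mass N m r p (fst xw) * pred_mass m L d l nu p (snd xw)"
  let ?g = "\<lambda>xw. ?f xw *\<^sub>R h (fst xw) (snd xw)"
  have law: "joint_law N m r L d l nu p = density (count_space (?X \<times> ?W)) (\<lambda>xw. ennreal (?f xw))"
    unfolding joint_law_def point_measure_def by (simp add: case_prod_unfold)
  have f0: "AE xw in count_space (?X \<times> ?W). 0 \<le> ?f xw"
    using mass obs_mass_pos by (auto simp: AE_count_space intro!: mult_nonneg_nonneg less_imp_le[OF obs_mass_pos])
  have sm: "Infinite_Set_Sum.abs_summable_on (\<lambda>x. ?g (x, w)) ?X" if "w \<in> ?W" for w
    using abs_summable_on_cmult_right[OF linearly_bounded_summable[OF h[OF that]], of "pred_mass m L d l nu p w"]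
    by (simp add: mult_ac)
  note S = Sigma_sum_abs_summable[OF countable_obs_space finite_pred_space, of m L d l nu ?g N m, OF sm]
  have i: "integrable (count_space (?X \<times> ?W)) ?g" using S(1) by (simp add: abs_summable_on_def)
  show "integrable (joint_law N m r L d l nu p) (\<lambda>(x, w). h x w)"
    unfolding law case_prod_unfold by (subst integrable_density) (use i f0 in auto)
  have "(LINT (x, w)|joint_law N m r L d l nu p. h x w) = integral\<^sup>L (count_space (?X \<times> ?W)) ?g"
    unfolding law case_prod_unfold by (subst integral_density) (use f0 in auto)
  also have "\<dots> = infsetsum ?g (?X \<times> ?W)" by (simp add: infsetsum_def)
  also have "\<dots> = (\<Sum>w\<in>?W. \<Sum>\<^sub>ax\<in>?X. ?g (x, w))" by (rule S(2))
  also have "\<dots> = (\<Sum>w\<in>?W. pred_mass m L d l nu p w * obs_expectation (\<lambda>x. h x w))"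
  proof (rule sum.cong[OF refl])
    fix w assume w: "w \<in> ?W"
    show "(\<Sum>\<^sub>ax\<in>?X. ?g (x, w)) = pred_mass m L d l nu p w * obs_expectation (\<lambda>x. h x w)"
      unfolding obs_expectation_def
      using infsetsum_cmult_right[of "pred_mass m L d l nu p w" "\<lambda>x. obs_mass N m r p x * h x w" ?X]
        linearly_bounded_summable[OF h[OF w]] by (simp add: mult_ac)
  qed
  finally show "(LINT (x, w)|joint_law N m r L d l nu p. h x w)
       = (\<Sum>w\<in>?W. pred_mass m L d l nu p w * obs_expectation (\<lambda>x. h x w))" .
qed

end

section \<open>Dominance\<close>

lemma param_space_nonempty: "param_space N m \<noteq> {}"
proof -
  define p where "p = (\<lambda>\<nu>\<in>{1..N}. \<lambda>i\<in>{1..m \<nu>}. 1 / (real (m \<nu>) + 1))"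
  have "p \<in> param_space N m"
    unfolding param_space_def
  proof (rule PiE_I)
    fix \<nu> assume \<nu>: "\<nu> \<in> {1..N}"
    have "(\<Sum>i=1..m \<nu>. p \<nu> i) = (\<Sum>i=1..m \<nu>. 1 / (real (m \<nu>) + 1))" using \<nu> by (simp add: p_def)
    also have "\<dots> < 1" by (simp add: divide_less_eq)
    finally have "(\<Sum>i=1..m \<nu>. p \<nu> i) < 1" .
    thus "p \<nu> \<in> open_simplex (m \<nu>)" using \<nu> by (auto simp: open_simplex_def p_def)
  qed (auto simp: p_def)
  thus ?thesis by blast
qed

theorem theorem3p1:
  fixes N L :: nat
    and m d l :: "nat \<Rightarrow> nat"
    and nu :: "nat \<Rightarrow> nat \<Rightarrow> nat"
    and r \<gamma> a0 :: "nat \<Rightarrow> real"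
    and a :: "nat \<Rightarrow> nat \<Rightarrow> real"
    and \<alpha> \<beta> :: real
  assumes "1 \<le> N"
    and "\<And>\<nu>. \<nu> \<in> {1..N} \<Longrightarrow> 1 \<le> m \<nu>"
    and "\<And>\<nu>. \<nu> \<in> {1..N} \<Longrightarrow> 0 < r \<nu>"
    and "1 \<le> L"
    and "\<And>lam. lam \<in> {1..L} \<Longrightarrow> d lam \<in> {1..N}"
    and "\<And>lam. lam \<in> {1..L} \<Longrightarrow> 1 \<le> l lam"
    and "\<And>lam. lam \<in> {1..L} \<Longrightarrow> strict_mono_on {1..d lam} (nu lam)"
    and "\<And>lam h. lam \<in> {1..L} \<Longrightarrow> h \<in> {1..d lam} \<Longrightarrow> nu lam h \<in> {1..N}"
    and "0 < \<alpha>" and "0 < \<beta>"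
    and "\<And>\<nu>. \<nu> \<in> {1..N} \<Longrightarrow> 0 < \<gamma> \<nu>"
    and "\<And>\<nu> i. \<nu> \<in> {1..N} \<Longrightarrow> i \<in> {1..m \<nu>} \<Longrightarrow> 0 < a \<nu> i"
    and "\<And>\<nu>. \<nu> \<in> {1..N} \<Longrightarrow> 0 < r \<nu> + a0 \<nu>"
    and "\<And>\<nu>. \<nu> \<in> {1..N} \<Longrightarrow> 1 \<le> r \<nu>"
    and "\<And>\<nu> (y::nat). \<nu> \<in> {1..N} \<Longrightarrow> 1 \<le> y \<Longrightarrow>
           ((\<alpha> + 1) * \<gamma> \<nu> / (\<beta> + \<gamma> \<nu>) - (\<Sum>i=1..m \<nu>. a \<nu> i)) * (r \<nu> - 1)
           \<le> real y * (- ((\<alpha> + 1) * \<gamma> \<nu> / (\<beta> + \<gamma> \<nu>))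
                        - real (\<Sum>lam\<in>tables_involving L d nu \<nu>. l lam) - a0 \<nu>)"
  shows "kl_dominates N m r L d l nu
           (bayes_predictive N m r L d l nu (shrinkage_prior N m \<alpha> \<beta> \<gamma> a0 a))
           (bayes_predictive N m r L d l nu (dirichlet_prior N m a0 a))"
proof -
  define asum where "asum \<nu> = (\<Sum>i=1..m \<nu>. a \<nu> i)" for \<nu>
  define K where "K = pred_hits L d l nu"
  let ?W = "pred_space m L d l nu" and ?X = "obs_space N m"
  define gS where "gS = bayes_predictive N m r L d l nu (shrinkage_prior N m \<alpha> \<beta> \<gamma> a0 a)"
  define gD where "gD = bayes_predictive N m r L d l nu (dirichlet_prior N m a0 a)"
  have K: "K \<nu> = (\<Sum>lam\<in>tables_involving L d nu \<nu>. l lam)" for \<nu>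
    unfolding K_def by (rule pred_hits_strict_mono[OF assms(7)])
  have setting: "shrinkage_setting N m r p \<alpha> \<beta> \<gamma> a0 asum K" if p: "p \<in> param_space N m" for p
  proof
    show "p \<in> param_space N m" by (rule p)
    show "0 < asum \<nu>" if "\<nu> \<in> {1..N}" for \<nu>
      unfolding asum_def using assms(2,12)[OF that] by (intro sum_pos) auto
    show "((\<alpha> + 1) * \<gamma> \<nu> / (\<beta> + \<gamma> \<nu>) - asum \<nu>) * (r \<nu> - 1)
           \<le> real n * (- ((\<alpha> + 1) * \<gamma> \<nu> / (\<beta> + \<gamma> \<nu>)) - real (K \<nu>) - a0 \<nu>)"
      if "\<nu> \<in> {1..N}" "1 \<le> n" for \<nu> n
      using assms(15)[OF that] unfolding asum_def K .
  qed (use assms in auto)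
  define C where "C w = pred_count m L d nu w" for w
  define b0 where "b0 \<nu> = a0 \<nu> + r \<nu>" for \<nu>
  define b where "b x \<nu> i = a \<nu> i + real (x \<nu> i)" for x :: "nat \<Rightarrow> nat \<Rightarrow> nat" and \<nu> i
  have b0: "0 < b0 \<nu>" if "\<nu> \<in> {1..N}" for \<nu> using assms(13)[OF that] by (simp add: b0_def)
  have b: "0 < b x \<nu> i" if "\<nu> \<in> {1..N}" "i \<in> {1..m \<nu>}" for x \<nu> i
    using assms(12)[OF that] by (simp add: b_def add_pos_nonneg)
  define Z1 where "Z1 x = (\<Prod>\<nu>=1..N. dirichlet_const (m \<nu>) (b0 \<nu>) (b x \<nu>))" for x
  define Z2 where "Z2 x w = (\<Prod>\<nu>=1..N. dirichlet_const (m \<nu>) (b0 \<nu> + real (C w \<nu> 0)) (\<lambda>i. b x \<nu> i + real (C w \<nu> i)))" for x w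
  have Z: "0 < Z1 x" "0 < Z2 x w" for x w
    unfolding Z1_def Z2_def using b0 b by (auto intro!: prod_pos dirichlet_const_pos add_pos_nonneg)
  define pc where "pc = pred_coeff m L d l nu"
  have pc: "0 < pc w" for w unfolding pc_def by (rule pred_coeff_pos)
  have oc: "obs_coeff N m r x \<noteq> 0" for x
    using obs_coeff_pos[of N r m x] assms(3) by simp
  have mass_counts: "pred_mass m L d l nu p w = pc w * (\<Prod>\<nu>=1..N. \<Prod>j=0..m \<nu>. cell_prob (m \<nu>) (p \<nu>) j ^ C w \<nu> j)" for p w
    unfolding pc_def C_def by (rule pred_mass_counts) (use assms(8) in auto)
  have pred_mult: "pred_mass m L d l nu p w * dirichlet_prior N m c0 c p
      = pc w * dirichlet_prior N m (\<lambda>\<nu>. c0 \<nu> + real (C w \<nu> 0)) (\<lambda>\<nu> i. c \<nu> i + real (C w \<nu> i)) p"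
    if "p \<in> param_space N m" for p w c0 c
    unfolding mass_counts using monomial_times_dirichlet_prior[OF that, of "C w" c0 c] by (simp add: mult.assoc)
  have gD: "gD x w = pc w * Z2 x w / Z1 x" for x w
    unfolding gD_def
  proof (rule bayes_predictive_eq[OF obs_mass_times_dirichlet_prior pred_mult oc])
    show "(LINT p:param_space N m|param_lborel N m. dirichlet_prior N m (\<lambda>\<nu>. a0 \<nu> + r \<nu>) (\<lambda>\<nu> i. a \<nu> i + real (x \<nu> i)) p) = Z1 x"
      using integral_dirichlet_prior[of N b0 m "b x"] b0 b unfolding Z1_def b0_def[abs_def] b_def[abs_def] by simp
    show "(LINT p:param_space N m|param_lborel N m. dirichlet_prior N m (\<lambda>\<nu>. a0 \<nu> + r \<nu> + real (C w \<nu> 0))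
            (\<lambda>\<nu> i. a \<nu> i + real (x \<nu> i) + real (C w \<nu> i)) p) = Z2 x w"
      using integral_dirichlet_prior[of N "\<lambda>\<nu>. b0 \<nu> + real (C w \<nu> 0)" m "\<lambda>\<nu> i. b x \<nu> i + real (C w \<nu> i)"] b0 b
      unfolding Z2_def by (simp add: b0_def b_def add_pos_nonneg)
  qed
  have mixing: "mixing {1..N} \<alpha> \<beta> \<gamma>" by unfold_locales (use assms in auto)
  \<comment> \<open>\<open>\<Phi> c k x\<close> is \<open>F\<close> at the parameters of \<open>zero_par c\<close> and \<open>total_par k (obs_count m x)\<close>. It is written
    out because these depend on a locale with a fixed true parameter, and the predictive masses do not.\<close>
  define \<Phi> where "\<Phi> c k x = mix_integral {1..N} \<alpha> \<beta> \<gamma> (\<lambda>\<nu>. r \<nu> + a0 \<nu> + real (c \<nu>))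
      (\<lambda>\<nu>. r \<nu> + a0 \<nu> + asum \<nu> + real (k \<nu>) + real (obs_count m x \<nu>))" for c k :: "nat \<Rightarrow> nat" and x
  have gS: "gS x w = pc w * (Z2 x w * \<Phi> (\<lambda>\<nu>. C w \<nu> 0) K x) / (Z1 x * \<Phi> (\<lambda>_. 0) (\<lambda>_. 0) x)" if w: "w \<in> ?W" for x w
    unfolding gS_def
  proof (rule bayes_predictive_eq[OF times_shrinkage_prior[OF obs_mass_times_dirichlet_prior] times_shrinkage_prior[OF pred_mult] oc])
    have sb: "(\<Sum>i=1..m \<nu>. b x \<nu> i) = asum \<nu> + real (obs_count m x \<nu>)" for \<nu>
      by (simp add: b_def asum_def obs_count_def sum.distrib)
    have sC: "C w \<nu> 0 + (\<Sum>i=1..m \<nu>. C w \<nu> i) = K \<nu>" for \<nu>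
      using pred_count_total[OF w, of \<nu>] by (simp add: C_def K_def sum.atLeast_Suc_atMost)
    have sC': "real (C w \<nu> 0) + (\<Sum>i=1..m \<nu>. real (C w \<nu> i)) = real (K \<nu>)" for \<nu>
      unfolding sC[symmetric] by simp
    have "(LINT p:param_space N m|param_lborel N m. shrinkage_prior N m \<alpha> \<beta> \<gamma> b0 (b x) p)
       = Z1 x * mix_integral {1..N} \<alpha> \<beta> \<gamma> b0 (\<lambda>\<nu>. b0 \<nu> + (\<Sum>i=1..m \<nu>. b x \<nu> i))"
      unfolding Z1_def using b0 b by (intro integral_shrinkage_prior mixing)
    also have "mix_integral {1..N} \<alpha> \<beta> \<gamma> b0 (\<lambda>\<nu>. b0 \<nu> + (\<Sum>i=1..m \<nu>. b x \<nu> i)) = \<Phi> (\<lambda>_. 0) (\<lambda>_. 0) x"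
      unfolding \<Phi>_def sb by (intro arg_cong2[where f = "mix_integral {1..N} \<alpha> \<beta> \<gamma>"] ext) (auto simp: b0_def)
    finally show "(LINT p:param_space N m|param_lborel N m. shrinkage_prior N m \<alpha> \<beta> \<gamma> (\<lambda>\<nu>. a0 \<nu> + r \<nu>) (\<lambda>\<nu> i. a \<nu> i + real (x \<nu> i)) p)
       = Z1 x * \<Phi> (\<lambda>_. 0) (\<lambda>_. 0) x" unfolding b0_def b_def .
    have "(LINT p:param_space N m|param_lborel N m. shrinkage_prior N m \<alpha> \<beta> \<gamma> (\<lambda>\<nu>. b0 \<nu> + real (C w \<nu> 0)) (\<lambda>\<nu> i. b x \<nu> i + real (C w \<nu> i)) p)
       = Z2 x w * mix_integral {1..N} \<alpha> \<beta> \<gamma> (\<lambda>\<nu>. b0 \<nu> + real (C w \<nu> 0))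
            (\<lambda>\<nu>. b0 \<nu> + real (C w \<nu> 0) + (\<Sum>i=1..m \<nu>. b x \<nu> i + real (C w \<nu> i)))"
      unfolding Z2_def using b0 b by (intro integral_shrinkage_prior mixing) (auto intro: add_pos_nonneg)
    also have "mix_integral {1..N} \<alpha> \<beta> \<gamma> (\<lambda>\<nu>. b0 \<nu> + real (C w \<nu> 0))
            (\<lambda>\<nu>. b0 \<nu> + real (C w \<nu> 0) + (\<Sum>i=1..m \<nu>. b x \<nu> i + real (C w \<nu> i))) = \<Phi> (\<lambda>\<nu>. C w \<nu> 0) K x"
      unfolding \<Phi>_def
    proof (intro arg_cong2[where f = "mix_integral {1..N} \<alpha> \<beta> \<gamma>"] ext)
      fix \<nu>
      show "b0 \<nu> + real (C w \<nu> 0) + (\<Sum>i=1..m \<nu>. b x \<nu> i + real (C w \<nu> i))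
          = r \<nu> + a0 \<nu> + asum \<nu> + real (K \<nu>) + real (obs_count m x \<nu>)"
        unfolding sum.distrib sb sC'[symmetric] by (simp add: b0_def)
    qed (simp add: b0_def)
    finally show "(LINT p:param_space N m|param_lborel N m. shrinkage_prior N m \<alpha> \<beta> \<gamma> (\<lambda>\<nu>. a0 \<nu> + r \<nu> + real (C w \<nu> 0))
        (\<lambda>\<nu> i. a \<nu> i + real (x \<nu> i) + real (C w \<nu> i)) p) = Z2 x w * \<Phi> (\<lambda>\<nu>. C w \<nu> 0) K x" unfolding b0_def b_def .
  qed
  have main: "kl_risk_exists N m r L d l nu gS p \<and> kl_risk_exists N m r L d l nu gD p \<and>
      kl_risk N m r L d l nu gS p < kl_risk N m r L d l nu gD p" if p: "p \<in> param_space N m" for p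
  proof -
    interpret shrinkage_setting N m r p \<alpha> \<beta> \<gamma> a0 asum K by (rule setting[OF p])
    have log_gain: "log_gain c k (obs_count m x) = ln (\<Phi> c k x)" for c k x
      unfolding log_gain_def \<Phi>_def zero_par_def[abs_def] total_par_def[abs_def] ..
    have CK: "C w \<nu> 0 \<le> K \<nu>" if "w \<in> ?W" for w \<nu>
      unfolding C_def K_def by (rule pred_count_le_hits[OF that])
    have \<Phi>: "0 < \<Phi> (\<lambda>\<nu>. C w \<nu> 0) K x" "0 < \<Phi> (\<lambda>_. 0) (\<lambda>_. 0) x" if "w \<in> ?W" for w x
      using F_pos[OF admissible_par[of "\<lambda>\<nu>. C w \<nu> 0" K "obs_count m x"]] F_pos[OF admissible_par[of "\<lambda>_. 0" "\<lambda>_. 0" "obs_count m x"]] CK[OF that]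
      unfolding \<Phi>_def zero_par_def[abs_def] total_par_def[abs_def] by auto
    have gD_pos: "0 < gD x w" for x w unfolding gD using pc Z by simp
    have gS_pos: "0 < gS x w" if "w \<in> ?W" for x w unfolding gS[OF that] using pc Z \<Phi>[OF that] by simp
    have q_pos: "0 < cell_prob (m \<nu>) (p \<nu>) j" if "\<nu> \<in> {1..N}" "j \<le> m \<nu>" for \<nu> j
      using open_simplexD(3)[OF p_simplex[OF that(1)] that(2)] .
    have q_sum: "(\<Sum>j=0..m \<nu>. cell_prob (m \<nu>) (p \<nu>) j) = 1" if "\<nu> \<in> {1..N}" for \<nu>
      using open_simplexD(5)[OF p_simplex[OF that]] .
    have mass_pos: "0 < pred_mass m L d l nu p w" for w
      unfolding mass_counts by (intro mult_pos_pos pc prod_pos ballI zero_less_power q_pos) auto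
    define hD where "hD x w = ln (pred_mass m L d l nu p w / gD x w)" for x w
    define hS where "hS x w = ln (pred_mass m L d l nu p w / gS x w)" for x w
    define G where "G x w = log_gain (\<lambda>\<nu>. C w \<nu> 0) K (obs_count m x) - log_gain (\<lambda>_. 0) (\<lambda>_. 0) (obs_count m x)" for x w
    have hDS: "hS x w = hD x w - G x w" if w: "w \<in> ?W" for x w
    proof -
      have "gS x w = gD x w * (\<Phi> (\<lambda>\<nu>. C w \<nu> 0) K x / \<Phi> (\<lambda>_. 0) (\<lambda>_. 0) x)"
        unfolding gS[OF w] gD by simp
      hence "ln (gS x w) = ln (gD x w) + (ln (\<Phi> (\<lambda>\<nu>. C w \<nu> 0) K x) - ln (\<Phi> (\<lambda>_. 0) (\<lambda>_. 0) x))"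
        using gD_pos[of x w] \<Phi>[OF w, of x] by (simp add: ln_mult_pos ln_div)
      thus ?thesis unfolding hS_def hD_def G_def log_gain
        using gD_pos[of x w] gS_pos[OF w, of x] mass_pos[of w] by (simp add: ln_div)
    qed
    have lbG: "linearly_bounded N m (\<lambda>x. G x w)" if "w \<in> ?W" for w
      unfolding G_def using CK[OF that] by (intro linearly_bounded_diff log_gain_linearly_bounded) auto
    have lbD: "linearly_bounded N m (\<lambda>x. hD x w)" for w
    proof -
      let ?R = "\<lambda>x \<nu>. dirichlet_const (m \<nu>) (b0 \<nu> + real (C w \<nu> 0)) (\<lambda>i. b x \<nu> i + real (C w \<nu> i))
          / dirichlet_const (m \<nu>) (b0 \<nu>) (b x \<nu>)"
      have eq: "hD x w = (ln (pred_mass m L d l nu p w) - ln (pc w)) - (\<Sum>\<nu>=1..N. ln (?R x \<nu>))" for x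
      proof -
        have "0 < ?R x \<nu>" if "\<nu> \<in> {1..N}" for \<nu>
          using b0[OF that] b[OF that] by (intro divide_pos_pos dirichlet_const_pos) (auto intro: add_pos_nonneg)
        hence "ln (\<Prod>\<nu>=1..N. ?R x \<nu>) = (\<Sum>\<nu>=1..N. ln (?R x \<nu>))"
          by (intro ln_prod finite_atLeastAtMost less_imp_neq[symmetric])
        moreover have "Z2 x w / Z1 x = (\<Prod>\<nu>=1..N. ?R x \<nu>)"
          unfolding Z1_def Z2_def by (rule prod_dividef[symmetric])
        ultimately have "ln (Z2 x w / Z1 x) = (\<Sum>\<nu>=1..N. ln (?R x \<nu>))" by (simp only:)
        moreover have "ln (gD x w) = ln (pc w) + ln (Z2 x w / Z1 x)"
          unfolding gD times_divide_eq_right[symmetric] by (rule ln_mult_pos[OF pc divide_pos_pos[OF Z(2,1)]])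
        moreover have "hD x w = ln (pred_mass m L d l nu p w) - ln (gD x w)"
          unfolding hD_def by (rule ln_divide_pos[OF mass_pos gD_pos])
        ultimately show ?thesis by linarith
      qed
      show ?thesis unfolding eq b_def
        by (intro linearly_bounded_diff[OF linearly_bounded_const] linearly_bounded_sum finite_atLeastAtMost
              linearly_bounded_ln_dirichlet_ratio b0 assms(12))
    qed
    have lbS: "linearly_bounded N m (\<lambda>x. hS x w)" if "w \<in> ?W" for w
      unfolding hDS[OF that] by (rule linearly_bounded_diff[OF lbD lbG[OF that]])
    have mass0: "0 \<le> pred_mass m L d l nu p w" for w using mass_pos[of w] by simp
    have exD: "kl_risk_exists N m r L d l nu gD p"
      unfolding kl_risk_exists_def using gD_pos integral_joint_law(1)[where h = hD, OF mass0 lbD] unfolding hD_def by blast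
    have exS: "kl_risk_exists N m r L d l nu gS p"
      unfolding kl_risk_exists_def using gS_pos integral_joint_law(1)[where h = hS, OF mass0 lbS] unfolding hS_def by blast
    have riskD: "kl_risk N m r L d l nu gD p = (\<Sum>w\<in>?W. pred_mass m L d l nu p w * obs_expectation (\<lambda>x. hD x w))"
      unfolding kl_risk_def using integral_joint_law(2)[where h = hD, OF mass0 lbD] unfolding hD_def .
    have riskS: "kl_risk N m r L d l nu gS p = (\<Sum>w\<in>?W. pred_mass m L d l nu p w * obs_expectation (\<lambda>x. hS x w))"
      unfolding kl_risk_def using integral_joint_law(2)[where h = hS, OF mass0 lbS] unfolding hS_def .
    \<comment> \<open>Normalized to vanish in the initial state. A constant does not affect the drift condition, because the
      weights of a draw add up to \<open>1\<close>.\<close>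
    define U where "U c k = potential c k - potential (\<lambda>_. 0) (\<lambda>_. 0)" for c k
    have EG: "obs_expectation (\<lambda>x. hD x w) - obs_expectation (\<lambda>x. hS x w) = U (\<lambda>\<nu>. C w \<nu> 0) K" if w: "w \<in> ?W" for w
    proof -
      have "obs_expectation (\<lambda>x. hS x w) = obs_expectation (\<lambda>x. hD x w) - obs_expectation (\<lambda>x. G x w)"
        unfolding hDS[OF w] by (rule obs_expectation_diff[OF lbD lbG[OF w]])
      moreover have "obs_expectation (\<lambda>x. G x w) = U (\<lambda>\<nu>. C w \<nu> 0) K"
        unfolding G_def U_def potential_def using CK[OF w]
        by (intro obs_expectation_diff log_gain_linearly_bounded) auto
      ultimately show ?thesis by simp
    qed
    have "kl_risk N m r L d l nu gD p - kl_risk N m r L d l nu gS p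
        = (\<Sum>w\<in>?W. pred_mass m L d l nu p w * U (\<lambda>\<nu>. C w \<nu> 0) K)"
      unfolding riskD riskS sum_subtractf[symmetric]
      by (intro sum.cong refl) (simp add: EG[symmetric] right_diff_distrib)
    moreover have "0 < (\<Sum>w\<in>?W. pred_mass m L d l nu p w * U (\<lambda>\<nu>. C w \<nu> 0) K)"
    proof -
      interpret U: drift N m p U K
      proof
        fix \<nu> c k assume A: "\<nu> \<in> {1..N}" "\<And>\<mu>. \<mu> \<in> {1..N} \<Longrightarrow> c \<mu> \<le> k \<mu>" "k \<nu> < K \<nu>"
        show "U c k < cell_prob (m \<nu>) (p \<nu>) 0 * U (c(\<nu> := Suc (c \<nu>))) (k(\<nu> := Suc (k \<nu>)))
            + (1 - cell_prob (m \<nu>) (p \<nu>) 0) * U c (k(\<nu> := Suc (k \<nu>)))"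
          using potential_drift[where \<nu> = \<nu> and c = c and k = k, OF A] unfolding U_def by (simp add: algebra_simps)
      qed (use q_pos q_sum in auto)
      have "U (\<lambda>_. 0) (\<lambda>_. 0) < (\<Sum>w\<in>?W. pred_mass m L d l nu p w *
            U (\<lambda>\<nu>. 0 + pred_count m L d nu w \<nu> 0) (\<lambda>\<nu>. 0 + pred_hits L d l nu \<nu>))"
      proof (rule U.all_tables_drift[THEN conjunct2, rule_format])
        show "0 < d lam" "0 < l lam" if "lam \<in> {1..L}" for lam using assms(5,6)[OF that] by auto
      qed (use assms in \<open>auto simp: K_def\<close>)
      thus ?thesis by (simp add: U_def C_def K_def)
    qed
    ultimately have "kl_risk N m r L d l nu gS p < kl_risk N m r L d l nu gD p" by simp
    thus ?thesis using exD exS by blast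
  qed
  obtain p where "p \<in> param_space N m" using param_space_nonempty by blast
  thus ?thesis unfolding kl_dominates_def gS_def[symmetric] gD_def[symmetric]
    using main by (blast intro: less_imp_le)
qed

end
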